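(* In type $E_8^{(1)}$, let $(z^{n_r}y_r)_{r\ge0}\in\mathcal Z(\Lambda_0)$ and $r\ge0$. If $H_{\mathrm{aff}}(z^{n_{r+1}}y_{r+1}\otimes z^{n_r}y_r)\ne2$, then whenever the Young wall contains a block in column $r+1$ it also contains the block occupying the same position in column $r$.
   Context: **Notation.** $\hat{\mathfrak g}$ is the untwisted affine Kac–Moody algebra of type $E_8^{(1)}$, $I=\{0,\dots,8\}$, with fundamental weights $\Lambda_i$. Dynkin diagram (Bourbaki): chain $0-8-7-6-5-4-3-1$ together with $4-2$. **Crystals.** On a tensor product of crystals: $\tilde f_i(b\otimes b')=\tilde f_ib\otimes b'$ if $\varphi_i(b)>\varepsilon_i(b')$ and $b\otimes\tilde f_ib'$ otherwise; $\tilde e_i(b\otimes b')=\tilde e_ib\otimes b'$ if $\varphi_i(b)\ge\varepsilon_i(b')$ and $b\otimes\tilde e_ib'$ otherwise. The affinization of a classical crystal $C$ is $C_{\mathrm{aff}}=\{z^mc:m\in\mathbb Z,c\in C\}$ with $\tilde e_i(z^mc)=z^{m+\delta_{i0}}\tilde e_ic$, $\tilde f_i(z^mc)=z^{m-\delta_{i0}}\tilde f_ic$, and $\varepsilon_i,\varphi_i$ as for $c$. **Young column pattern.** An infinite vertical strip of unit cubes indexed by $k\in\mathbb Z$ (height increasing with $k$), each cut by vertical cuts into blocks coloured by $I$. The horizontal cross-section of every cube is a grid with $6$ columns of cells (numbered $1,\dots,6$ from left to right) and two rows (upper, lower). A block is the full-height prism over a union of cells. Write $u/l$ for a cross-section whose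 upper row has colours $u$ and lower row has colours $l$ (just $u$ if both rows agree); equally coloured cells of one cube form a single block, except that a cube $444444$ consists of two $4$-blocks, one over cell columns 1–3 and one over cell columns 4–6. Rotation by $180^\circ$ sends $u/l$ to $\mathrm{rev}(l)/\mathrm{rev}(u)$, where rev reverses a word. The pattern has period 20: cubes $1,\dots,10$ are $775522/075552$; $866444$; $755533/775533$; $664441$; $552233/555233$; $444444$; $332555/332255$; $144466$; $335577/335557$; $444668$; and cube $k+10$ is the rotation of cube $k$ for all $k$. **Young columns.** A Young column is a nonempty collection of blocks of the pattern of bounded height with no empty space below any block (if a block of cube $k$ belongs to it, so does every block of cube $k-1$ lying below at least one of its cells), or a member of one of two further equivalence classes, those of: (S1) all blocks of cubes $k\le4$, the $5$- and $3$-blocks of cube 5, and the $4$-block over cell columns 4–6 of cube 6; (S2) all blocks of cubes $k\le5$, the $4$-block over cell columns 4–6 of cube 6, and the $2$-block of cube 7. Young columns are equivalent if obtained from one another by vertical translation and/or rotation by $180^\circ$ about the vertical axis. An $i$-block of a Young column is removable if removing it leaves a Young column; an $i$-block not in it is addable if adding it gives a Young column. $\tilde f_i$ adds an addable $i$-block if one exists and gives $0$ otherwise; $\tilde e_i$ removes a removable $i$-block if one exists and gives $0$ otherwise; with these rules: (a) if there are two addable $i$-blocks, $\tilde f_i$ adds the higher one if $i\ne4$ and the one lying on top of a $5$-block if $i=4$; if there are two removable $i$-blocks, $\tilde e_i$ removes the lower one if $i\ne4$ and the one lying on top of a $3$-block if $i=4$; (b) if a Young column $y$ is obtained by adding (resp.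 removing) an $i$-block to (from) some other Young column under these rules and $y$ itself has an addable (resp. removable) $i$-block, then $\tilde f_j(y)=\tilde e_j(y)=0$ for all $j\ne i$. Put $\varphi_i(y)=\max\{m:\tilde f_i^my\neq0\}$, $\varepsilon_i(y)=\max\{m:\tilde e_i^my\neq0\}$. The set $C$ of equivalence classes becomes a classical crystal with $\mathrm{wt}(y)=\sum_i(\varphi_i(y)-\varepsilon_i(y))\Lambda_i$. **Energy functions.** $H:C\otimes C\to\mathbb Z$ is the function with $H(\tilde f_i(b\otimes b'))=H(b\otimes b')$ for $i\ne0$, and, when $\tilde f_0(b\otimes b')\neq0$, $H(\tilde f_0(b\otimes b'))=H(b\otimes b')+1$ if $\tilde f_0(b\otimes b')=\tilde f_0b\otimes b'$ and $H(b\otimes b')-1$ if $\tilde f_0(b\otimes b')=b\otimes\tilde f_0b'$; normalised by $H(c\otimes c)=0$ for extremal $c$, i.e. all $c$ of nonzero weight. $H_{\mathrm{aff}}(z^ma\otimes z^nb)=H(a\otimes b)+m-n$. **Young walls.** The Young wall pattern has columns indexed $r=0,1,2,\dots$ from right to left, each a copy (at the same height) of the Young column pattern. The ground state wall consists in every column of all blocks of cubes $k\le0$ together with the blocks of colours $7,5,2$ in cube 1; $6,4$ in cube 2; $5,3$ in cube 3; $4,1$ in cube 4; $2,3$ in cube 5; the $4$-block over cell columns 4–6 in cube 6; and the blocks of colours $5,6,7,8,0$ in cubes $7,8,9,10,11$ respectively. Let $b_r\in C$ be the class of column $r$ of the ground state wall (the same for all $r$), and let $m_r\in\mathbb Z$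 be given by $m_0=0$ and $H_{\mathrm{aff}}(z^{m_{r+1}}b_{r+1}\otimes z^{m_r}b_r)=1$ for all $r\ge0$. A Young wall is a collection of blocks of the Young wall pattern which differs from the ground state wall in finitely many blocks and each of whose columns is a Young column. The Young columns in column $r$ are identified with the elements $z^my$ of $C_{\mathrm{aff}}$ by the bijection commuting with all $\tilde e_i,\tilde f_i$ which sends column $r$ of the ground state wall to $z^{m_r}b_r$; so a Young wall is written $(z^{n_r}y_r)_{r\ge0}$. $\mathcal Z(\Lambda_0)$ is the set of Young walls $(z^{n_r}y_r)_{r\ge0}$ with $H_{\mathrm{aff}}(z^{n_{r+1}}y_{r+1}\otimes z^{n_r}y_r)>0$ for all $r\ge0$. *)

theory Defs
  imports Main
begin

section \<open>The Young column pattern of type E8(1)\<close>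

abbreviation colours :: "nat set" where
  "colours \<equiv> {0..8}"

datatype row = Upper | Lower

text \<open>A cell is given by the index of its cube, its row and its cell column in 1..6.\<close>

type_synonym cell = "int \<times> row \<times> nat"

text \<open>A block is given by its colour together with the cells it occupies.\<close>

type_synonym block = "nat \<times> cell set"

text \<open>Cross-sections of the cubes 1 to 10, as pairs (upper row, lower row).\<close>

definition first_cubes :: "(nat list \<times> nat list) list" where
  "first_cubes =
    [([7,7,5,5,2,2], [0,7,5,5,5,2]),
     ([8,6,6,4,4,4], [8,6,6,4,4,4]),
     ([7,5,5,5,3,3], [7,7,5,5,3,3]),
     ([6,6,4,4,4,1], [6,6,4,4,4,1]),
     ([5,5,2,2,3,3], [5,5,5,2,3,3]),
     ([4,4,4,4,4,4], [4,4,4,4,4,4]),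
     ([3,3,2,5,5,5], [3,3,2,2,5,5]),
     ([1,4,4,4,6,6], [1,4,4,4,6,6]),
     ([3,3,5,5,7,7], [3,3,5,5,5,7]),
     ([4,4,4,6,6,8], [4,4,4,6,6,8])]"

definition rotate_section :: "nat list \<times> nat list \<Rightarrow> nat list \<times> nat list" where
  "rotate_section s = (rev (snd s), rev (fst s))"

definition cube :: "int \<Rightarrow> nat list \<times> nat list" where
  "cube k = (let s = first_cubes ! nat ((k - 1) mod 10)
             in if even ((k - 1) div 10) then s else rotate_section s)"

definition cells :: "cell set" where
  "cells = {(k, \<rho>, j). 1 \<le> j \<and> j \<le> 6}"

fun cell_colour :: "cell \<Rightarrow> nat" where
  "cell_colour (k, Upper, j) = fst (cube k) ! (j - 1)"
| "cell_colour (k, Lower, j) = snd (cube k) ! (j - 1)"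

text \<open>Equally coloured cells of a cube form one block, except that the cubes consisting only
  of cells of colour 4 are cut into a left and a right half.\<close>

fun same_block :: "cell \<Rightarrow> cell \<Rightarrow> bool" where
  "same_block (k, \<rho>, j) (k', \<rho>', j') \<longleftrightarrow>
     k = k' \<and> cell_colour (k, \<rho>, j) = cell_colour (k', \<rho>', j') \<and>
     (cube k = (replicate 6 4, replicate 6 4) \<longrightarrow> (j \<le> 3 \<longleftrightarrow> j' \<le> 3))"

definition block_at :: "cell \<Rightarrow> block" where
  "block_at c = (cell_colour c, {c' \<in> cells. same_block c c'})"

definition pattern :: "block set" where
  "pattern = block_at ` cells"

definition colour :: "block \<Rightarrow> nat" where
  "colour b = fst b"

definition height :: "block \<Rightarrow> int" where
  "height b = the_elem (fst ` snd b)"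

definition lies_on :: "block \<Rightarrow> block \<Rightarrow> bool" where
  "lies_on b b' \<longleftrightarrow> (\<exists>k \<rho> j. (k, \<rho>, j) \<in> snd b \<and> (k - 1, \<rho>, j) \<in> snd b')"

definition lies_on_colour :: "nat \<Rightarrow> block \<Rightarrow> bool" where
  "lies_on_colour i b \<longleftrightarrow> (\<exists>b'\<in>pattern. lies_on b b' \<and> colour b' = i)"


section \<open>Young columns\<close>

fun flip :: "row \<Rightarrow> row" where
  "flip Upper = Lower"
| "flip Lower = Upper"

text \<open>Vertical translation by \<open>t\<close>, combined with the rotation by 180 degrees if \<open>s\<close> holds.\<close>

fun move_cell :: "int \<Rightarrow> bool \<Rightarrow> cell \<Rightarrow> cell" where
  "move_cell t s (k, \<rho>, j) = (if s then (k + t, flip \<rho>, 7 - j) else (k + t, \<rho>, j))"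

definition move_block :: "int \<Rightarrow> bool \<Rightarrow> block \<Rightarrow> block" where
  "move_block t s b = (fst b, move_cell t s ` snd b)"

definition moved :: "block set \<Rightarrow> block set \<Rightarrow> bool" where
  "moved Y Y' \<longleftrightarrow> (\<exists>t s. Y' = move_block t s ` Y)"

text \<open>The 4-block over the cell columns 4 to 6 of cube 6.\<close>

definition right_four :: block where
  "right_four = block_at (6, Upper, 4)"

definition special1 :: "block set" where
  "special1 = {b \<in> pattern. height b \<le> 4}
     \<union> {b \<in> pattern. height b = 5 \<and> colour b \<in> {5, 3}} \<union> {right_four}"

definition special2 :: "block set" where
  "special2 = {b \<in> pattern. height b \<le> 5} \<union> {right_four}
     \<union> {b \<in> pattern. height b = 7 \<and> colour b = 2}"

definition ordinary_column :: "block set \<Rightarrow> bool" where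
  "ordinary_column Y \<longleftrightarrow> Y \<subseteq> pattern \<and> Y \<noteq> {} \<and> (\<exists>N. \<forall>b\<in>Y. height b \<le> N) \<and>
     (\<forall>b\<in>Y. \<forall>b'\<in>pattern. lies_on b b' \<longrightarrow> b' \<in> Y)"

definition young_columns :: "block set set" where
  "young_columns = {Y. ordinary_column Y \<or>
     Y \<subseteq> pattern \<and> (moved special1 Y \<or> moved special2 Y)}"

definition column_equiv :: "(block set \<times> block set) set" where
  "column_equiv = {(Y, Y'). Y \<in> young_columns \<and> Y' \<in> young_columns \<and> moved Y Y'}"


section \<open>Kashiwara operators on Young columns\<close>

definition addable :: "nat \<Rightarrow> block set \<Rightarrow> block set" where
  "addable i Y = {b \<in> pattern. colour b = i \<and> b \<notin> Y \<and> insert b Y \<in> young_columns}"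

definition removable :: "nat \<Rightarrow> block set \<Rightarrow> block set" where
  "removable i Y = {b \<in> Y. colour b = i \<and> Y - {b} \<in> young_columns}"

text \<open>The conditions on \<open>b'\<close> are void unless there is a second addable (removable)
  \<open>i\<close>-block; a Young column never has more than two.\<close>

definition block_to_add :: "nat \<Rightarrow> block set \<Rightarrow> block" where
  "block_to_add i Y = (THE b. b \<in> addable i Y \<and>
     (\<forall>b'\<in>addable i Y. b' \<noteq> b \<longrightarrow>
        (if i = 4 then lies_on_colour 5 b else height b' < height b)))"

definition block_to_remove :: "nat \<Rightarrow> block set \<Rightarrow> block" where
  "block_to_remove i Y = (THE b. b \<in> removable i Y \<and>
     (\<forall>b'\<in>removable i Y. b' \<noteq> b \<longrightarrow>
        (if i = 4 then lies_on_colour 3 b else height b < height b')))"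

text \<open>The operators given by rule (a) alone; \<open>None\<close> stands for the element 0.\<close>

definition f_pre :: "nat \<Rightarrow> block set \<Rightarrow> block set option" where
  "f_pre i Y = (if addable i Y = {} then None else Some (insert (block_to_add i Y) Y))"

definition e_pre :: "nat \<Rightarrow> block set \<Rightarrow> block set option" where
  "e_pre i Y = (if removable i Y = {} then None else Some (Y - {block_to_remove i Y}))"

text \<open>The hypothesis of rule (b). ``Under these rules'' is read as referring to rule (a), which
  avoids a circular definition; replacing \<open>f_pre\<close> and \<open>e_pre\<close> by the final operators \<open>col_f\<close>
  and \<open>col_e\<close> would give the same predicate.\<close>

definition exclusive :: "nat \<Rightarrow> block set \<Rightarrow> bool" where
  "exclusive i Y \<longleftrightarrow>
     ((\<exists>Y'\<in>young_columns. Y' \<noteq> Y \<and> f_pre i Y' = Some Y) \<and> addable i Y \<noteq> {}) \<or>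
     ((\<exists>Y'\<in>young_columns. Y' \<noteq> Y \<and> e_pre i Y' = Some Y) \<and> removable i Y \<noteq> {})"

definition col_f :: "nat \<Rightarrow> block set \<Rightarrow> block set option" where
  "col_f j Y = (if \<exists>i\<in>colours. i \<noteq> j \<and> exclusive i Y then None else f_pre j Y)"

definition col_e :: "nat \<Rightarrow> block set \<Rightarrow> block set option" where
  "col_e j Y = (if \<exists>i\<in>colours. i \<noteq> j \<and> exclusive i Y then None else e_pre j Y)"


section \<open>The classical crystal, its tensor square and its affinization\<close>

definition crystal :: "block set set set" where
  "crystal = young_columns // column_equiv"

definition class_of :: "block set \<Rightarrow> block set set" where
  "class_of Y = column_equiv `` {Y}"

text \<open>The operators on Young columns commute with the equivalence, so the choice of the
  representative in the next two definitions is immaterial.\<close>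

definition cr_f :: "nat \<Rightarrow> block set set \<Rightarrow> block set set option" where
  "cr_f i c = map_option class_of (col_f i (SOME Y. Y \<in> c))"

definition cr_e :: "nat \<Rightarrow> block set set \<Rightarrow> block set set option" where
  "cr_e i c = map_option class_of (col_e i (SOME Y. Y \<in> c))"

definition iterate :: "('a \<Rightarrow> 'a option) \<Rightarrow> nat \<Rightarrow> 'a \<Rightarrow> 'a option" where
  "iterate g m x = ((\<lambda>y. Option.bind y g) ^^ m) (Some x)"

definition phi :: "nat \<Rightarrow> block set set \<Rightarrow> nat" where
  "phi i c = Max {m. iterate (cr_f i) m c \<noteq> None}"

definition eps :: "nat \<Rightarrow> block set set \<Rightarrow> nat" where
  "eps i c = Max {m. iterate (cr_e i) m c \<noteq> None}"

text \<open>\<open>wt c i\<close> is the coefficient of the \<open>i\<close>-th fundamental weight in the weight of \<open>c\<close>.\<close>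

definition wt :: "block set set \<Rightarrow> nat \<Rightarrow> int" where
  "wt c i = int (phi i c) - int (eps i c)"

text \<open>A pair \<open>(b, b')\<close> stands for the tensor product of \<open>b\<close> and \<open>b'\<close>.\<close>

fun tensor_f ::
  "nat \<Rightarrow> block set set \<times> block set set \<Rightarrow> (block set set \<times> block set set) option" where
  "tensor_f i (b, b') =
     (if phi i b > eps i b' then map_option (\<lambda>u. (u, b')) (cr_f i b)
      else map_option (\<lambda>v. (b, v)) (cr_f i b'))"

definition energy_function :: "(block set set \<times> block set set \<Rightarrow> int) \<Rightarrow> bool" where
  "energy_function H \<longleftrightarrow>
     (\<forall>b\<in>crystal. \<forall>b'\<in>crystal.
        (\<forall>i\<in>colours. \<forall>x. i \<noteq> 0 \<longrightarrow> tensor_f i (b, b') = Some x \<longrightarrow> H x = H (b, b')) \<and>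
        (\<forall>u. cr_f 0 b = Some u \<longrightarrow> tensor_f 0 (b, b') = Some (u, b') \<longrightarrow>
             H (u, b') = H (b, b') + 1) \<and>
        (\<forall>v. cr_f 0 b' = Some v \<longrightarrow> tensor_f 0 (b, b') = Some (b, v) \<longrightarrow>
             H (b, v) = H (b, b') - 1)) \<and>
     (\<forall>c\<in>crystal. (\<exists>i\<in>colours. wt c i \<noteq> 0) \<longrightarrow> H (c, c) = 0)"

text \<open>The element \<open>z\<^sup>m c\<close> of the affinization is represented by \<open>(m, c)\<close>.\<close>

type_synonym affine = "int \<times> block set set"

definition affinization :: "affine set" where
  "affinization = UNIV \<times> crystal"

fun aff_f :: "nat \<Rightarrow> affine \<Rightarrow> affine option" where
  "aff_f i (m, c) = map_option (\<lambda>d. (if i = 0 then m - 1 else m, d)) (cr_f i c)"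

fun aff_e :: "nat \<Rightarrow> affine \<Rightarrow> affine option" where
  "aff_e i (m, c) = map_option (\<lambda>d. (if i = 0 then m + 1 else m, d)) (cr_e i c)"

fun H_aff :: "(block set set \<times> block set set \<Rightarrow> int) \<Rightarrow> affine \<Rightarrow> affine \<Rightarrow> int" where
  "H_aff H (m, a) (n, b) = H (a, b) + m - n"


section \<open>Young walls\<close>

definition ground_column :: "block set" where
  "ground_column = {b \<in> pattern. height b \<le> 0}
     \<union> {b \<in> pattern. (height b, colour b) \<in>
          {(1,7), (1,5), (1,2), (2,6), (2,4), (3,5), (3,3), (4,4), (4,1), (5,2), (5,3),
           (7,5), (8,6), (9,7), (10,8), (11,0)}}
     \<union> {right_four}"

definition ground_exponents ::
  "(block set set \<times> block set set \<Rightarrow> int) \<Rightarrow> (nat \<Rightarrow> int) \<Rightarrow> bool" where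
  "ground_exponents H m \<longleftrightarrow> m 0 = 0 \<and>
     (\<forall>r. H_aff H (m (Suc r), class_of ground_column) (m r, class_of ground_column) = 1)"

text \<open>\<open>\<Phi> r\<close> is the identification of the Young columns in column \<open>r\<close> with the affinization.\<close>

definition column_identification ::
  "(nat \<Rightarrow> int) \<Rightarrow> (nat \<Rightarrow> block set \<Rightarrow> affine) \<Rightarrow> bool" where
  "column_identification m \<Phi> \<longleftrightarrow>
     (\<forall>r. bij_betw (\<Phi> r) young_columns affinization \<and>
          (\<forall>Y\<in>young_columns. \<forall>i\<in>colours.
             map_option (\<Phi> r) (col_f i Y) = aff_f i (\<Phi> r Y) \<and>
             map_option (\<Phi> r) (col_e i Y) = aff_e i (\<Phi> r Y)) \<and>
          \<Phi> r ground_column = (m r, class_of ground_column))"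

text \<open>The pair \<open>(r, b)\<close> stands for the copy in column \<open>r\<close> of the block \<open>b\<close> of the
  Young column pattern.\<close>

definition wall_pattern :: "(nat \<times> block) set" where
  "wall_pattern = UNIV \<times> pattern"

definition ground_wall :: "(nat \<times> block) set" where
  "ground_wall = UNIV \<times> ground_column"

definition wall_column :: "(nat \<times> block) set \<Rightarrow> nat \<Rightarrow> block set" where
  "wall_column W r = {b. (r, b) \<in> W}"

definition young_wall :: "(nat \<times> block) set \<Rightarrow> bool" where
  "young_wall W \<longleftrightarrow> W \<subseteq> wall_pattern \<and>
     finite ((W - ground_wall) \<union> (ground_wall - W)) \<and>
     (\<forall>r. wall_column W r \<in> young_columns)"

definition Z_Lambda0 ::
  "(block set set \<times> block set set \<Rightarrow> int) \<Rightarrow> (nat \<Rightarrow> block set \<Rightarrow> affine) \<Rightarrow>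
     (nat \<times> block) set set" where
  "Z_Lambda0 H \<Phi> = {W. young_wall W \<and>
     (\<forall>r. H_aff H (\<Phi> (Suc r) (wall_column W (Suc r))) (\<Phi> r (wall_column W r)) > 0)}"

end

(* Up to translation and rotation there are 249 Young columns. Write every Young column as one
   of 249 representatives, moved by n periods. The energy H_aff of the pair formed by the
   representative a in column r + 1 and the representative b in column r, moved relative to each
   other by k periods, has the form h(a, b) + k; it is constant along the tensor product
   operators, and h is 1 at the pair of ground state columns.

   If a is not contained in b moved by k periods, then this and the value h(a, b) + k persist
   when f_i is applied to the left factor (if phi_i(a) > eps_i(b)) or e_i to the right factor (if
   phi_i(a) < eps_i(b)): the left column grows or the right one shrinks. Since h <= 1 everywhere
   (raise a pair to one of the eight pairs of classical highest weight), a positive value bounds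
   k from below and the process stops, at a pair with phi(a) = eps(b). For each of the finitely
   many such pairs either the inclusion holds or a short walk of tensor product operators,
   combined with h <= 1, shows that the value is not positive. The exception is the pair of
   ground state columns moved by one period, which has value 2. *)

theory Submission
  imports Defs
begin

text \<open>The number 249 is 1 + 248: under the operators of nonzero colour, \<open>C\<close> is
  the trivial crystal, formed by the ground state class, together with the crystal of the adjoint
  representation of E8, whose highest weight element is entry 1 of the table. Hence only entries 0
  and 1 occur on the left of a pair of classical highest weight.

  The definitions quantify over all sets of blocks, choose with \<open>THE\<close> and
  \<open>SOME\<close>, and take maxima over iterations; the work lies in making them finite. A
  column contains everything far below its top, so it is a threshold with finitely many further
  blocks. An equivalence moves the pattern by a multiple of ten cubes, with a rotation exactly for
  odd multiples, since a 0-block is a single cell whose position reveals the motion. So equivalence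
  is translation of numbers by multiples of 30, and the closure properties of the table become
  computations.

  The identification of columns with the affinization is an unknown of the theorem. It is pinned
  down by connectedness of the crystal graph and by a closed walk in it that climbs one
  period.\<close>

section \<open>Numbering the blocks\<close>

text \<open>The blocks are numbered by the integers, thirty to a period of ten cubes and increasing with
  the height, so that adding 30 is the translation by ten cubes combined with the rotation.\<close>

definition first_numbers :: "(int list \<times> int list) list" where
  "first_numbers =
    [([1,1,2,2,3,3], [0,1,2,2,2,3]),
     ([4,5,5,6,6,6], [4,5,5,6,6,6]),
     ([7,8,8,8,9,9], [7,7,8,8,9,9]),
     ([10,10,11,11,11,12], [10,10,11,11,11,12]),
     ([13,13,14,14,15,15], [13,13,13,14,15,15]),
     ([16,16,16,17,17,17], [16,16,16,17,17,17]),
     ([18,18,19,20,20,20], [18,18,19,19,20,20]),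
     ([21,22,22,22,23,23], [21,22,22,22,23,23]),
     ([24,24,25,25,26,26], [24,24,25,25,25,26]),
     ([27,27,27,28,28,29], [27,27,27,28,28,29])]"

fun entry_at :: "'a list \<times> 'a list \<Rightarrow> row \<Rightarrow> nat \<Rightarrow> 'a" where
  "entry_at s Upper j = fst s ! (j - 1)"
| "entry_at s Lower j = snd s ! (j - 1)"

text \<open>In a rotated cube the number is read off at the rotated cell.\<close>

fun number :: "cell \<Rightarrow> int" where
  "number (k, \<rho>, j) = 30 * ((k - 1) div 10) +
     (let s = first_numbers ! nat ((k - 1) mod 10)
      in if even ((k - 1) div 10) then entry_at s \<rho> j else entry_at s (flip \<rho>) (7 - j))"

definition colour_list :: "nat list" where
  "colour_list = [0,7,5,2, 8,6,4, 7,5,3, 6,4,1, 5,2,3, 4,4, 3,2,5, 1,4,6, 3,5,7, 4,6,8]"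

definition height_list :: "int list" where
  "height_list = [1,1,1,1, 2,2,2, 3,3,3, 4,4,4, 5,5,5, 6,6, 7,7,7, 8,8,8, 9,9,9, 10,10,10]"

text \<open>Distances instead of numbers: one list then serves every period, and the lowest blocks
  of a period can refer to the period underneath.\<close>

definition below_list :: "int list list" where
  "below_list = [[1], [2, 3], [4, 5], [6], [3, 4], [3, 4], [3, 4], [2, 3], [2, 3], [3], [2, 3],
     [2, 3], [3], [2, 3], [3], [3, 4], [2, 3], [2, 3], [2], [2, 3], [3], [3], [2, 3, 4], [3],
     [2, 3], [2, 3], [3], [2, 3], [2, 3], [3]]"

definition num_colour :: "int \<Rightarrow> nat" where
  "num_colour t = colour_list ! nat (t mod 30)"

definition num_height :: "int \<Rightarrow> int" where
  "num_height t = height_list ! nat (t mod 30) + 10 * (t div 30)"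

definition below :: "int \<Rightarrow> int list" where
  "below t = map (\<lambda>d. t - d) (below_list ! nat (t mod 30))"

definition blk :: "int \<Rightarrow> block" where
  "blk t = (num_colour t, {c \<in> cells. number c = t})"

definition row_list :: "row list" where "row_list = [Upper, Lower]"

definition pos_list :: "nat list" where "pos_list = [1,2,3,4,5,6]"

definition base_cell_list :: "cell list" where
  "base_cell_list = List.product [1..10] (List.product row_list pos_list)"

lemma set_row_list: "set row_list = UNIV"
  by (auto simp: row_list_def intro: row.exhaust)

lemma set_pos_list: "j \<in> set pos_list \<longleftrightarrow> 1 \<le> j \<and> j \<le> 6"
  by (auto simp: pos_list_def)

lemma set_base_cell_list:
  "(k, \<rho>, j) \<in> set base_cell_list \<longleftrightarrow> 1 \<le> k \<and> k \<le> 10 \<and> 1 \<le> j \<and> j \<le> 6"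
  by (auto simp: base_cell_list_def set_row_list set_pos_list)

lemma flip_flip [simp]: "flip (flip \<rho>) = \<rho>"
  by (cases \<rho>) auto

text \<open>The parity of the period index decides whether a cube is rotated, so a move by
  \<open>n\<close> periods stays inside the pattern only if it rotates exactly for odd
  \<open>n\<close>.\<close>

lemma number_moves:
  assumes "1 \<le> j" "j \<le> 6"
  shows "number (move_cell (10 * n) (odd n) (k, \<rho>, j)) = number (k, \<rho>, j) + 30 * n"
proof -
  have "(k + 10 * n - 1) div 10 = (k - 1) div 10 + n" "(k + 10 * n - 1) mod 10 = (k - 1) mod 10"
    using div_mult_self1[of 10 "k - 1" n] mod_mult_self2[of "k - 1" 10 n] by (simp_all add: algebra_simps)
  then show ?thesis using assms by (auto simp: Let_def)
qed

declare number.simps [simp del]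

section \<open>Colours, heights and cuts read off from the numbers\<close>

lemma length_first_cubes: "c < 10 \<Longrightarrow> length (fst (first_cubes ! c)) = 6 \<and> length (snd (first_cubes ! c)) = 6"
proof -
  have "\<forall>c\<in>set [0..<10]. length (fst (first_cubes ! c)) = 6 \<and> length (snd (first_cubes ! c)) = 6" by code_simp
  then show "c < 10 \<Longrightarrow> ?thesis" by simp
qed

text \<open>The rotation exchanges the rows and reverses them, so the colours of a rotated cube are
  those of the first cube at the rotated cells. This is the reading rule by which
  \<open>number\<close> is defined.\<close>

lemma cell_colour_entry:
  assumes "1 \<le> j" "j \<le> 6"
  shows "cell_colour (k, \<rho>, j) =
    (let s = first_cubes ! nat ((k - 1) mod 10)
      in if even ((k - 1) div 10) then entry_at s \<rho> j else entry_at s (flip \<rho>) (7 - j))"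
proof -
  have "nat ((k - 1) mod 10) < 10" by simp
  note len = length_first_cubes[OF this]
  have "6 - Suc (j - Suc 0) = 6 - j" using assms by simp
  then show ?thesis
    using assms len by (cases \<rho>) (auto simp: cube_def Let_def rotate_section_def rev_nth)
qed

lemma first_numbers_data:
  assumes "c < 10" "1 \<le> j" "j \<le> 6"
  shows "0 \<le> entry_at (first_numbers ! c) \<rho> j \<and> entry_at (first_numbers ! c) \<rho> j < 30
    \<and> colour_list ! nat (entry_at (first_numbers ! c) \<rho> j) = entry_at (first_cubes ! c) \<rho> j
    \<and> height_list ! nat (entry_at (first_numbers ! c) \<rho> j) = int c + 1"
proof -
  have "\<forall>c\<in>set [0..<10]. \<forall>\<rho>\<in>set row_list. \<forall>j\<in>set pos_list. 0 \<le> entry_at (first_numbers ! c) \<rho> j \<and> entry_at (first_numbers ! c) \<rho> j < 30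
    \<and> colour_list ! nat (entry_at (first_numbers ! c) \<rho> j) = entry_at (first_cubes ! c) \<rho> j
    \<and> height_list ! nat (entry_at (first_numbers ! c) \<rho> j) = int c + 1" by code_simp
  with assms show ?thesis unfolding set_row_list Ball_def set_pos_list by simp
qed

text \<open>Index 5, counted from 0, is the cube 444444, the only one in which the colour of a cell
  does not determine its block.\<close>

lemma first_numbers_eq_iff:
  assumes "c < 10" "1 \<le> j" "j \<le> 6" "1 \<le> j'" "j' \<le> 6"
  shows "entry_at (first_numbers ! c) \<rho> j = entry_at (first_numbers ! c) \<rho>' j' \<longleftrightarrow>
     entry_at (first_cubes ! c) \<rho> j = entry_at (first_cubes ! c) \<rho>' j' \<and> (c = 5 \<longrightarrow> (j \<le> 3 \<longleftrightarrow> j' \<le> 3))"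
proof -
  define triples :: "nat \<Rightarrow> (int \<times> nat \<times> bool) list" where
    "triples c = concat (map (\<lambda>\<rho>. map (\<lambda>j. (entry_at (first_numbers ! c) \<rho> j,
       entry_at (first_cubes ! c) \<rho> j, c = 5 \<and> j \<le> 3)) pos_list) row_list)" for c
  have "list_all (\<lambda>c. (\<lambda>l. list_all (\<lambda>x. list_all (\<lambda>y. fst x = fst y \<longleftrightarrow> snd x = snd y) l) l)
     (concat (map (\<lambda>\<rho>. map (\<lambda>j. (entry_at (first_numbers ! c) \<rho> j,
       entry_at (first_cubes ! c) \<rho> j, c = 5 \<and> j \<le> 3)) pos_list) row_list))) [0..<10]"
    by code_simp
  then have *: "fst x = fst y \<longleftrightarrow> snd x = snd y" if "x \<in> set (triples c)" "y \<in> set (triples c)" for x y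
    using assms(1) that by (auto simp: list_all_iff triples_def)
  have "(entry_at (first_numbers ! c) \<rho> j, entry_at (first_cubes ! c) \<rho> j, c = 5 \<and> j \<le> 3) \<in> set (triples c)"
    if "1 \<le> j" "j \<le> 6" for \<rho> j
    using that set_pos_list by (force simp: triples_def set_row_list)
  from *[OF this[OF assms(2,3)] this[OF assms(4,5)]] show ?thesis by auto
qed

lemma nat_eq_5: "nat x = 5 \<longleftrightarrow> x = 5"
  by linarith

text \<open>The extra cut is conditioned on the contents of a cube; this turns the condition into
  one on its position in the period. Rotated periods behave alike because 444444 is
  symmetric.\<close>

lemma cube_all_four: "cube k = (replicate 6 4, replicate 6 4) \<longleftrightarrow> (k - 1) mod 10 = 5"
proof -
  have "\<forall>c\<in>set [0..<10]. (first_cubes ! c = (replicate 6 4, replicate 6 4) \<longleftrightarrow> c = 5) \<and>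
     (rotate_section (first_cubes ! c) = (replicate 6 4, replicate 6 4) \<longleftrightarrow> c = 5)" by code_simp
  then have "\<forall>c<10. (first_cubes ! c = (replicate 6 4, replicate 6 4) \<longleftrightarrow> c = 5) \<and>
     (rotate_section (first_cubes ! c) = (replicate 6 4, replicate 6 4) \<longleftrightarrow> c = 5)" by simp
  moreover have "nat ((k - 1) mod 10) < 10" by simp
  ultimately have "cube k = (replicate 6 4, replicate 6 4) \<longleftrightarrow> nat ((k - 1) mod 10) = 5"
    unfolding cube_def Let_def by (metis)
  then show ?thesis by (simp add: nat_eq_5)
qed

lemma number_data:
  assumes "1 \<le> j" "j \<le> 6"
  shows "number (k, \<rho>, j) div 30 = (k - 1) div 10"
    and "num_colour (number (k, \<rho>, j)) = cell_colour (k, \<rho>, j)"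
    and "num_height (number (k, \<rho>, j)) = k"
proof -
  define c where "c = nat ((k - 1) mod 10)"
  define p where "p = (k - 1) div 10"
  have c: "c < 10" "k = 10 * p + int c + 1" by (auto simp: c_def p_def)
  have j': "1 \<le> 7 - j" "7 - j \<le> 6" using assms by auto
  obtain x where x: "number (k, \<rho>, j) = 30 * p + x" "0 \<le> x" "x < 30"
    "colour_list ! nat x = cell_colour (k, \<rho>, j)" "height_list ! nat x = int c + 1"
    using first_numbers_data[OF c(1) assms] first_numbers_data[OF c(1) j']
    unfolding cell_colour_entry[OF assms] number.simps Let_def c_def[symmetric] p_def[symmetric]
    by (smt (verit, best))
  show "number (k, \<rho>, j) div 30 = (k - 1) div 10" using x p_def by simp
  show "num_colour (number (k, \<rho>, j)) = cell_colour (k, \<rho>, j)" using x by (simp add: num_colour_def)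
  show "num_height (number (k, \<rho>, j)) = k" using x c by (simp add: num_height_def)
qed

lemma same_block_iff:
  assumes "x \<in> cells" "y \<in> cells"
  shows "same_block x y \<longleftrightarrow> number x = number y"
proof -
  obtain k \<rho> j k' \<rho>' j' where xy: "x = (k, \<rho>, j)" "y = (k', \<rho>', j')" by (metis prod_cases3)
  have j: "1 \<le> j" "j \<le> 6" "1 \<le> j'" "j' \<le> 6" using assms xy by (auto simp: cells_def)
  show ?thesis
  proof (cases "k = k'")
    case False
    then show ?thesis using number_data(3) j xy by (metis same_block.simps)
  next
    case True
    define c where "c = nat ((k - 1) mod 10)"
    have c: "c < 10" by (simp add: c_def)
    have c5: "(k - 1) mod 10 = 5 \<longleftrightarrow> c = 5" by (simp add: c_def nat_eq_5)
    have j': "1 \<le> 7 - j" "7 - j \<le> 6" "1 \<le> 7 - j'" "7 - j' \<le> 6" using j by auto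
    \<comment> \<open>The rotation swaps the two halves of a cube, so it preserves whether two cells
      lie in the same half.\<close>
    have r: "(7 - j \<le> 3 \<longleftrightarrow> 7 - j' \<le> 3) \<longleftrightarrow> (j \<le> 3 \<longleftrightarrow> j' \<le> 3)" using j by auto
    show ?thesis
      using first_numbers_eq_iff[OF c j, of \<rho> \<rho>'] first_numbers_eq_iff[OF c j', of "flip \<rho>" "flip \<rho>'"] True
      unfolding xy same_block.simps cell_colour_entry[OF j(1,2)] cell_colour_entry[OF j(3,4)]
        cube_all_four c5 number.simps Let_def c_def[symmetric] r
      unfolding True[symmetric] c_def[symmetric] by simp
  qed
qed

lemma block_at_blk: "x \<in> cells \<Longrightarrow> block_at x = blk (number x)"
proof -
  assume x: "x \<in> cells"
  then have "cell_colour x = num_colour (number x)"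
    using number_data(2) by (auto simp: cells_def)
  moreover have "{c' \<in> cells. same_block x c'} = {c \<in> cells. number c = number x}"
    using same_block_iff[OF x] by auto
  ultimately show ?thesis by (simp add: block_at_def blk_def)
qed

lemma move_cell_cells [simp]: "move_cell t s x \<in> cells \<longleftrightarrow> x \<in> cells"
  by (cases x) (auto simp: cells_def)

text \<open>No \<open>blk t\<close> has an empty set of cells; both the injectivity of
  \<open>blk\<close> and the height of a block rest on this.\<close>

lemma ex_number: "\<exists>x\<in>cells. number x = t"
proof -
  have "(\<lambda>l. list_all (\<lambda>q. list_ex (\<lambda>x. x = q) l) [0..29]) (map number base_cell_list)" by code_simp
  then have "\<forall>q\<in>set [0..29]. \<exists>x\<in>set base_cell_list. number x = q"
    by (auto simp: list_all_iff list_ex_iff)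
  moreover have "t mod 30 \<in> set [0..29]" by simp
  ultimately obtain c \<rho> j where "(c, \<rho>, j) \<in> set base_cell_list" "number (c, \<rho>, j) = t mod 30"
    by fast
  then have x: "j \<in> set pos_list" "number (c, \<rho>, j) = t mod 30"
    by (auto simp: set_base_cell_list set_pos_list)
  then have "number (move_cell (10 * (t div 30)) (odd (t div 30)) (c, \<rho>, j)) = t"
    using number_moves[of j] by (simp add: set_pos_list)
  moreover have "(c, \<rho>, j) \<in> cells" using x by (simp add: cells_def set_pos_list)
  ultimately show ?thesis by (metis move_cell_cells)
qed

lemma pattern_blk: "pattern = range blk"
  unfolding pattern_def using ex_number by (auto simp: block_at_blk) (metis block_at_blk image_eqI)

lemma inj_blk: "inj blk"
proof (rule injI)
  fix t u
  assume "blk t = blk u"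
  then have "{c \<in> cells. number c = t} = {c \<in> cells. number c = u}" by (simp add: blk_def)
  moreover obtain x where "x \<in> cells" "number x = t" using ex_number by blast
  ultimately show "t = u" by blast
qed

lemma colour_blk [simp]: "colour (blk t) = num_colour t"
  by (simp add: colour_def blk_def)

lemma height_blk [simp]: "height (blk t) = num_height t"
proof -
  have *: "fst x = num_height t" if "x \<in> cells" "number x = t" for x
    using that number_data(3) by (cases x) (auto simp: cells_def)
  obtain x where "x \<in> cells" "number x = t" using ex_number by blast
  then have "fst x \<in> fst ` {c \<in> cells. number c = t}" by simp
  moreover have "fst ` {c \<in> cells. number c = t} \<subseteq> {num_height t}" using * by auto
  ultimately have "fst ` {c \<in> cells. number c = t} = {num_height t}"
    by (metis empty_iff subset_singletonD)
  then show ?thesis by (simp add: height_def blk_def)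
qed

text \<open>Both directions are evaluated in one period and carried to the others by moves, which
  shift the numbers of a cell and of the cell below it by the same amount. Cube 1 already looks down
  into the rotated cube 0.\<close>

lemma below_mem: "u \<in> set (below t) \<longleftrightarrow> (\<exists>k \<rho> j. (k, \<rho>, j) \<in> cells \<and> number (k, \<rho>, j) = t \<and> number (k - 1, \<rho>, j) = u)"
proof -
  define N where "N = t div 30"
  have *: "\<forall>k\<in>set [1..10]. \<forall>\<rho>\<in>set row_list. \<forall>j\<in>set pos_list. number (k - 1, \<rho>, j) \<in> set (below (number (k, \<rho>, j)))" by code_simp
  have "(\<lambda>l. list_all (\<lambda>q. list_all (\<lambda>u. list_ex (\<lambda>x. x = (q, u)) l) (below q)) [0..29])
     (map (\<lambda>(k, \<rho>, j). (number (k, \<rho>, j), number (k - 1, \<rho>, j))) base_cell_list)" by code_simp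
  then have "\<forall>q\<in>set [0..29]. \<forall>u\<in>set (below q).
      (q, u) \<in> (\<lambda>(k, \<rho>, j). (number (k, \<rho>, j), number (k - 1, \<rho>, j))) ` set base_cell_list"
    by (simp add: list_all_iff list_ex_iff image_iff)
  then have **: "\<exists>k \<rho> j. (k, \<rho>, j) \<in> set base_cell_list \<and> number (k, \<rho>, j) = q \<and> number (k - 1, \<rho>, j) = u"
    if "q \<in> set [0..29]" "u \<in> set (below q)" for q u
    using that by (auto simp: image_iff split: prod.splits dest!: bspec) blast
  have sh: "u + 30 * n \<in> set (below (t + 30 * n)) \<longleftrightarrow> u \<in> set (below t)" for u t n
    by (auto simp: below_def image_iff)
  show ?thesis
  proof
    assume "u \<in> set (below t)"
    then have "u - 30 * N \<in> set (below (t mod 30))"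
      using sh[of "u - 30 * N" N "t mod 30"] by (simp add: N_def)
    moreover have "t mod 30 \<in> set [0..29]" by simp
    ultimately obtain k \<rho> j where "(k, \<rho>, j) \<in> set base_cell_list"
      and x: "number (k, \<rho>, j) = t mod 30"  "number (k - 1, \<rho>, j) = u - 30 * N"
      using ** by blast
    obtain k' \<rho>' j' where y: "move_cell (10 * N) (odd N) (k, \<rho>, j) = (k', \<rho>', j')" by (metis prod_cases3)
    have j: "1 \<le> j" "j \<le> 6" using \<open>(k, \<rho>, j) \<in> set base_cell_list\<close> set_base_cell_list by auto
    have "(k, \<rho>, j) \<in> cells" using j by (simp add: cells_def)
    then have "(k', \<rho>', j') \<in> cells" by (metis y move_cell_cells)
    moreover have "move_cell (10 * N) (odd N) (k - 1, \<rho>, j) = (k' - 1, \<rho>', j')" using y by (auto split: if_splits)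
    then have "number (k' - 1, \<rho>', j') = u" "number (k', \<rho>', j') = t"
      using number_moves[OF j, of N k \<rho>] number_moves[OF j, of N "k - 1" \<rho>] x y N_def by auto
    ultimately show "\<exists>k \<rho> j. (k, \<rho>, j) \<in> cells \<and> number (k, \<rho>, j) = t \<and> number (k - 1, \<rho>, j) = u" by blast
  next
    assume "\<exists>k \<rho> j. (k, \<rho>, j) \<in> cells \<and> number (k, \<rho>, j) = t \<and> number (k - 1, \<rho>, j) = u"
    then obtain k \<rho> j where x: "(k, \<rho>, j) \<in> cells" "number (k, \<rho>, j) = t" "number (k - 1, \<rho>, j) = u" by blast
    \<comment> \<open>The move by \<open>M\<close> periods brings cube \<open>k\<close> back to one
      of the cubes 1 to 10.\<close>
    define M where "M = - ((k - 1) div 10)"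
    obtain k' \<rho>' j' where y: "move_cell (10 * M) (odd M) (k, \<rho>, j) = (k', \<rho>', j')" by (metis prod_cases3)
    have j: "1 \<le> j" "j \<le> 6" using x by (auto simp: cells_def)
    have "(k', \<rho>', j') \<in> cells" using x y by (metis move_cell_cells)
    then have j': "j' \<in> set pos_list" by (auto simp: cells_def set_pos_list)
    have "k' = k + 10 * M" using y by (auto split: if_splits)
    then have k': "k' \<in> set [1..10]" unfolding M_def using minus_mult_div_eq_mod[of "k - 1" 10] pos_mod_bound[of 10 "k - 1"] pos_mod_sign[of 10 "k - 1"] by simp linarith
    have "move_cell (10 * M) (odd M) (k - 1, \<rho>, j) = (k' - 1, \<rho>', j')" using y by (auto split: if_splits)
    then have "number (k' - 1, \<rho>', j') = u + 30 * M" "number (k', \<rho>', j') = t + 30 * M"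
      using number_moves[OF j, of M k \<rho>] number_moves[OF j, of M "k - 1" \<rho>] x y by auto
    moreover have "number (k' - 1, \<rho>', j') \<in> set (below (number (k', \<rho>', j')))"
      using * k' j' set_row_list by blast
    ultimately show "u \<in> set (below t)" using sh by simp
  qed
qed

lemma lies_on_blk [simp]: "lies_on (blk t) (blk u) \<longleftrightarrow> u \<in> set (below t)"
  unfolding lies_on_def below_mem by (auto simp: blk_def cells_def)

lemma lies_on_colour_blk: "lies_on_colour i (blk t) \<longleftrightarrow> (\<exists>u\<in>set (below t). num_colour u = i)"
  unfolding lies_on_colour_def pattern_blk by auto

lemma move_block_blk: "move_block (10 * n) (odd n) (blk t) = blk (t + 30 * n)"
proof -
  have "num_colour (t + 30 * n) = num_colour t" by (simp add: num_colour_def)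
  moreover have "move_cell (10 * n) (odd n) ` {c \<in> cells. number c = t} = {c \<in> cells. number c = t + 30 * n}" (is "?A = ?B")
  proof
    show "?A \<subseteq> ?B"
    proof
      fix x assume "x \<in> ?A"
      then obtain k \<rho> j where x: "x = move_cell (10 * n) (odd n) (k, \<rho>, j)" "(k, \<rho>, j) \<in> cells" "number (k, \<rho>, j) = t"
        by auto
      then show "x \<in> ?B" using number_moves[of j n k \<rho>] by (auto simp: cells_def)
    qed
    show "?B \<subseteq> ?A"
    proof
      fix x assume x: "x \<in> ?B"
      obtain k \<rho> j where xx: "x = (k, \<rho>, j)" by (metis prod_cases3)
      define y where "y = move_cell (10 * (-n)) (odd (-n)) x"
      have "number y = t" unfolding y_def xx using x xx number_moves[of j "-n" k \<rho>] by (auto simp: cells_def)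
      moreover have "y \<in> cells" using x y_def by simp
      moreover have "x = move_cell (10 * n) (odd n) y" unfolding y_def xx using x xx by (auto simp: cells_def)
      ultimately show "x \<in> ?A" by blast
    qed
  qed
  ultimately show ?thesis by (simp add: move_block_def blk_def)
qed

section \<open>Columns as sets of integers\<close>

definition shift :: "int \<Rightarrow> int set \<Rightarrow> int set" where
  "shift n X = {t. t - 30 * n \<in> X}"

definition ordinary :: "int set \<Rightarrow> bool" where
  "ordinary X \<longleftrightarrow> X \<noteq> {} \<and> (\<exists>N. \<forall>t\<in>X. t \<le> N) \<and> (\<forall>t\<in>X. set (below t) \<subseteq> X)"

text \<open>Cubes up to 4 end at number 12; 13, 14, 15 are the 5-, 2- and 3-block of cube 5; 16 and
  17 are the two 4-blocks of cube 6, and 19 is the 2-block of cube 7. In (S1) the block 17 lacks its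
  support 14, in (S2) the block 19 lacks its support 16.\<close>

definition num_special1 :: "int set" where "num_special1 = {t. t < 14 \<or> t = 15 \<or> t = 17}"

definition num_special2 :: "int set" where "num_special2 = {t. t < 16 \<or> t = 17 \<or> t = 19}"

definition is_column :: "int set \<Rightarrow> bool" where
  "is_column X \<longleftrightarrow> ordinary X \<or> (\<exists>n. X = shift n num_special1 \<or> X = shift n num_special2)"

lemma mem_shift [simp]: "t \<in> shift n X \<longleftrightarrow> t - 30 * n \<in> X"
  by (simp add: shift_def)

lemma shift_shift [simp]: "shift n (shift m X) = shift (n + m) X"
  by (auto simp: algebra_simps)

lemma shift_0 [simp]: "shift 0 X = X"
  by auto

lemma shift_insert: "shift n (insert t X) = insert (t + 30 * n) (shift n X)"
  by auto

lemma image_shift: "shift n X = (\<lambda>t. t + 30 * n) ` X"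
  by (force simp: image_iff)

lemma num_colour_shift [simp]: "num_colour (t + 30 * n) = num_colour t"
  by (simp add: num_colour_def)

lemma num_height_shift [simp]: "num_height (t + 30 * n) = num_height t + 10 * n"
  by (simp add: num_height_def)

lemma below_shift: "set (below (t + 30 * n)) = (\<lambda>u. u + 30 * n) ` set (below t)"
  by (force simp: below_def)

lemma ordinary_shift_imp: "ordinary X \<Longrightarrow> ordinary (shift n X)"
proof -
  assume X: "ordinary X"
  then obtain N where "\<forall>t\<in>X. t \<le> N" by (auto simp: ordinary_def)
  then have "\<forall>t\<in>shift n X. t \<le> N + 30 * n" by (metis diff_le_eq mem_shift)
  moreover have "shift n X \<noteq> {} \<and> (\<forall>t\<in>shift n X. set (below t) \<subseteq> shift n X)"
    using X by (auto simp: ordinary_def image_shift below_shift)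
  ultimately show ?thesis unfolding ordinary_def by blast
qed

lemma ordinary_shift [simp]: "ordinary (shift n X) \<longleftrightarrow> ordinary X"
  using ordinary_shift_imp[of "shift n X" "- n"] ordinary_shift_imp by auto

lemma is_column_shift [simp]: "is_column (shift n X) \<longleftrightarrow> is_column X"
proof -
  have "is_column (shift n X)" if "is_column X" for n X
    using that unfolding is_column_def by (metis ordinary_shift shift_shift)
  from this[of X n] this[of "shift n X" "-n"] show ?thesis by auto
qed

lemma mod_30_cases: "P (t mod 30)" if "list_all P [0..29]" for t :: int
proof -
  have "t mod 30 \<in> set [0..29]" by simp
  with that show ?thesis unfolding list_all_iff by blast
qed

lemma height_bounds: "10 * (t div 30) < num_height t \<and> num_height t \<le> 10 * (t div 30) + 10"
proof -
  have "list_all (\<lambda>q. 1 \<le> height_list ! nat q \<and> height_list ! nat q \<le> 10) [0..29]" by code_simp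
  from mod_30_cases[OF this, of t] show ?thesis by (simp add: num_height_def)
qed

lemma height_le_iff: "num_height t \<le> 10 * p \<longleftrightarrow> t < 30 * p"
proof -
  have "t < 30 * p \<longleftrightarrow> t div 30 < p" by presburger
  then show ?thesis using height_bounds[of t] by linarith
qed

lemma height_bounded: "(\<exists>N. \<forall>t\<in>X. num_height t \<le> N) \<longleftrightarrow> (\<exists>N. \<forall>t\<in>X. t \<le> N)"
proof
  assume "\<exists>N. \<forall>t\<in>X. num_height t \<le> N"
  then obtain N where N: "\<forall>t\<in>X. num_height t \<le> N" by blast
  have "t \<le> 3 * N + 30" if "t \<in> X" for t
    using bspec[OF N that] height_bounds[of t] by linarith
  then show "\<exists>N. \<forall>t\<in>X. t \<le> N" by blast
next
  assume "\<exists>N. \<forall>t\<in>X. t \<le> N"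
  then obtain N where N: "\<forall>t\<in>X. t \<le> N" by blast
  have "num_height t \<le> 10 * (N div 30) + 10" if "t \<in> X" for t
    using zdiv_mono1[of t N 30] bspec[OF N that] height_bounds[of t] by linarith
  then show "\<exists>N. \<forall>t\<in>X. num_height t \<le> N" by blast
qed

lemma ordinary_column_blk: "ordinary_column (blk ` X) \<longleftrightarrow> ordinary X"
proof -
  have "(\<forall>b\<in>blk ` X. \<forall>b'\<in>range blk. lies_on b b' \<longrightarrow> b' \<in> blk ` X) \<longleftrightarrow> (\<forall>t\<in>X. set (below t) \<subseteq> X)"
    using inj_blk by (auto simp: inj_image_mem_iff)
  moreover have "(\<exists>N. \<forall>b\<in>blk ` X. height b \<le> N) \<longleftrightarrow> (\<exists>N. \<forall>t\<in>X. t \<le> N)"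
    using height_bounded[of X] by simp
  ultimately show ?thesis
    unfolding ordinary_column_def ordinary_def pattern_blk by auto
qed

section \<open>Closure under support fills everything far below a block\<close>

primrec layer :: "nat \<Rightarrow> int \<Rightarrow> int list" where
  "layer 0 t = [t]"
| "layer (Suc n) t = remdups (concat (map below (layer n t)))"

lemma layer_shift: "set (layer k (t + 30 * n)) = (\<lambda>u. u + 30 * n) ` set (layer k t)"
  by (induction k) (auto simp: below_shift)

lemma layer_mem: "ordinary X \<Longrightarrow> t \<in> X \<Longrightarrow> set (layer n t) \<subseteq> X"
  by (induction n) (auto simp: ordinary_def)

text \<open>Supports widen on the way down: eleven cubes below any block they fill the whole
  cross-section. It suffices to evaluate this for the thirty blocks of one period; the bounds on
  heights confine the lower block to the window \<open>[-60..30]\<close>.\<close>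

lemma ordinary_contains_layer:
  assumes "ordinary X" "t \<in> X" "num_height u = num_height t - 11"
  shows "u \<in> X"
proof -
  have check: "list_all (\<lambda>q. (\<lambda>l. list_all (\<lambda>u. num_height u = num_height q - 11 \<longrightarrow> u \<in> set l) [-60..30]) (layer 11 q)) [0..29]"
    by code_simp
  define q where "q = t mod 30"
  define v where "v = u - 30 * (t div 30)"
  from mod_30_cases[OF check, of t] have *: "\<forall>u\<in>{-60..30}. num_height u = num_height q - 11 \<longrightarrow> u \<in> set (layer 11 q)"
    unfolding q_def[symmetric] by (simp only: list_all_iff set_upto)
  have t: "t = q + 30 * (t div 30)" and u: "u = v + 30 * (t div 30)" by (auto simp: q_def v_def)
  have h: "num_height v = num_height q - 11"
    using assms(3) num_height_shift[of q "t div 30"] num_height_shift[of v "t div 30"] t u by simp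
  have q: "0 \<le> q" "q < 30" by (auto simp: q_def)
  have "q div 30 = 0" using q by simp
  then have "- 2 \<le> v div 30" "v div 30 < 1"
    using h height_bounds[of q] height_bounds[of v] by linarith+
  then have "v \<in> {-60..30}" unfolding atLeastAtMost_iff by presburger
  with * h have "v \<in> set (layer 11 q)" by blast
  then have "u \<in> set (layer 11 t)" using layer_shift[of 11 q "t div 30"] t u by (metis image_eqI)
  then show ?thesis using layer_mem[OF assms(1,2)] by blast
qed

lemma ex_above: "\<exists>v. u \<in> set (below v) \<and> num_height v = num_height u + 1"
proof -
  have "list_all (\<lambda>q. list_ex (\<lambda>v. q \<in> set (below v) \<and> num_height v = num_height q + 1) [q+1..q+6]) [0..29]"
    by code_simp
  from mod_30_cases[OF this, of u] obtain v where v: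
    "u mod 30 \<in> set (below v)" "num_height v = num_height (u mod 30) + 1"
    by (auto simp: list_ex_iff)
  then have "u mod 30 + 30 * (u div 30) \<in> set (below (v + 30 * (u div 30)))"
    "num_height (v + 30 * (u div 30)) = num_height (u mod 30 + 30 * (u div 30)) + 1"
    using v unfolding below_shift num_height_shift by (blast, simp)
  then show ?thesis unfolding mod_mult_div_eq by blast
qed

text \<open>Downward induction from the full layer eleven cubes below \<open>t\<close>: every lower
  block supports some block of the next cube, which already belongs to \<open>X\<close>.\<close>

lemma ordinary_down:
  assumes "ordinary X" "t \<in> X" "num_height u \<le> num_height t - 11"
  shows "u \<in> X"
  using assms(3)
proof (induction "nat (num_height t - 11 - num_height u)" arbitrary: u)
  case 0
  then show ?case using ordinary_contains_layer[OF assms(1,2)] by simp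
next
  case (Suc n)
  obtain v where v: "u \<in> set (below v)" "num_height v = num_height u + 1" using ex_above by blast
  then have "v \<in> X" using Suc by simp
  then show ?case using v assms(1) by (auto simp: ordinary_def)
qed

lemma ordinary_threshold: "ordinary X \<Longrightarrow> \<exists>p. \<forall>t<30 * p. t \<in> X"
proof -
  assume X: "ordinary X"
  then obtain t where t: "t \<in> X" by (auto simp: ordinary_def)
  have "u \<in> X" if "u < 30 * ((num_height t - 11) div 10)" for u
  proof (rule ordinary_down[OF X t])
    have "num_height u \<le> 10 * ((num_height t - 11) div 10)" using that by (simp add: height_le_iff)
    then show "num_height u \<le> num_height t - 11" by linarith
  qed
  then show ?thesis by blast
qed

lemma is_column_threshold: "is_column X \<Longrightarrow> \<exists>p. \<forall>t<30 * p. t \<in> X"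
  unfolding is_column_def
proof (elim disjE exE)
  assume "ordinary X" then show ?thesis by (rule ordinary_threshold)
next
  fix n assume "X = shift n num_special1"
  then show ?thesis by (intro exI[of _ n]) (auto simp: num_special1_def)
next
  fix n assume "X = shift n num_special2"
  then show ?thesis by (intro exI[of _ n]) (auto simp: num_special2_def)
qed

section \<open>Equivalent columns differ by whole periods\<close>

lemma blk_zero: "blk (30 * p) = (0, {(10 * p + 1, if even p then Lower else Upper, if even p then 1 else 6)})"
proof -
  have "\<forall>x\<in>set base_cell_list. number x = 0 \<longleftrightarrow> x = (1, Lower, 1)" by code_simp
  then have base: "number x = 0 \<longleftrightarrow> x = (1, Lower, 1)" if "x \<in> set base_cell_list" for x using that by blast
  have "{c \<in> cells. number c = 0} = {(1, Lower, 1)}"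
  proof -
    have "x = (1, Lower, 1)" if x: "x \<in> cells" "number x = 0" for x
    proof -
      obtain k \<rho> j where kj: "x = (k, \<rho>, j)" by (metis prod_cases3)
      have j: "1 \<le> j" "j \<le> 6" using x kj by (auto simp: cells_def)
      then have "(k - 1) div 10 = 0" using number_data(1)[OF j, of k \<rho>] x kj by simp
      then have "1 \<le> k \<and> k \<le> 10" by presburger
      then show ?thesis using base[of x] x kj j by (simp add: set_base_cell_list)
    qed
    moreover have "number (1, Lower, 1) = 0" by code_simp
    ultimately show ?thesis by (auto simp: cells_def)
  qed
  then have "blk 0 = (0, {(1, Lower, 1)})" by (simp add: blk_def num_colour_def colour_list_def)
  then have "move_block (10 * p) (odd p) (blk 0) = (0, {(10 * p + 1, if even p then Lower else Upper, if even p then 1 else 6)})"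
    by (simp add: move_block_def)
  then show ?thesis using move_block_blk[of p 0] by simp
qed

lemma colour_0_iff: "num_colour t = 0 \<longleftrightarrow> t mod 30 = 0"
proof -
  have "list_all (\<lambda>q. colour_list ! nat q = 0 \<longleftrightarrow> q = 0) [0..29]" by code_simp
  from mod_30_cases[OF this, of t] show ?thesis by (simp add: num_colour_def)
qed

lemma move_blk_image: "move_block (10 * n) (odd n) ` blk ` X = blk ` shift n X"
  by (simp add: image_shift image_image move_block_blk)

text \<open>The translation and the rotation behind \<open>moved\<close> are arbitrary at first.
  Since the image lies in the pattern, a 0-block of \<open>X\<close> goes to a 0-block; this is one
  cell, lower left in unrotated periods and upper right in rotated ones, so its image determines
  both the height and the orientation of the move.\<close>

lemma moved_blk_iff:
  assumes "\<forall>t<30 * p. t \<in> X"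
  shows "Z \<subseteq> pattern \<and> moved (blk ` X) Z \<longleftrightarrow> (\<exists>n. Z = blk ` shift n X)"
proof
  assume "\<exists>n. Z = blk ` shift n X"
  then show "Z \<subseteq> pattern \<and> moved (blk ` X) Z"
    unfolding moved_def pattern_blk by (metis image_mono move_blk_image subset_UNIV)
next
  assume Z: "Z \<subseteq> pattern \<and> moved (blk ` X) Z"
  then obtain t s where ts: "Z = move_block t s ` blk ` X" by (auto simp: moved_def)
  \<comment> \<open>One period below the threshold, so that the 0-block with number
    \<open>30 * p'\<close> lies in \<open>X\<close>.\<close>
  define p' where "p' = p - 1"
  have "30 * p' \<in> X" using assms by (simp add: p'_def)
  then have "move_block t s (blk (30 * p')) \<in> range blk" using Z ts unfolding pattern_blk by blast
  then obtain t' where t': "move_block t s (blk (30 * p')) = blk t'" by blast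
  then have "num_colour t' = 0" by (metis blk_zero colour_blk colour_def fst_conv move_block_def)
  then obtain q where q: "t' = 30 * q" unfolding colour_0_iff by (metis mult_div_mod_eq add.right_neutral)
  have "10 * p' + 1 + t = 10 * q + 1" and "s \<longleftrightarrow> even p' \<noteq> even q"
    using t' unfolding q blk_zero by (auto simp: move_block_def split: if_splits)
  then have "t = 10 * (q - p')" "s = odd (q - p')" by auto
  with ts have "Z = move_block (10 * (q - p')) (odd (q - p')) ` blk ` X" by simp
  then show "\<exists>n. Z = blk ` shift n X" unfolding move_blk_image by blast
qed

lemma special_blk: "special1 = blk ` num_special1" "special2 = blk ` num_special2"
proof -
  have h4: "num_height t \<le> 4 \<longleftrightarrow> t < 13" and h5: "num_height t \<le> 5 \<longleftrightarrow> t < 16"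
    and c5: "num_height t = 5 \<and> num_colour t \<in> {5, 3} \<longleftrightarrow> t = 13 \<or> t = 15"
    and c7: "num_height t = 7 \<and> num_colour t = 2 \<longleftrightarrow> t = 19" for t
  proof -
    have *: "list_all (\<lambda>q. (height_list ! nat q \<le> 4 \<longleftrightarrow> q < 13) \<and> (height_list ! nat q \<le> 5 \<longleftrightarrow> q < 16) \<and>
      (height_list ! nat q = 5 \<and> (colour_list ! nat q = 5 \<or> colour_list ! nat q = 3) \<longleftrightarrow> q = 13 \<or> q = 15) \<and>
      (height_list ! nat q = 7 \<and> colour_list ! nat q = 2 \<longleftrightarrow> q = 19)) [0..29]" by code_simp
    consider "t < 0" | "0 \<le> t \<and> t < 30" | "30 \<le> t" by linarith
    then have "(num_height t \<le> 4 \<longleftrightarrow> t < 13) \<and> (num_height t \<le> 5 \<longleftrightarrow> t < 16) \<and>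
      (num_height t = 5 \<and> num_colour t \<in> {5, 3} \<longleftrightarrow> t = 13 \<or> t = 15) \<and> (num_height t = 7 \<and> num_colour t = 2 \<longleftrightarrow> t = 19)"
    proof cases
      case 1 then show ?thesis using height_le_iff[of t 0] by auto
    next
      case 2 then show ?thesis using mod_30_cases[OF *, of t] by (simp add: num_height_def num_colour_def)
    next
      case 3 then show ?thesis using height_le_iff[of t 1] by auto
    qed
    then show "num_height t \<le> 4 \<longleftrightarrow> t < 13" "num_height t \<le> 5 \<longleftrightarrow> t < 16"
      "num_height t = 5 \<and> num_colour t \<in> {5, 3} \<longleftrightarrow> t = 13 \<or> t = 15"
      "num_height t = 7 \<and> num_colour t = 2 \<longleftrightarrow> t = 19" by blast+
  qed
  have "number (6, Upper, 4) = 17" by code_simp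
  then have r: "right_four = blk 17" by (simp add: right_four_def block_at_blk cells_def)
  have "special1 = blk ` ({t. num_height t \<le> 4} \<union> {t. num_height t = 5 \<and> num_colour t \<in> {5, 3}} \<union> {17})"
    unfolding special1_def pattern_blk r by auto
  also have "\<dots> = blk ` num_special1" unfolding h4 c5 num_special1_def by (rule arg_cong[of _ _ "image blk"]) auto
  finally show "special1 = blk ` num_special1" .
  have "special2 = blk ` ({t. num_height t \<le> 5} \<union> {17} \<union> {t. num_height t = 7 \<and> num_colour t = 2})"
    unfolding special2_def pattern_blk r by auto
  also have "\<dots> = blk ` num_special2" unfolding h5 c7 num_special2_def by (rule arg_cong[of _ _ "image blk"]) auto
  finally show "special2 = blk ` num_special2" .
qed

lemma young_columns_blk: "young_columns = image blk ` Collect is_column"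
proof -
  have s: "\<forall>t<30 * 0. t \<in> num_special1" "\<forall>t<30 * 0. t \<in> num_special2"
    by (auto simp: num_special1_def num_special2_def)
  have "Y \<in> young_columns \<longleftrightarrow> ordinary_column Y \<or> (\<exists>n. Y = blk ` shift n num_special1) \<or> (\<exists>n. Y = blk ` shift n num_special2)" for Y
    unfolding young_columns_def special_blk mem_Collect_eq conj_disj_distribL moved_blk_iff[OF s(1)] moved_blk_iff[OF s(2)] ..
  moreover have "ordinary_column Y \<longleftrightarrow> (\<exists>X. Y = blk ` X \<and> ordinary X)" for Y
    using ordinary_column_blk by (metis ordinary_column_def pattern_blk subset_imageE)
  moreover have "(\<exists>X. (P X \<or> (\<exists>n. X = f n \<or> X = g n)) \<and> Y = h X) \<longleftrightarrow>
      (\<exists>X. Y = h X \<and> P X) \<or> (\<exists>n. Y = h (f n)) \<or> (\<exists>n. Y = h (g n))"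
    for P and f g :: "int \<Rightarrow> int set" and h and Y :: "block set"
    by blast
  ultimately have "Y \<in> young_columns \<longleftrightarrow> (\<exists>X. is_column X \<and> Y = blk ` X)" for Y
    unfolding is_column_def by simp
  then show ?thesis by (intro set_eqI) (simp add: image_iff)
qed

lemma young_columns_iff: "blk ` X \<in> young_columns \<longleftrightarrow> is_column X"
  unfolding young_columns_blk using inj_blk by (auto simp: inj_image_eq_iff)

lemma class_of_blk:
  assumes "is_column X"
  shows "class_of (blk ` X) = range (\<lambda>n. blk ` shift n X)"
proof -
  obtain p where p: "\<forall>t<30 * p. t \<in> X" using is_column_threshold[OF assms] by blast
  have "Y \<in> class_of (blk ` X) \<longleftrightarrow> Y \<in> young_columns \<and> Y \<subseteq> pattern \<and> moved (blk ` X) Y" for Y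
    using assms by (auto simp: class_of_def column_equiv_def young_columns_iff young_columns_blk pattern_blk)
  then have "Y \<in> class_of (blk ` X) \<longleftrightarrow> Y \<in> young_columns \<and> (\<exists>n. Y = blk ` shift n X)" for Y
    unfolding moved_blk_iff[OF p] .
  moreover have "blk ` shift n X \<in> young_columns" for n using assms by (simp add: young_columns_iff)
  ultimately have "Y \<in> class_of (blk ` X) \<longleftrightarrow> (\<exists>n. Y = blk ` shift n X)" for Y
    by metis
  then show ?thesis by (intro set_eqI) (simp add: image_iff)
qed

section \<open>The table of Young columns\<close>

text \<open>An entry \<open>(l, xs, as, rs, \<phi>, \<epsilon>)\<close> describes the Young column consisting of the blocks with a number
  below \<open>l\<close> or in \<open>xs\<close>. The lists \<open>as\<close> and \<open>rs\<close> contain the addable and the removable blocks as triples of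
  colour, number and index of the resulting column; of two blocks of the same colour the one
  preferred by rule (a) comes first. The lists \<open>\<phi>\<close> and \<open>\<epsilon>\<close> contain the colour \<open>i\<close> with multiplicity
  \<open>\<phi>\<^sub>i\<close> and \<open>\<epsilon>\<^sub>i\<close>. All entries have equally many 0-blocks above any given level far below, so that
  adding a 0-block leads to an entry moved up by one period. Entry 0 is the ground state
  column, entries 156 and 153 are the special columns (S1) and (S2).\<close>

type_synonym step = "int \<times> int \<times> int"

definition columns :: "(int \<times> int list \<times> step list \<times> step list \<times> int list \<times> int list) list" where
  "columns = [
   (0,[1,2,3,5,6,8,9,11,12,14,15,17,20,23,26,29,30], [(0,0,1)], [(0,30,2)], [0], [0]),
   (-26,[-25,-24,-22,-21,-19,-18,-16,-15,-13,-10,-7,-4,-1,0], [(8,-26,3)], [(0,-30,0),(0,0,11)], [8], [0,0]),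
   (30,[31,32,33,35,36,38,39,41,42,44,45,47,50,53,56,59], [(0,60,0),(0,30,11)], [(8,59,4)], [0,0], [8]),
   (-23,[-22,-21,-19,-18,-16,-15,-13,-10,-7,-4,-1,0], [(7,-23,5)], [(0,0,6),(8,-26,1)], [7], [0,8]),
   (30,[31,32,33,35,36,38,39,41,42,44,45,47,50,53,56], [(0,30,7),(8,59,2)], [(7,56,8)], [0,8], [7]),
   (-20,[-19,-18,-16,-15,-13,-10,-7,-4,-1,0], [(6,-20,9)], [(0,0,10),(7,-23,3)], [6], [0,7]),
   (7,[8,9,11,12,14,15,17,20,23,26,29], [(0,30,3),(7,7,10)], [(8,4,11),(8,29,23)], [0,7], [8,8]),
   (4,[5,6,8,9,11,12,14,15,17,20,23,26], [(8,29,11),(8,4,23)], [(0,0,4),(7,26,12)], [8,8], [0,7]),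
   (30,[31,32,33,35,36,38,39,41,42,44,45,47,50,53], [(0,30,12),(7,56,4)], [(6,53,13)], [0,7], [6]),
   (-17,[-16,-15,-13,-10,-7,-4,-1,0], [(5,-17,14)], [(0,0,15),(6,-20,5)], [5], [0,6]),
   (10,[11,12,14,15,17,20,23,26,29], [(0,30,5),(6,10,15)], [(7,7,6),(8,29,16)], [0,6], [7,8]),
   (4,[5,6,8,9,11,12,14,15,17,20,23,26,29], [(0,30,1),(8,4,6)], [(0,0,2),(8,29,7)], [8], [8]),
   (4,[5,6,8,9,11,12,14,15,17,20,23], [(7,26,7),(8,4,17)], [(0,0,8),(6,23,18)], [7,8], [0,6]),
   (30,[31,32,33,35,36,38,39,41,42,44,45,47,50], [(0,30,18),(6,53,8)], [(5,50,19)], [0,6], [5]),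
   (-14,[-13,-10,-7,-4,-1,0], [(4,-14,20)], [(0,0,21),(5,-17,9)], [4], [0,5]),
   (13,[14,15,17,20,23,26,29], [(0,30,9),(5,13,21)], [(6,10,10),(8,29,22)], [0,5], [6,8]),
   (10,[11,12,14,15,17,20,23,26], [(6,10,22),(8,29,10)], [(7,7,23),(7,26,43)], [6,8], [7,7]),
   (7,[8,9,11,12,14,15,17,20,23], [(7,26,23),(7,7,43)], [(6,23,24),(8,4,12)], [7,7], [6,8]),
   (4,[5,6,8,9,11,12,14,15,17,20], [(6,23,12),(8,4,24)], [(0,0,13),(5,20,25)], [6,8], [0,5]),
   (30,[31,32,33,35,36,38,39,41,42,44,45,47], [(0,30,25),(5,50,13)], [(4,47,26)], [0,5], [4]),
   (-12,[-10,-7,-4,-1,0], [(2,-11,27),(3,-12,28)], [(0,0,29),(4,-14,14)], [2,3], [0,4]),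
   (16,[17,20,23,26,29], [(0,30,14),(4,16,29)], [(5,13,15),(8,29,30)], [0,4], [5,8]),
   (13,[14,15,17,20,23,26], [(5,13,30),(8,29,15)], [(6,10,16),(7,26,31)], [5,8], [6,7]),
   (7,[8,9,11,12,14,15,17,20,23,26], [(7,7,16),(8,29,6)], [(7,26,17),(8,4,7)], [7], [7]),
   (7,[8,9,11,12,14,15,17,20], [(6,23,17),(7,7,32)], [(5,20,33),(8,4,18)], [6,7], [5,8]),
   (4,[5,6,8,9,11,12,14,15,17], [(5,20,18),(8,4,33)], [(0,0,19),(4,17,34)], [5,8], [0,4]),
   (30,[31,32,33,35,36,38,39,41,42,44,45], [(0,30,34),(4,47,19)], [(2,44,35),(3,45,36)], [0,4], [2,3]),
   (-12,[-11,-10,-7,-4,-1,0], [(3,-12,37)], [(0,0,38),(2,-11,20)], [3], [0,2]),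
   (-11,[-10,-7,-4,-1,0], [(1,-9,39),(2,-11,37)], [(0,0,40),(3,-12,20)], [1,2], [0,3]),
   (18,[20,23,26,29], [(0,30,20),(2,19,38),(3,18,40)], [(4,16,21),(8,29,41)], [0,2,3], [4,8]),
   (16,[17,20,23,26], [(4,16,41),(8,29,21)], [(5,13,22),(7,26,42)], [4,8], [5,7]),
   (13,[14,15,17,20,23], [(5,13,42),(7,26,22)], [(6,10,43),(6,23,75)], [5,7], [6,6]),
   (10,[11,12,14,15,17,20], [(6,23,43),(6,10,75)], [(5,20,44),(7,7,24)], [6,6], [5,7]),
   (7,[8,9,11,12,14,15,17], [(5,20,24),(7,7,44)], [(4,17,45),(8,4,25)], [5,7], [4,8]),
   (4,[5,6,8,9,11,12,14,15], [(4,17,25),(8,4,45)], [(0,0,26),(2,14,46),(3,15,47)], [4,8], [0,2,3]),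
   (30,[31,32,33,35,36,38,39,41,42,45], [(0,30,46),(2,44,26)], [(3,45,48)], [0,2], [3]),
   (30,[31,32,33,35,36,38,39,41,42,44], [(0,30,47),(3,45,26)], [(1,42,49),(2,44,48)], [0,3], [1,2]),
   (-9,[-7,-4,-1,0], [(1,-9,50),(4,-8,51)], [(0,0,52),(2,-11,28),(3,-12,27)], [1,4], [0,2,3]),
   (18,[19,20,23,26,29], [(0,30,27),(3,18,52)], [(2,19,29),(8,29,53)], [0,3], [2,8]),
   (-11,[-10,-9,-7,-4,-1,0], [(2,-11,50)], [(0,0,54),(1,-9,28)], [2], [0,1]),
   (19,[20,23,26,29], [(0,30,28),(1,21,54),(2,19,52)], [(3,18,29),(8,29,55)], [0,1,2], [3,8]),
   (18,[20,23,26], [(2,19,53),(3,18,55),(8,29,29)], [(4,16,30),(7,26,56)], [2,3,8], [4,7]),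
   (16,[17,20,23], [(4,16,56),(7,26,30)], [(5,13,31),(6,23,57)], [4,7], [5,6]),
   (10,[11,12,14,15,17,20,23], [(6,10,31),(7,26,16)], [(6,23,32),(7,7,17)], [6], [6]),
   (10,[11,12,14,15,17], [(5,20,32),(6,10,58)], [(4,17,59),(7,7,33)], [5,6], [4,7]),
   (7,[8,9,11,12,14,15], [(4,17,33),(7,7,59)], [(2,14,60),(3,15,61),(8,4,34)], [4,7], [2,3,8]),
   (4,[5,6,8,9,11,12,15], [(2,14,34),(8,4,60)], [(0,0,35),(3,15,62)], [2,8], [0,3]),
   (4,[5,6,8,9,11,12,14], [(3,15,34),(8,4,61)], [(0,0,36),(1,12,63),(2,14,62)], [3,8], [0,1,2]),
   (30,[31,32,33,35,36,38,39,41,42], [(0,30,62),(2,44,36),(3,45,35)], [(1,42,64),(4,41,65)], [0,2,3], [1,4]),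
   (30,[31,32,33,35,36,38,39,41,44], [(0,30,63),(1,42,36)], [(2,44,64)], [0,1], [2]),
   (-8,[-7,-4,-1,0], [(4,-8,66)], [(0,0,67),(1,-9,37),(2,-11,39)], [4], [0,1,2]),
   (-9,[-8,-7,-4,-1,0], [(1,-9,66),(5,-5,68)], [(0,0,69),(4,-8,37)], [1,5], [0,4]),
   (21,[23,26,29], [(0,30,37),(1,21,67),(4,22,69)], [(2,19,40),(3,18,38),(8,29,70)], [0,1,4], [2,3,8]),
   (18,[19,20,23,26], [(3,18,70),(8,29,38)], [(2,19,41),(7,26,71)], [3,8], [2,7]),
   (19,[20,21,23,26,29], [(0,30,39),(2,19,67)], [(1,21,40),(8,29,72)], [0,2], [1,8]),
   (19,[20,23,26], [(1,21,72),(2,19,70),(8,29,40)], [(3,18,41),(7,26,73)], [1,2,8], [3,7]),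
   (18,[20,23], [(2,19,71),(3,18,73),(7,26,41)], [(4,16,42),(6,23,74)], [2,3,7], [4,6]),
   (16,[17,20], [(4,16,74),(6,23,42)], [(5,13,75),(5,20,187)], [4,6], [5,5]),
   (13,[14,15,17], [(5,20,75),(5,13,187)], [(4,17,76),(6,10,44)], [5,5], [4,6]),
   (10,[11,12,14,15], [(4,17,44),(6,10,76)], [(2,14,77),(3,15,78),(7,7,45)], [4,6], [2,3,7]),
   (7,[8,9,11,12,15], [(2,14,45),(7,7,77)], [(3,15,79),(8,4,46)], [2,7], [3,8]),
   (7,[8,9,11,12,14], [(3,15,45),(7,7,78)], [(1,12,80),(2,14,79),(8,4,47)], [3,7], [1,2,8]),
   (4,[5,6,8,9,11,12], [(2,14,47),(3,15,46),(8,4,79)], [(0,0,48),(1,12,81),(4,11,82)], [2,3,8], [0,1,4]),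
   (4,[5,6,8,9,11,14], [(1,12,47),(8,4,80)], [(0,0,49),(2,14,81)], [1,8], [0,2]),
   (30,[31,32,33,35,36,38,39,41], [(0,30,81),(1,42,48),(2,44,49)], [(4,41,83)], [0,1,2], [4]),
   (30,[31,32,33,35,36,38,39,42], [(0,30,82),(4,41,48)], [(1,42,83),(5,38,84)], [0,4], [1,5]),
   (-6,[-4,-1,0], [(3,-6,85),(5,-5,86)], [(0,0,87),(1,-9,51),(4,-8,50)], [3,5], [0,1,4]),
   (22,[23,26,29], [(0,30,50),(4,22,87)], [(1,21,52),(2,19,54),(8,29,88)], [0,4], [1,2,8]),
   (-9,[-8,-7,-5,-4,-1,0], [(1,-9,86),(6,-2,89)], [(0,0,90),(5,-5,51)], [1,6], [0,5]),
   (21,[22,23,26,29], [(0,30,51),(1,21,87),(5,25,90)], [(4,22,52),(8,29,91)], [0,1,5], [4,8]),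
   (21,[23,26], [(1,21,88),(4,22,91),(8,29,52)], [(2,19,55),(3,18,53),(7,26,92)], [1,4,8], [2,3,7]),
   (18,[19,20,23], [(3,18,92),(7,26,53)], [(2,19,56),(6,23,93)], [3,7], [2,6]),
   (19,[20,21,23,26], [(2,19,88),(8,29,54)], [(1,21,55),(7,26,94)], [2,8], [1,7]),
   (19,[20,23], [(1,21,94),(2,19,92),(7,26,55)], [(3,18,56),(6,23,95)], [1,2,7], [3,6]),
   (18,[20], [(2,19,93),(3,18,95),(6,23,56)], [(4,16,57),(5,20,96)], [2,3,6], [4,5]),
   (13,[14,15,17,20], [(5,13,57),(6,23,31)], [(5,20,58),(6,10,32)], [5], [5]),
   (13,[14,15], [(4,17,58),(5,13,97)], [(2,14,98),(3,15,99),(6,10,59)], [4,5], [2,3,6]),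
   (10,[11,12,15], [(2,14,59),(6,10,98)], [(3,15,100),(7,7,60)], [2,6], [3,7]),
   (10,[11,12,14], [(3,15,59),(6,10,99)], [(1,12,101),(2,14,100),(7,7,61)], [3,6], [1,2,7]),
   (7,[8,9,11,12], [(2,14,61),(3,15,60),(7,7,100)], [(1,12,102),(4,11,103),(8,4,62)], [2,3,7], [1,4,8]),
   (7,[8,9,11,14], [(1,12,61),(7,7,101)], [(2,14,102),(8,4,63)], [1,7], [2,8]),
   (4,[5,6,8,9,11], [(1,12,62),(2,14,63),(8,4,102)], [(0,0,64),(4,11,104)], [1,2,8], [0,4]),
   (4,[5,6,8,9,12], [(4,11,62),(8,4,103)], [(0,0,65),(1,12,104),(5,8,105)], [4,8], [0,1,5]),
   (30,[31,32,33,35,36,38,39], [(0,30,104),(1,42,65),(4,41,64)], [(3,39,106),(5,38,107)], [0,1,4], [3,5]),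
   (30,[31,32,33,35,36,39,42], [(0,30,105),(5,38,65)], [(1,42,107),(6,35,108)], [0,5], [1,6]),
   (-5,[-4,-1,0], [(5,-5,109)], [(0,0,110),(3,-6,66)], [5], [0,3]),
   (-6,[-5,-4,-1,0], [(3,-6,109),(6,-2,111)], [(0,0,112),(1,-9,68),(5,-5,66)], [3,6], [0,1,5]),
   (24,[26,29], [(0,30,66),(3,24,110),(5,25,112)], [(1,21,69),(4,22,67),(8,29,113)], [0,3,5], [1,4,8]),
   (22,[23,26], [(4,22,113),(8,29,67)], [(1,21,70),(2,19,72),(7,26,114)], [4,8], [1,2,7]),
   (-9,[-8,-7,-5,-4,-2,-1,0], [(1,-9,111),(7,1,115)], [(0,0,116),(6,-2,68)], [1,7], [0,6]),
   (21,[22,23,25,26,29], [(0,30,68),(1,21,112),(6,28,116)], [(5,25,69),(8,29,117)], [0,1,6], [5,8]),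
   (21,[22,23,26], [(1,21,113),(5,25,117),(8,29,69)], [(4,22,70),(7,26,118)], [1,5,8], [4,7]),
   (21,[23], [(1,21,114),(4,22,118),(7,26,70)], [(2,19,73),(3,18,71),(6,23,119)], [1,4,7], [2,3,6]),
   (18,[19,20], [(3,18,119),(6,23,71)], [(2,19,74),(5,20,120)], [3,6], [2,5]),
   (19,[20,21,23], [(2,19,114),(7,26,72)], [(1,21,73),(6,23,121)], [2,7], [1,6]),
   (19,[20], [(1,21,121),(2,19,119),(6,23,73)], [(3,18,74),(5,20,122)], [1,2,6], [3,5]),
   (18,[], [(2,19,120),(3,18,122),(5,20,74)], [(4,17,123),(4,16,187)], [2,3,5], [4,4]),
   (16,[], [(4,16,123),(4,17,187)], [(2,14,124),(3,15,125),(5,13,76)], [4,4], [2,3,5]),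
   (13,[15], [(2,14,76),(5,13,124)], [(3,15,126),(6,10,77)], [2,5], [3,6]),
   (13,[14], [(3,15,76),(5,13,125)], [(1,12,127),(2,14,126),(6,10,78)], [3,5], [1,2,6]),
   (10,[11,12], [(2,14,78),(3,15,77),(6,10,126)], [(1,12,128),(4,11,129),(7,7,79)], [2,3,6], [1,4,7]),
   (10,[11,14], [(1,12,78),(6,10,127)], [(2,14,128),(7,7,80)], [1,6], [2,7]),
   (7,[8,9,11], [(1,12,79),(2,14,80),(7,7,128)], [(4,11,130),(8,4,81)], [1,2,7], [4,8]),
   (7,[8,9,12], [(4,11,79),(7,7,129)], [(1,12,130),(5,8,131),(8,4,82)], [4,7], [1,5,8]),
   (4,[5,6,8,9], [(1,12,82),(4,11,81),(8,4,130)], [(0,0,83),(3,9,132),(5,8,133)], [1,4,8], [0,3,5]),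
   (4,[5,6,9,12], [(5,8,82),(8,4,131)], [(0,0,84),(1,12,133),(6,5,134)], [5,8], [0,1,6]),
   (30,[31,32,33,35,36,38], [(0,30,132),(3,39,83)], [(5,38,135)], [0,3], [5]),
   (30,[31,32,33,35,36,39], [(0,30,133),(1,42,84),(5,38,83)], [(3,39,135),(6,35,136)], [0,1,5], [3,6]),
   (30,[31,32,33,36,39,42], [(0,30,134),(6,35,84)], [(1,42,136),(7,31,137)], [0,6], [1,7]),
   (-3,[-1,0], [(4,-3,138),(6,-2,139)], [(0,0,140),(3,-6,86),(5,-5,85)], [4,6], [0,3,5]),
   (25,[26,29], [(0,30,85),(5,25,140)], [(3,24,87),(8,29,141)], [0,5], [3,8]),
   (-6,[-5,-4,-2,-1,0], [(3,-6,139),(7,1,142)], [(0,0,143),(1,-9,89),(6,-2,86)], [3,7], [0,1,6]),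
   (24,[25,26,29], [(0,30,86),(3,24,140),(6,28,143)], [(1,21,90),(5,25,87),(8,29,144)], [0,3,6], [1,5,8]),
   (24,[26], [(3,24,141),(5,25,144),(8,29,87)], [(1,21,91),(4,22,88),(7,26,145)], [3,5,8], [1,4,7]),
   (22,[23], [(4,22,145),(7,26,88)], [(1,21,92),(2,19,94),(6,23,146)], [4,7], [1,2,6]),
   (-9,[-8,-7,-5,-4,-2,-1,0,1], [(1,-9,142),(8,4,147)], [(0,0,148),(7,1,89)], [1,8], [0,7]),
   (21,[22,23,25,26,28,29], [(0,30,89),(1,21,143),(7,31,148)], [(6,28,90),(8,29,149)], [0,1,7], [6,8]),
   (21,[22,23,25,26], [(1,21,144),(6,28,149),(8,29,90)], [(5,25,91),(7,26,150)], [1,6,8], [5,7]),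
   (21,[22,23], [(1,21,145),(5,25,150),(7,26,91)], [(4,22,92),(6,23,151)], [1,5,7], [4,6]),
   (21,[], [(1,21,146),(4,22,151),(6,23,92)], [(2,19,95),(3,18,93),(5,20,152)], [1,4,6], [2,3,5]),
   (18,[19], [(3,18,152),(5,20,93)], [(2,19,96),(4,16,153)], [3,5], [2,4]),
   (19,[20,21], [(2,19,146),(6,23,94)], [(1,21,95),(5,20,154)], [2,6], [1,5]),
   (19,[], [(1,21,154),(2,19,152),(5,20,95)], [(3,18,96),(4,17,155)], [1,2,5], [3,4]),
   (17,[], [(3,18,155),(4,17,96)], [(3,15,158),(4,16,97)], [4], [4]),
   (14,[15], [(2,14,97),(4,17,156)], [(3,15,157),(5,13,98)], [2,4], [3,5]),
   (15,[], [(3,15,97),(4,16,158)], [(1,12,159),(2,14,157),(5,13,99)], [3,4], [1,2,5]),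
   (13,[], [(2,14,99),(3,15,98),(5,13,157)], [(1,12,160),(4,11,161),(6,10,100)], [2,3,5], [1,4,6]),
   (12,[14], [(1,12,99),(5,13,159)], [(2,14,160),(6,10,101)], [1,5], [2,6]),
   (10,[11], [(1,12,100),(2,14,101),(6,10,160)], [(4,11,162),(7,7,102)], [1,2,6], [4,7]),
   (10,[12], [(4,11,100),(6,10,161)], [(1,12,162),(5,8,163),(7,7,103)], [4,6], [1,5,7]),
   (7,[8,9], [(1,12,103),(4,11,102),(7,7,162)], [(3,9,164),(5,8,165),(8,4,104)], [1,4,7], [3,5,8]),
   (7,[9,12], [(5,8,103),(7,7,163)], [(1,12,165),(6,5,166),(8,4,105)], [5,7], [1,6,8]),
   (4,[5,6,8], [(3,9,104),(8,4,164)], [(0,0,106),(5,8,167)], [3,8], [0,5]),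
   (4,[5,6,9], [(1,12,105),(5,8,104),(8,4,165)], [(0,0,107),(3,9,167),(6,5,168)], [1,5,8], [0,3,6]),
   (4,[6,9,12], [(6,5,105),(8,4,166)], [(0,0,108),(1,12,168),(7,1,169)], [6,8], [0,1,7]),
   (30,[31,32,33,35,36], [(0,30,167),(3,39,107),(5,38,106)], [(4,36,170),(6,35,171)], [0,3,5], [4,6]),
   (30,[31,32,33,36,39], [(0,30,168),(1,42,108),(6,35,107)], [(3,39,171),(7,31,172)], [0,1,6], [3,7]),
   (30,[32,33,36,39,42], [(0,30,169),(7,31,108)], [(1,42,172),(8,29,173)], [0,7], [1,8]),
   (-2,[-1,0], [(2,3,174),(6,-2,175)], [(0,0,176),(4,-3,109)], [2,6], [0,4]),
   (-3,[-2,-1,0], [(4,-3,175),(7,1,177)], [(0,0,178),(3,-6,111),(6,-2,109)], [4,7], [0,3,6]),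
   (27,[29], [(0,30,109),(4,27,176),(6,28,178)], [(3,24,112),(5,25,110),(8,29,179)], [0,4,6], [3,5,8]),
   (25,[26], [(5,25,179),(8,29,110)], [(3,24,113),(7,26,180)], [5,8], [3,7]),
   (-6,[-5,-4,-2,-1,0,1], [(3,-6,177),(8,4,181)], [(0,0,182),(1,-9,115),(7,1,111)], [3,8], [0,1,7]),
   (24,[25,26,28,29], [(0,30,111),(3,24,178),(7,31,182)], [(1,21,116),(6,28,112),(8,29,183)], [0,3,7], [1,6,8]),
   (24,[25,26], [(3,24,179),(6,28,183),(8,29,112)], [(1,21,117),(5,25,113),(7,26,184)], [3,6,8], [1,5,7]),
   (24,[], [(3,24,180),(5,25,184),(7,26,113)], [(1,21,118),(4,22,114),(6,23,185)], [3,5,7], [1,4,6]),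
   (22,[], [(4,22,185),(6,23,114)], [(1,21,119),(2,19,121),(5,20,186)], [4,6], [1,2,5]),
   (-9,[-8,-7,-5,-4,-2,-1,0,1,4], [(1,-9,181)], [(8,4,115)], [1], [8]),
   (21,[22,23,25,26,28,29,31], [(0,30,115),(1,21,182)], [(7,31,116)], [0,1], [7]),
   (21,[22,23,25,26,28], [(1,21,183),(8,29,116)], [(6,28,117)], [1,8], [6]),
   (21,[22,23,25], [(1,21,184),(7,26,117)], [(5,25,118)], [1,7], [5]),
   (21,[22], [(1,21,185),(6,23,118)], [(4,22,119)], [1,6], [4]),
   (20,[], [(1,21,186),(5,20,119)], [(2,19,122),(3,18,120)], [1,5], [2,3]),
   (16,[17,19], [(4,16,120)], [(2,19,187)], [4], [2,2]),
   (19,[21], [(2,19,186),(5,20,121)], [(1,21,122),(4,17,188)], [2,5], [1,4]),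
   (17,[18], [(1,21,188),(4,17,122)], [(3,15,189),(3,18,123)], [1,4], [3,3]),
   (14,[15,17], [(2,14,187)], [(4,17,124)], [2,2], [4]),
   (14,[], [(2,14,125),(3,15,124)], [(1,12,190),(5,13,126)], [2,3], [1,5]),
   (15,[16], [(3,18,189),(3,15,123)], [(1,12,191),(4,16,125)], [3,3], [1,4]),
   (12,[13,14], [(1,12,125),(4,16,191)], [(2,14,190),(5,13,127)], [1,4], [2,5]),
   (12,[], [(1,12,126),(2,14,127),(5,13,190)], [(4,11,192),(6,10,128)], [1,2,5], [4,6]),
   (11,[12], [(4,11,126)], [(1,12,192),(6,10,129)], [4], [1,6]),
   (10,[], [(1,12,129),(4,11,128),(6,10,192)], [(3,9,193),(5,8,194),(7,7,130)], [1,4,6], [3,5,7]),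
   (8,[9,12], [(5,8,129)], [(1,12,194),(7,7,131)], [5], [1,7]),
   (7,[8], [(3,9,130),(7,7,193)], [(5,8,195),(8,4,132)], [3,7], [5,8]),
   (7,[9], [(1,12,131),(5,8,130),(7,7,194)], [(3,9,195),(6,5,196),(8,4,133)], [1,5,7], [3,6,8]),
   (5,[6,9,12], [(6,5,131)], [(1,12,196),(8,4,134)], [6], [1,8]),
   (4,[5,6], [(3,9,133),(5,8,132),(8,4,195)], [(0,0,135),(4,6,197),(6,5,198)], [3,5,8], [0,4,6]),
   (4,[6,9], [(1,12,134),(6,5,133),(8,4,196)], [(0,0,136),(3,9,198),(7,1,199)], [1,6,8], [0,3,7]),
   (1,[2,3,6,9,12], [(7,1,134)], [(0,0,137),(1,12,199)], [7], [0,1]),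
   (30,[31,32,33,35], [(0,30,197),(4,36,135)], [(2,33,200),(6,35,201)], [0,4], [2,6]),
   (30,[31,32,33,36], [(0,30,198),(3,39,136),(6,35,135)], [(4,36,201),(7,31,202)], [0,3,6], [4,7]),
   (30,[32,33,36,39], [(0,30,199),(1,42,137),(7,31,136)], [(3,39,202),(8,29,203)], [0,1,7], [3,8]),
   (29,[32,33,36,39,42], [(8,29,137)], [(1,42,203)], [8], [1]),
   (-2,[-1,0,3], [(6,-2,204)], [(0,0,205),(2,3,138)], [6], [0,2]),
   (1,[], [(2,3,204),(5,2,206),(7,1,207)], [(0,0,208),(4,-3,139),(6,-2,138)], [2,5,7], [0,4,6]),
   (28,[29], [(0,30,138),(2,33,205),(6,28,208)], [(4,27,140),(8,29,209)], [0,2,6], [4,8]),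
   (-3,[-2,-1,0,1], [(4,-3,207),(8,4,210)], [(0,0,211),(3,-6,142),(7,1,139)], [4,8], [0,3,7]),
   (27,[28,29], [(0,30,139),(4,27,208),(7,31,211)], [(3,24,143),(6,28,140),(8,29,212)], [0,4,7], [3,6,8]),
   (27,[], [(4,27,209),(6,28,212),(8,29,140)], [(3,24,144),(5,25,141),(7,26,213)], [4,6,8], [3,5,7]),
   (25,[], [(5,25,213),(7,26,141)], [(3,24,145),(6,23,214)], [5,7], [3,6]),
   (-6,[-5,-4,-2,-1,0,1,4], [(3,-6,210)], [(1,-9,147),(8,4,142)], [3], [1,8]),
   (24,[25,26,28,29,31], [(0,30,142),(3,24,211)], [(1,21,148),(7,31,143)], [0,3], [1,7]),
   (24,[25,26,28], [(3,24,212),(8,29,143)], [(1,21,149),(6,28,144)], [3,8], [1,6]),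
   (24,[25], [(3,24,213),(7,26,144)], [(1,21,150),(5,25,145)], [3,7], [1,5]),
   (23,[], [(3,24,214),(6,23,145)], [(1,21,151),(4,22,146)], [3,6], [1,4]),
   (20,[21], [(5,20,146)], [(1,21,152),(2,19,154)], [5], [1,2]),
   (16,[17], [(2,19,153),(4,16,96),(5,20,57)], [(2,14,156),(4,17,97),(5,13,58)], [2], [2]),
   (17,[18,21], [(4,17,154)], [(1,21,155),(3,15,215)], [4], [1,3]),
   (15,[16,18], [(1,21,215),(3,15,155)], [(1,12,216),(3,18,158)], [3], [3]),
   (12,[13], [(1,12,157),(2,14,159)], [(5,13,160)], [1,2], [5]),
   (12,[13,14,16], [(1,12,158),(3,18,216)], [(4,16,159)], [1,3], [4]),
   (11,[], [(1,12,161),(4,11,160)], [(3,9,217),(6,10,162)], [1,4], [3,6]),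
   (9,[], [(3,9,162),(6,10,217)], [(5,8,218),(7,7,164)], [3,6], [5,7]),
   (8,[9], [(1,12,163),(5,8,162)], [(3,9,218),(7,7,165)], [1,5], [3,7]),
   (7,[], [(3,9,165),(5,8,164),(7,7,218)], [(4,6,219),(6,5,220),(8,4,167)], [3,5,7], [4,6,8]),
   (5,[6,9], [(1,12,166),(6,5,165)], [(3,9,220),(8,4,168)], [1,6], [3,8]),
   (4,[5], [(4,6,167),(8,4,219)], [(0,0,170),(2,3,221),(6,5,222)], [4,8], [0,2,6]),
   (4,[6], [(3,9,168),(6,5,167),(8,4,220)], [(0,0,171),(4,6,222),(7,1,223)], [3,6,8], [0,4,7]),
   (1,[2,3,6,9], [(1,12,169),(7,1,168)], [(0,0,172),(3,9,223)], [1,7], [0,3]),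
   (30,[31,32,35], [(0,30,221),(2,33,170)], [(6,35,224)], [0,2], [6]),
   (30,[31,32,33], [(0,30,222),(4,36,171),(6,35,170)], [(2,33,224),(5,32,225),(7,31,226)], [0,4,6], [2,5,7]),
   (30,[32,33,36], [(0,30,223),(3,39,172),(7,31,171)], [(4,36,226),(8,29,227)], [0,3,7], [4,8]),
   (29,[32,33,36,39], [(1,42,173),(8,29,172)], [(3,39,227)], [1,8], [3]),
   (1,[3], [(5,2,228),(7,1,229)], [(0,0,230),(2,3,175),(6,-2,174)], [5,7], [0,2,6]),
   (28,[29,33], [(0,30,174),(6,28,230)], [(2,33,176),(8,29,231)], [0,6], [2,8]),
   (1,[2], [(2,3,228),(7,1,232)], [(0,0,233),(5,2,175)], [2,7], [0,5]),
   (2,[], [(2,3,229),(5,2,232),(8,4,234)], [(0,0,235),(4,-3,177),(7,1,175)], [2,5,8], [0,4,7]),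
   (30,[], [(0,30,175),(2,33,230),(5,32,233),(7,31,235)], [(4,27,178),(6,28,176),(8,29,236)], [0,2,5,7], [4,6,8]),
   (28,[], [(2,33,231),(6,28,236),(8,29,176)], [(4,27,179),(7,26,237)], [2,6,8], [4,7]),
   (-3,[-2,-1,0,1,4], [(4,-3,234)], [(3,-6,181),(8,4,177)], [4], [3,8]),
   (27,[28,29,31], [(0,30,177),(4,27,235)], [(3,24,182),(7,31,178)], [0,4], [3,7]),
   (27,[28], [(4,27,236),(8,29,178)], [(3,24,183),(6,28,179)], [4,8], [3,6]),
   (26,[], [(4,27,237),(7,26,179)], [(3,24,184),(5,25,180)], [4,7], [3,5]),
   (23,[24], [(6,23,180)], [(3,24,185)], [6], [3]),
   (15,[16,18,21], [(3,15,188)], [(1,12,238),(1,21,189)], [3], [1,1]),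
   (12,[13,14,16,18], [(1,21,238),(1,12,189)], [(3,18,191)], [1,1], [3]),
   (9,[10], [(3,9,192)], [(6,10,193)], [3], [6]),
   (8,[], [(3,9,194),(5,8,193)], [(4,6,239),(7,7,195)], [3,5], [4,7]),
   (6,[], [(4,6,195),(7,7,239)], [(2,3,240),(6,5,241),(8,4,197)], [4,7], [2,6,8]),
   (5,[6], [(3,9,196),(6,5,195)], [(4,6,241),(8,4,198)], [3,6], [4,8]),
   (3,[5], [(2,3,197),(8,4,240)], [(0,0,200),(6,5,232)], [2,8], [0,6]),
   (4,[], [(4,6,198),(6,5,197),(8,4,241)], [(0,0,201),(2,3,232),(5,2,229),(7,1,228)], [4,6,8], [0,2,5,7]),
   (1,[2,3,6], [(3,9,199),(7,1,198)], [(0,0,202),(4,6,228)], [3,7], [0,4]),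
   (30,[31,32], [(0,30,232),(2,33,201),(6,35,200)], [(5,32,235),(7,31,233)], [0,2,6], [5,7]),
   (30,[31,33], [(0,30,229),(5,32,201)], [(2,33,235),(7,31,230)], [0,5], [2,7]),
   (30,[32,33], [(0,30,228),(4,36,202),(7,31,201)], [(2,33,233),(5,32,230),(8,29,242)], [0,4,7], [2,5,8]),
   (29,[32,33,36], [(3,39,203),(8,29,202)], [(4,36,242)], [3,8], [4]),
   (1,[2,3], [(4,6,223),(7,1,222)], [(0,0,226),(2,3,206),(5,2,204)], [4,7], [0,2,5]),
   (2,[3], [(5,2,222),(8,4,243)], [(0,0,225),(2,3,207),(7,1,204)], [5,8], [0,2,7]),
   (30,[33], [(0,30,204),(5,32,226),(7,31,225)], [(2,33,208),(6,28,205),(8,29,244)], [0,5,7], [2,6,8]),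
   (28,[33], [(6,28,244),(8,29,205)], [(2,33,209),(7,26,245)], [6,8], [2,7]),
   (3,[], [(2,3,222),(6,5,221),(8,4,246)], [(0,0,224),(5,2,207),(7,1,206)], [2,6,8], [0,5,7]),
   (30,[32], [(0,30,206),(2,33,226),(7,31,224)], [(5,32,208),(8,29,247)], [0,2,7], [5,8]),
   (2,[4], [(2,3,243),(5,2,246)], [(4,-3,210),(8,4,207)], [2,5], [4,8]),
   (30,[31], [(0,30,207),(2,33,225),(5,32,224)], [(4,27,211),(7,31,208)], [0,2,5], [4,7]),
   (29,[], [(2,33,244),(5,32,247),(8,29,208)], [(4,27,212),(6,28,209)], [2,5,8], [4,6]),
   (26,[27], [(2,33,245),(7,26,209)], [(4,27,213)], [2,7], [4]),
   (12,[13,14,16,18,21], [(1,12,215)], [(1,21,216)], [1], [1]),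
   (6,[7], [(4,6,218)], [(2,3,248),(7,7,219)], [4], [2,7]),
   (3,[4,5], [(2,3,219),(7,7,248)], [(6,5,246),(8,4,221)], [2,7], [6,8]),
   (5,[], [(4,6,220),(6,5,219)], [(2,3,246),(5,2,243),(8,4,222)], [4,6], [2,5,8]),
   (29,[32,33], [(4,36,227),(8,29,226)], [(2,33,247),(5,32,244)], [4,8], [2,5]),
   (2,[3,4], [(5,2,241)], [(2,3,234),(8,4,229)], [5], [2,8]),
   (29,[33], [(5,32,242),(8,29,230)], [(2,33,236),(6,28,231)], [5,8], [2,6]),
   (26,[27,33], [(7,26,231)], [(2,33,237)], [7], [2]),
   (3,[4], [(2,3,241),(6,5,240)], [(5,2,234),(8,4,232)], [2,6], [5,8]),
   (29,[32], [(2,33,242),(8,29,233)], [(5,32,236)], [2,8], [5]),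
   (3,[4,5,7], [(2,3,239)], [(7,7,240)], [2], [7])]"

definition lo :: "int \<Rightarrow> int" where "lo a = fst (columns ! nat a)"

definition extras :: "int \<Rightarrow> int list" where "extras a = fst (snd (columns ! nat a))"

definition adds :: "int \<Rightarrow> step list" where "adds a = fst (snd (snd (columns ! nat a)))"

definition rems :: "int \<Rightarrow> step list" where "rems a = fst (snd (snd (snd (columns ! nat a))))"

definition phis :: "int \<Rightarrow> int list" where "phis a = fst (snd (snd (snd (snd (columns ! nat a)))))"

definition epss :: "int \<Rightarrow> int list" where "epss a = snd (snd (snd (snd (snd (columns ! nat a)))))"

lemma length_columns: "length columns = 249"
  by (simp add: columns_def)

lemma map_columns: "map (\<lambda>a. f (columns ! nat a)) [0..248] = map f columns"
  by (rule nth_equalityI) (simp_all add: length_columns)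

text \<open>Unfolds the interval of indices into explicit numerals. It is declared only while
  rewrite rules are being generated, since it would expand any other interval with numeral bounds as
  well.\<close>

lemmas upto_numeral_simps [simp] =
  upto.simps[of 0 "numeral m"] upto.simps[of 1 "numeral m"] upto.simps[of "- 1" "numeral m"] for m

text \<open>Each of the following facts is a conjunction of one rewrite rule per entry, so that the simplifier
  can evaluate conditions on the table without traversing it.\<close>

lemma lo_list: "map lo [0..248] = map fst columns" unfolding lo_def by (rule map_columns)
lemmas lo_simps = lo_list[unfolded columns_def, simplified]

lemma extras_list: "map extras [0..248] = map (\<lambda>x. fst (snd x)) columns" unfolding extras_def by (rule map_columns)
lemmas extras_simps = extras_list[unfolded columns_def, simplified]

lemma adds_list: "map adds [0..248] = map (\<lambda>x. fst (snd (snd x))) columns" unfolding adds_def by (rule map_columns)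
lemmas adds_simps = adds_list[unfolded columns_def, simplified]

lemma rems_list: "map rems [0..248] = map (\<lambda>x. fst (snd (snd (snd x)))) columns" unfolding rems_def by (rule map_columns)
lemmas rems_simps = rems_list[unfolded columns_def, simplified]

lemma phis_list: "map phis [0..248] = map (\<lambda>x. fst (snd (snd (snd (snd x))))) columns" unfolding phis_def by (rule map_columns)
lemmas phis_simps = phis_list[unfolded columns_def, simplified]

lemma epss_list: "map epss [0..248] = map (\<lambda>x. snd (snd (snd (snd (snd x))))) columns" unfolding epss_def by (rule map_columns)
lemmas epss_simps = epss_list[unfolded columns_def, simplified]

lemma below_map: "map below ts = map (\<lambda>t. map (\<lambda>d. t - d) (below_list ! nat (t mod 30))) ts"
  by (simp add: below_def)
text \<open>The numbers in the table run from -30 to 60, and the frontier check looks at most six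
  further up. The window for colours reaches lower because colours are also asked for at supporting
  blocks.\<close>

lemmas below_simps = below_map[of "[-30..70]", unfolded below_list_def, simplified]

definition icol :: "int \<Rightarrow> int" where "icol t = int (num_colour t)"

lemma icol_map: "map icol ts = map (\<lambda>t. int (colour_list ! nat (t mod 30))) ts"
  by (simp add: icol_def num_colour_def)
lemmas icol_simps = icol_map[of "[-40..70]", unfolded colour_list_def, simplified]

lemma num_height_map: "map num_height ts = map (\<lambda>t. height_list ! nat (t mod 30) + 10 * (t div 30)) ts"
  by (simp add: num_height_def)
lemmas num_height_simps = num_height_map[of "[-30..70]", unfolded height_list_def, simplified]

definition ids :: "int list" where "ids = [0..248]"
lemmas ids_simps = ids_def[simplified]
declare upto_numeral_simps [simp del]

section \<open>Conditions to be evaluated on the table\<close>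

definition in_col :: "int \<Rightarrow> int \<Rightarrow> bool" where "in_col a t \<longleftrightarrow> t < lo a \<or> t \<in> set (extras a)"

definition delta :: "int \<Rightarrow> int" where "delta i = (if i = 0 then 1 else 0)"

text \<open>Restores the normal form in which the threshold is the lowest missing number: once the
  block at the threshold is added, adjacent further blocks fall below the new threshold.\<close>

fun absorb :: "int \<Rightarrow> int list \<Rightarrow> int \<times> int list" where
  "absorb l [] = (l, [])"
| "absorb l (x # xs) = (if x = l then absorb (l + 1) xs else (l, x # xs))"

definition ins :: "int \<Rightarrow> int \<Rightarrow> int list \<Rightarrow> int \<times> int list" where
  "ins t l xs = (if t = l then absorb (l + 1) xs else (l, insort t xs))"

definition chk_sorted where "chk_sorted a = sorted_wrt (<) (lo a # extras a)"

text \<open>The special columns are exempt, each having one block without full support.\<close>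

definition chk_below where
  "chk_below a = (a = 153 \<or> a = 156 \<or> list_all (\<lambda>t. list_all (in_col a) (below t)) (extras a))"

definition chk_adds where
  "chk_adds a = list_all (\<lambda>(i, t, b). 0 \<le> b \<and> b \<le> 248 \<and> i = icol t \<and> \<not> in_col a t \<and>
     ins t (lo a) (extras a) = (lo b + 30 * delta i, map (\<lambda>x. x + 30 * delta i) (extras b))) (adds a)"

text \<open>The window suffices because a block is numbered at most 6 higher than any block below it.\<close>

definition chk_frontier where
  "chk_frontier a = (a = 153 \<or> a = 156 \<or> list_all (\<lambda>t. in_col a t \<or> \<not> list_all (in_col a) (below t) \<or>
     list_ex (\<lambda>(j, u, c). u = t) (adds a)) [lo a..last (lo a # extras a) + 6])"

text \<open>Removals are compared with additions only: each is the inverse of the other.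
  Completeness of the additions then carries over to the removals.\<close>

definition chk_rems where
  "chk_rems a = (list_all (\<lambda>(i, t, b). 0 \<le> b \<and> b \<le> 248 \<and> (i, t + 30 * delta i, a) \<in> set (adds b)) (rems a) \<and>
     list_all (\<lambda>(i, t, b). (i, t - 30 * delta i, a) \<in> set (rems b)) (adds a))"

fun prefs :: "(int \<Rightarrow> int \<Rightarrow> int \<Rightarrow> bool) \<Rightarrow> step list \<Rightarrow> bool" where
  "prefs P [] = True"
| "prefs P ((i, t, b) # l) = (list_all (\<lambda>(j, u, c). j = i \<longrightarrow> P i t u) l \<and> prefs P l)"

definition on_col where "on_col c t = list_ex (\<lambda>u. icol u = c) (below t)"

text \<open>For colour 4 the rejected block must fail the criterion as well. Comparison of heights
  is asymmetric by itself, whereas lying on a given colour is not, and \<open>THE\<close> requires a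
  unique choice.\<close>

definition chk_prefs where
  "chk_prefs a = (prefs (\<lambda>i t u. if i = 4 then on_col 5 t \<and> \<not> on_col 5 u else num_height u < num_height t) (adds a) \<and>
     prefs (\<lambda>i t u. if i = 4 then on_col 3 t \<and> \<not> on_col 3 u else num_height t < num_height u) (rems a))"

fun first :: "int \<Rightarrow> step list \<Rightarrow> (int \<times> int) option" where
  "first i [] = None"
| "first i ((j, t, b) # l) = (if j = i then Some (t, b) else first i l)"

text \<open>The hypothesis of rule (b). A column that \<open>f_pre i\<close> turns into
  \<open>a\<close> is \<open>a\<close> without a removable \<open>i\<close>-block, so the quantifier
  over columns becomes one over \<open>rems a\<close>; dually for \<open>e_pre i\<close> and
  \<open>adds a\<close>. The correction by \<open>30 * delta i\<close> renumbers the block when the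
  neighbouring entry stands one period higher or lower.\<close>

definition excl_in :: "int \<Rightarrow> int \<Rightarrow> bool" where
  "excl_in i a = ((i \<in> set (map fst (adds a)) \<and> list_ex (\<lambda>(j, t, b). j = i \<and> first i (adds b) = Some (t + 30 * delta i, a)) (rems a)) \<or>
     (i \<in> set (map fst (rems a)) \<and> list_ex (\<lambda>(j, t, b). j = i \<and> first i (rems b) = Some (t - 30 * delta i, a)) (adds a)))"

text \<open>Either alternative of \<open>excl_in\<close> requires the colour to be both addable and
  removable, so the inner filter loses nothing and leaves few colours to test.\<close>

definition excl :: "int \<Rightarrow> int list" where
  "excl a = filter (\<lambda>i. excl_in i a) (filter (\<lambda>i. i \<in> set (map fst (rems a))) (map fst (adds a)))"

text \<open>Instead of iterating, each value is tied to its successor: it drops by one along the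
  operator and is 0 where rule (b) or the absence of an addable block makes the operator
  vanish.\<close>

definition chk_phis where
  "chk_phis a = (list_all (\<lambda>i. if list_all (\<lambda>j. j = i) (excl a)
      then (case first i (adds a) of None \<Rightarrow> False | Some (t, b) \<Rightarrow> count_list (phis a) i = Suc (count_list (phis b) i))
      else count_list (phis a) i = 0) (map fst (adds a)) \<and> list_all (\<lambda>i. i \<in> set (map fst (adds a))) (phis a))"

definition chk_epss where
  "chk_epss a = (list_all (\<lambda>i. if list_all (\<lambda>j. j = i) (excl a)
      then (case first i (rems a) of None \<Rightarrow> False | Some (t, b) \<Rightarrow> count_list (epss a) i = Suc (count_list (epss b) i))
      else count_list (epss a) i = 0) (map fst (rems a)) \<and> list_all (\<lambda>i. i \<in> set (map fst (rems a))) (epss a))"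

text \<open>That \<open>f\<close> and \<open>e\<close> undo each other is not built into the rules:
  where two blocks compete, the preference for adding and the preference for removing have to fit
  together.\<close>

definition chk_inv where
  "chk_inv a = (list_all (\<lambda>i. case first i (adds a) of None \<Rightarrow> False | Some (t, b) \<Rightarrow> first i (rems b) = Some (t - 30 * delta i, a) \<and> i \<in> set (epss b)) (phis a)
   \<and> list_all (\<lambda>i. case first i (rems a) of None \<Rightarrow> False | Some (t, b) \<Rightarrow> first i (adds b) = Some (t + 30 * delta i, a) \<and> i \<in> set (phis b)) (epss a))"

lemmas table_simps = lo_simps extras_simps adds_simps rems_simps phis_simps epss_simps

lemma all_sorted: "list_all chk_sorted ids"
  by (simp add: ids_simps chk_sorted_def table_simps)

lemma all_below: "list_all chk_below ids"
  by (simp add: ids_simps chk_below_def table_simps in_col_def below_simps)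

lemma all_adds: "list_all chk_adds ids"
  by (simp add: ids_simps chk_adds_def table_simps in_col_def icol_simps ins_def delta_def)

lemma all_frontier: "list_all chk_frontier ids"
  by (simp add: ids_simps chk_frontier_def table_simps in_col_def below_simps upto.simps)

lemma all_rems: "list_all chk_rems ids"
  by (simp add: ids_simps chk_rems_def table_simps delta_def)

lemma all_prefs: "list_all chk_prefs ids"
  by (simp add: ids_simps chk_prefs_def table_simps on_col_def below_simps icol_simps num_height_simps)

lemma all_phis: "list_all chk_phis ids"
  by (simp add: ids_simps chk_phis_def table_simps excl_def excl_in_def delta_def)

lemma all_epss: "list_all chk_epss ids"
  by (simp add: ids_simps chk_epss_def table_simps excl_def excl_in_def delta_def)

lemma all_inv: "list_all chk_inv ids"
  by (simp add: ids_simps chk_inv_def table_simps delta_def)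

text \<open>The compared data, the threshold modulo 30 and the distances from it, do not change
  under shifts by periods. So no two entries are translates of each other.\<close>

lemma distinct_columns: "distinct (map (\<lambda>a. (lo a mod 30, map (\<lambda>x. x - lo a) (extras a))) ids)"
  by (simp add: ids_simps table_simps)

section \<open>The Young columns are those of the table\<close>

lemma set_ids: "set ids = {0..248}"
  by (simp add: ids_def)

definition col_set :: "int \<Rightarrow> int set" where "col_set a = {t. in_col a t}"

lemma col_set_eq: "col_set a = {..<lo a} \<union> set (extras a)"
  by (auto simp: col_set_def in_col_def)

lemma checks:
  assumes "a \<in> set ids"
  shows "chk_sorted a" "chk_below a" "chk_adds a" "chk_frontier a" "chk_rems a" "chk_prefs a"
    "chk_phis a" "chk_epss a" "chk_inv a"
  using assms all_sorted all_below all_adds all_frontier all_rems all_prefs all_phis all_epss all_inv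
  by (simp_all only: list_all_iff)

lemma below_bounds: "u \<in> set (below t) \<Longrightarrow> t - 6 \<le> u \<and> u < t" and below_nonempty: "below t \<noteq> []"
proof -
  have "list_all (\<lambda>q. below_list ! nat q \<noteq> [] \<and> list_all (\<lambda>d. 1 \<le> d \<and> d \<le> 6) (below_list ! nat q)) [0..29]"
    by code_simp
  from mod_30_cases[OF this, of t] show "below t \<noteq> []" "u \<in> set (below t) \<Longrightarrow> t - 6 \<le> u \<and> u < t"
    by (auto simp: below_def list_all_iff)
qed

lemma ordinaryD: "ordinary S \<Longrightarrow> t \<in> S \<Longrightarrow> u \<in> set (below t) \<Longrightarrow> u \<in> S"
  by (auto simp: ordinary_def)

lemma sorted_le_last: "sorted_wrt (<) xs \<Longrightarrow> x \<in> set xs \<Longrightarrow> x \<le> last xs" for x :: int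
  by (induction xs) (auto split: if_splits intro: less_imp_le order_trans dest: last_in_set)

lemma col_set_bounded: "a \<in> set ids \<Longrightarrow> t \<in> col_set a \<Longrightarrow> t \<le> last (lo a # extras a)"
  using sorted_le_last[of "lo a # extras a" t] sorted_le_last[of "lo a # extras a" "lo a"] checks(1)[of a]
  by (auto simp: col_set_eq chk_sorted_def simp del: sorted_wrt.simps)

lemma ordinary_col_set:
  assumes "a \<in> set ids" "a \<noteq> 153" "a \<noteq> 156"
  shows "ordinary (col_set a)"
proof -
  have "lo a - 1 \<in> col_set a" by (simp add: col_set_eq)
  moreover have "set (below t) \<subseteq> col_set a" if "t \<in> col_set a" for t
  proof (cases "t < lo a")
    case True
    then show ?thesis using below_bounds by (force simp: col_set_eq)
  next
    case False
    then have "t \<in> set (extras a)" using that by (simp add: col_set_eq)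
    then show ?thesis using checks(2)[OF assms(1)] assms(2,3)
      by (auto simp: chk_below_def list_all_iff col_set_def)
  qed
  ultimately show ?thesis using col_set_bounded[OF assms(1)] unfolding ordinary_def by blast
qed

lemma col_set_special: "col_set 156 = num_special1" "col_set 153 = num_special2"
  by (auto simp: col_set_eq lo_simps extras_simps num_special1_def num_special2_def)

lemma not_ordinary_special: "\<not> ordinary num_special1" "\<not> ordinary num_special2"
proof -
  have b: "below 17 = [15, 14]" "below 19 = [17, 16]" by code_simp+
  have "17 \<in> num_special1" "14 \<notin> num_special1" "19 \<in> num_special2" "16 \<notin> num_special2"
    by (simp_all add: num_special1_def num_special2_def)
  then show "\<not> ordinary num_special1" "\<not> ordinary num_special2"
    using b ordinaryD[of _ 17 14] ordinaryD[of _ 19 16] by (metis list.set_intros)+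
qed

lemma is_column_col_set: "a \<in> set ids \<Longrightarrow> is_column (col_set a)"
  using ordinary_col_set col_set_special shift_0 unfolding is_column_def by metis

section \<open>Exhaustion: every column is a translate of an entry\<close>

lemma absorb_set: "absorb l xs = (l', xs') \<Longrightarrow> {..<l} \<union> set xs = {..<l'} \<union> set xs'"
proof (induction l xs rule: absorb.induct)
  case (2 l x xs)
  show ?case
  proof (cases "x = l")
    case True
    then have "{..<l + 1} \<union> set xs = {..<l'} \<union> set xs'" using 2 by simp
    moreover have "{..<l + 1} = insert l {..<l}" by auto
    ultimately show ?thesis using True by simp
  next
    case False
    then show ?thesis using 2 by simp
  qed
qed simp

lemma ins_set: "ins t l xs = (l', xs') \<Longrightarrow> insert t ({..<l} \<union> set xs) = {..<l'} \<union> set xs'"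
proof (cases "t = l")
  case True
  assume "ins t l xs = (l', xs')"
  with True have "absorb (l + 1) xs = (l', xs')" by (simp add: ins_def)
  moreover have "{..<l + 1} = insert l {..<l}" by auto
  ultimately show ?thesis using absorb_set True by fastforce
next
  case False
  assume "ins t l xs = (l', xs')"
  with False have "l' = l" "xs' = insort t xs" by (simp_all add: ins_def)
  then show ?thesis by (simp add: set_insort_key)
qed

lemma shift_col_set: "shift n (col_set a) = {..<lo a + 30 * n} \<union> set (map (\<lambda>x. x + 30 * n) (extras a))"
  by (force simp: col_set_eq)

lemma addsD:
  assumes "a \<in> set ids" "(i, t, b) \<in> set (adds a)"
  shows "b \<in> set ids" "i = icol t" "t \<notin> col_set a" "insert t (col_set a) = shift (delta i) (col_set b)"
proof -
  have *: "0 \<le> b \<and> b \<le> 248 \<and> i = icol t \<and> \<not> in_col a t \<and>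
     ins t (lo a) (extras a) = (lo b + 30 * delta i, map (\<lambda>x. x + 30 * delta i) (extras b))"
    using checks(3)[OF assms(1)] assms(2) unfolding chk_adds_def list_all_iff by blast
  then show "b \<in> set ids" "i = icol t" "t \<notin> col_set a" by (auto simp: set_ids col_set_def)
  have "ins t (lo a) (extras a) = (lo b + 30 * delta i, map (\<lambda>x. x + 30 * delta i) (extras b))" using * by blast
  from ins_set[OF this] show "insert t (col_set a) = shift (delta i) (col_set b)"
    by (simp only: shift_col_set) (simp only: col_set_eq)
qed

lemma frontier:
  assumes "a \<in> set ids" "a \<noteq> 153" "a \<noteq> 156" "t \<notin> col_set a" "set (below t) \<subseteq> col_set a"
  shows "\<exists>i b. (i, t, b) \<in> set (adds a)"
proof -
  obtain u where u: "u \<in> set (below t)" using below_nonempty by (meson ex_in_conv set_empty)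
  then have "u \<in> col_set a" using assms(5) by blast
  then have "t \<le> last (lo a # extras a) + 6" using below_bounds[OF u] col_set_bounded[OF assms(1)] by fastforce
  moreover have "lo a \<le> t" using assms(4) by (auto simp: col_set_eq)
  ultimately have "t \<in> set [lo a..last (lo a # extras a) + 6]" by simp
  moreover have "list_all (\<lambda>t. in_col a t \<or> \<not> list_all (in_col a) (below t) \<or>
     list_ex (\<lambda>(j, u, c). u = t) (adds a)) [lo a..last (lo a # extras a) + 6]"
    using checks(4)[OF assms(1)] assms(2,3) unfolding chk_frontier_def by blast
  ultimately have "in_col a t \<or> \<not> list_all (in_col a) (below t) \<or> list_ex (\<lambda>(j, u, c). u = t) (adds a)"
    unfolding list_all_iff by blast
  then show ?thesis using assms(4,5) by (force simp: col_set_def list_all_iff list_ex_iff)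
qed

lemma ordinary_insert:
  assumes "ordinary S" "set (below t) \<subseteq> S"
  shows "ordinary (insert t S)"
proof -
  obtain N where "\<forall>s\<in>S. s \<le> N" using assms by (auto simp: ordinary_def)
  then have "\<forall>s\<in>insert t S. s \<le> max N t" by auto
  then show ?thesis using assms unfolding ordinary_def by blast
qed

text \<open>\<open>Z\<close> is filled up from below: everything under its lowest missing block is
  already present, so this block is a listed addition, and the table is closed under
  additions.\<close>

lemma ordinary_enum_step:
  assumes Z: "ordinary Z"
  shows "a \<in> set ids \<Longrightarrow> ordinary (col_set a) \<Longrightarrow> shift n (col_set a) \<subseteq> Z \<Longrightarrow>
    \<exists>b\<in>set ids. \<exists>m. Z = shift m (col_set b)"
proof (induction "card (Z - shift n (col_set a))" arbitrary: a n rule: less_induct)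
  case less
  let ?S = "shift n (col_set a)"
  obtain N where N: "\<forall>t\<in>Z. t \<le> N" using Z by (auto simp: ordinary_def)
  have "Z - ?S \<subseteq> {lo a + 30 * n..N}" using N by (auto simp: shift_col_set)
  then have fin: "finite (Z - ?S)" by (rule finite_subset) simp
  show ?case
  proof (cases "Z - ?S = {}")
    case True
    then show ?thesis using less by blast
  next
    case False
    define t where "t = Min (Z - ?S)"
    have t: "t \<in> Z" "t \<notin> ?S" using Min_in[OF fin False] t_def by auto
    have tb: "set (below t) \<subseteq> ?S"
    proof
      fix u assume u: "u \<in> set (below t)"
      then have "u \<in> Z" using Z t by (auto simp: ordinary_def)
      moreover have "u < t" using below_bounds u by blast
      ultimately show "u \<in> ?S" using Min_le[OF fin, of u] unfolding t_def by fastforce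
    qed
    have "a \<noteq> 153" "a \<noteq> 156" using less.prems(2) not_ordinary_special col_set_special by metis+
    moreover have "t - 30 * n \<notin> col_set a" using t by simp
    moreover have "set (below (t - 30 * n)) \<subseteq> col_set a"
      using tb below_shift[of "t - 30 * n" n] by auto
    ultimately obtain i b where ib: "(i, t - 30 * n, b) \<in> set (adds a)" using frontier less.prems(1) by meson
    note A = addsD[OF less.prems(1) ib]
    have "insert t ?S = shift n (insert (t - 30 * n) (col_set a))" by (simp add: shift_insert)
    then have eq: "insert t ?S = shift (n + delta i) (col_set b)" using A(4) by simp
    have "ordinary (insert t ?S)" using ordinary_insert tb less.prems(2) by simp
    then have "ordinary (col_set b)" using eq by simp
    moreover have "insert t ?S \<subseteq> Z" using t less.prems(3) by blast
    moreover have "card (Z - insert t ?S) < card (Z - ?S)"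
      by (rule psubset_card_mono[OF fin]) (use t in blast)
    ultimately show ?thesis using less.hyps[of "n + delta i" b] A(1) eq by simp
  qed
qed

lemma ordinary_enum:
  assumes "ordinary Z"
  shows "\<exists>b\<in>set ids. \<exists>m. Z = shift m (col_set b)"
proof -
  obtain p where p: "\<forall>t<30 * p. t \<in> Z" using ordinary_threshold[OF assms] by blast
  \<comment> \<open>Entry 208 consists of all numbers below 30, so moved by \<open>p - 1\<close>
    periods it ends exactly at the threshold \<open>30 * p\<close>.\<close>
  have "shift (p - 1) (col_set 208) \<subseteq> Z" using p by (auto simp: col_set_eq lo_simps extras_simps)
  moreover have "208 \<in> set ids" by (simp add: set_ids)
  ultimately show ?thesis using ordinary_enum_step[OF assms, of 208] ordinary_col_set[of 208] by auto
qed

lemma is_column_iff: "is_column Z \<longleftrightarrow> (\<exists>a\<in>set ids. \<exists>n. Z = shift n (col_set a))"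
proof
  assume "is_column Z"
  then consider "ordinary Z" | n where "Z = shift n (col_set 156)" | n where "Z = shift n (col_set 153)"
    unfolding is_column_def col_set_special by blast
  then show "\<exists>a\<in>set ids. \<exists>n. Z = shift n (col_set a)"
  proof cases
    case 1 then show ?thesis by (rule ordinary_enum)
  next
    case 2 then show ?thesis by (intro bexI[of _ 156] exI[of _ n]) (auto simp: set_ids)
  next
    case 3 then show ?thesis by (intro bexI[of _ 153] exI[of _ n]) (auto simp: set_ids)
  qed
qed (auto simp: is_column_col_set)

text \<open>In this normal form the threshold is the least number missing from the set, hence
  determined by the set.\<close>

lemma threshold_unique:
  fixes l l' :: int
  assumes "{..<l} \<union> set xs = {..<l'} \<union> set xs'" "sorted_wrt (<) (l # xs)" "sorted_wrt (<) (l' # xs')"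
  shows "l = l' \<and> xs = xs'"
proof -
  have m: "x < l \<or> x \<in> set xs \<longleftrightarrow> x < l' \<or> x \<in> set xs'" for x using assms(1) by blast
  have "l \<notin> set xs" "l' \<notin> set xs'" using assms(2,3) by auto
  then have l: "l = l'" using m[of l] m[of l'] assms(2,3) by fastforce
  have "set xs = set xs'"
  proof (rule set_eqI)
    fix x
    show "x \<in> set xs \<longleftrightarrow> x \<in> set xs'"
      using m[of x] assms(2,3) l by (cases "x < l") auto
  qed
  then show ?thesis using assms(2,3) l strict_sorted_equal[of xs' xs] by auto
qed

lemma col_set_unique:
  assumes "a \<in> set ids" "b \<in> set ids" "shift n (col_set a) = shift m (col_set b)"
  shows "a = b \<and> n = m"
proof -
  have "sorted_wrt (<) ((lo a + 30 * n) # map (\<lambda>x. x + 30 * n) (extras a))" if "a \<in> set ids" for a n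
    using checks(1)[OF that] by (auto simp: chk_sorted_def sorted_wrt_map)
  from threshold_unique[OF assms(3)[unfolded shift_col_set] this[OF assms(1)] this[OF assms(2)]]
  have eq: "lo a + 30 * n = lo b + 30 * m" "map (\<lambda>x. x + 30 * n) (extras a) = map (\<lambda>x. x + 30 * m) (extras b)" by auto
  have "lo a mod 30 = lo b mod 30" by (metis eq(1) mod_mult_self2)
  moreover have "map (\<lambda>x. x - lo c) (extras c) = map (\<lambda>x. x - (lo c + 30 * k)) (map (\<lambda>x. x + 30 * k) (extras c))" for c k
    by simp
  then have "map (\<lambda>x. x - lo a) (extras a) = map (\<lambda>x. x - lo b) (extras b)" using eq by metis
  moreover have "inj_on (\<lambda>a. (lo a mod 30, map (\<lambda>x. x - lo a) (extras a))) (set ids)"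
    using distinct_columns unfolding distinct_map by blast
  ultimately have "a = b" using assms(1,2) by (auto dest: inj_onD)
  then show ?thesis using eq(1) by simp
qed

text \<open>Removing any other block keeps the block without support that makes the column special.\<close>

lemma special_remove:
  assumes "is_column (S - {t})" "t \<in> S" "S = num_special1 \<and> s = 17 \<or> S = num_special2 \<and> s = 19"
  shows "t = s"
proof (rule ccontr)
  assume "t \<noteq> s"
  \<comment> \<open>Both special columns have the same shape: a threshold \<open>l\<close>, then
    \<open>l + 1\<close> and \<open>l + 3\<close>, the last block lacking its support
    \<open>l\<close>.\<close>
  obtain l where l: "l = 14 \<or> l = 16" and S: "\<And>x. x \<in> S \<longleftrightarrow> x < l \<or> x = l + 1 \<or> x = l + 3" "s = l + 3"
    using assms(3) by (force simp: num_special1_def num_special2_def)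
  have b: "below 17 = [15, 14]" "below 19 = [17, 16]" by code_simp+
  then have "l \<in> set (below s)" using l S(2) by auto
  moreover have "s \<in> S - {t}" "l \<notin> S - {t}" using S \<open>t \<noteq> s\<close> by auto
  ultimately have "\<not> ordinary (S - {t})" using ordinaryD by blast
  then obtain n where "S - {t} = shift n num_special1 \<or> S - {t} = shift n num_special2"
    using assms(1) unfolding is_column_def by blast
  then obtain l' where "\<And>x. x \<in> S - {t} \<longleftrightarrow> x < l' \<or> x = l' + 1 \<or> x = l' + 3"
  proof
    assume *: "S - {t} = shift n num_special1"
    show ?thesis by (rule that[of "14 + 30 * n"], subst *) (auto simp: num_special1_def)
  next
    assume *: "S - {t} = shift n num_special2"
    show ?thesis by (rule that[of "16 + 30 * n"], subst *) (auto simp: num_special2_def)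
  qed
  then have *: "(x < l \<or> x = l + 1 \<or> x = l + 3) \<and> x \<noteq> t \<longleftrightarrow> x < l' \<or> x = l' + 1 \<or> x = l' + 3" for x
    using S(1) by auto
  have "t \<noteq> l + 3" using \<open>t \<noteq> s\<close> S by simp
  \<comment> \<open>The shape determines its parameter; with \<open>l' = l\<close> nothing has been
    removed, a contradiction.\<close>
  then have "l' = l" using *[of "l + 3"] *[of "l' + 3"] *[of "l'"] *[of "l' + 2"] *[of "l+1"] by auto
  then show False using *[of t] assms(2) S(1) by auto
qed

text \<open>If an ordinary column stays ordinary, the new block is supported and the frontier check
  applies. If a special column becomes ordinary, the new block must be the missing support. If the
  result is special, \<open>special_remove\<close> shows that the new block is the unsupported one,
  and this identifies the entry \<open>a\<close>.\<close>

lemma adds_complete: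
  assumes a: "a \<in> set ids" and t: "t \<notin> col_set a" and c: "is_column (insert t (col_set a))"
  shows "\<exists>i b. (i, t, b) \<in> set (adds a)"
proof -
  \<comment> \<open>\<open>s\<close> is the unsupported block of the special entry \<open>k\<close>,
    and \<open>p\<close> is the entry that remains without it.\<close>
  have sp: ?thesis if ins: "insert t (col_set a) = shift n (col_set k)" and k: "k = 156 \<and> s = 17 \<and> p = 124 \<or> k = 153 \<and> s = 19 \<and> p = 187" for n k s p :: int
  proof -
    have "t - 30 * n \<in> col_set k" using ins by (metis insertI1 mem_shift)
    moreover have "col_set k - {t - 30 * n} = shift (- n) (col_set a)"
    proof -
      have "insert (t - 30 * n) (shift (- n) (col_set a)) = col_set k"
        using ins shift_insert[of "- n" t "col_set a"] by simp
      moreover have "t - 30 * n \<notin> shift (- n) (col_set a)" using t by simp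
      ultimately show ?thesis by blast
    qed
    ultimately have s: "t - 30 * n = s" "col_set k - {s} = shift (- n) (col_set a)"
      using special_remove[of "col_set k" "t - 30 * n" s] k col_set_special is_column_col_set[OF a] by auto
    have pk: "(\<exists>i b. (i, s, b) \<in> set (adds p)) \<and> col_set p = col_set k - {s} \<and> p \<in> set ids"
      using k by (auto simp: adds_simps col_set_eq lo_simps extras_simps set_ids)
    then have "shift 0 (col_set p) = shift (- n) (col_set a)" using s by simp
    then have "p = a" "n = 0" using col_set_unique[of p a 0 "- n"] pk a by auto
    then show ?thesis using pk s by auto
  qed
  consider "ordinary (insert t (col_set a))" | n where "insert t (col_set a) = shift n (col_set 156)"
    | n where "insert t (col_set a) = shift n (col_set 153)"
    using c unfolding is_column_def col_set_special by blast
  then show ?thesis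
  proof cases
    case 1
    have b: "below 17 = [15, 14]" "below 19 = [17, 16]" by code_simp+
    consider "a = 153" | "a = 156" | "a \<noteq> 153 \<and> a \<noteq> 156" by blast
    then show ?thesis
    proof cases
      case A: 1
      have "19 \<in> insert t (col_set a)" "16 \<notin> col_set a" using A col_set_special by (auto simp: num_special2_def)
      then have "t = 16" using 1 b unfolding ordinary_def by force
      then show ?thesis using A by (auto simp: adds_simps)
    next
      case A: 2
      have "17 \<in> insert t (col_set a)" "14 \<notin> col_set a" using A col_set_special by (auto simp: num_special1_def)
      then have "t = 14" using 1 b unfolding ordinary_def by force
      then show ?thesis using A by (auto simp: adds_simps)
    next
      case 3
      have "t \<notin> set (below t)" using below_bounds by blast
      then have "set (below t) \<subseteq> col_set a" using 1 unfolding ordinary_def by blast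
      then show ?thesis using frontier a 3 t by blast
    qed
  next
    case 2 then show ?thesis using sp[of n 156 17 124] by blast
  next
    case 3 then show ?thesis using sp[of n 153 19 187] by blast
  qed
qed

lemma adds_rems:
  assumes "a \<in> set ids" "(i, t, b) \<in> set (adds a)"
  shows "(i, t - 30 * delta i, a) \<in> set (rems b)"
  using checks(5)[OF assms(1)] assms(2) unfolding chk_rems_def list_all_iff by blast

lemma remsD:
  assumes "a \<in> set ids" "(i, t, b) \<in> set (rems a)"
  shows "b \<in> set ids" "(i, t + 30 * delta i, a) \<in> set (adds b)" "i = icol t" "t \<in> col_set a"
    "col_set a - {t} = shift (- delta i) (col_set b)"
proof -
  show b: "b \<in> set ids" and A: "(i, t + 30 * delta i, a) \<in> set (adds b)"
    using checks(5)[OF assms(1)] assms(2) unfolding chk_rems_def list_all_iff set_ids by fastforce+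
  note D = addsD[OF b A]
  show "i = icol t" using D(2) by (simp add: icol_def)
  have "shift (- delta i) (insert (t + 30 * delta i) (col_set b)) = col_set a" using D(4) by simp
  then have *: "insert t (shift (- delta i) (col_set b)) = col_set a" unfolding shift_insert by simp
  moreover have "t \<notin> shift (- delta i) (col_set b)" using D(3) by simp
  ultimately show "t \<in> col_set a" "col_set a - {t} = shift (- delta i) (col_set b)" by blast+
qed

text \<open>A removal is an addition read from the smaller column, whose additions are known to be
  complete; uniqueness of the description leads back to \<open>a\<close>.\<close>

lemma rems_complete:
  assumes a: "a \<in> set ids" and t: "t \<in> col_set a" and c: "is_column (col_set a - {t})"
  shows "\<exists>i b. (i, t, b) \<in> set (rems a)"
proof -
  obtain b n where b: "b \<in> set ids" "col_set a - {t} = shift n (col_set b)" using c is_column_iff by blast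
  have "insert t (shift n (col_set b)) = col_set a" using b t by blast
  then have "shift (- n) (insert t (shift n (col_set b))) = shift (- n) (col_set a)" by simp
  then have ins: "insert (t - 30 * n) (col_set b) = shift (- n) (col_set a)" unfolding shift_insert by simp
  have "t \<notin> shift n (col_set b)" using b(2) by blast
  then have nin: "t - 30 * n \<notin> col_set b" by simp
  moreover have "is_column (insert (t - 30 * n) (col_set b))" unfolding ins using is_column_col_set[OF a] by simp
  ultimately obtain i b' where ib: "(i, t - 30 * n, b') \<in> set (adds b)" using adds_complete[OF b(1)] by blast
  note D = addsD[OF b(1) ib]
  have "b' = a \<and> delta i = - n" using col_set_unique[OF D(1) a D(4)[symmetric, unfolded ins]] by simp
  then show ?thesis using adds_rems[OF b(1) ib] by auto
qed

section \<open>Kashiwara operators\<close>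

definition col :: "int \<Rightarrow> int \<Rightarrow> block set" where "col n a = blk ` shift n (col_set a)"

lemma blk_eq_iff [simp]: "blk s = blk t \<longleftrightarrow> s = t"
  using inj_blk by (auto dest: injD)

lemma blk_mem_col [simp]: "blk s \<in> col n a \<longleftrightarrow> s - 30 * n \<in> col_set a"
  unfolding col_def using inj_image_mem_iff[OF inj_blk, of s "shift n (col_set a)"] by simp

lemma young_columns_col: "Y \<in> young_columns \<longleftrightarrow> (\<exists>a\<in>set ids. \<exists>n. Y = col n a)"
proof -
  have "Y \<in> young_columns \<longleftrightarrow> (\<exists>Z. is_column Z \<and> Y = blk ` Z)"
    unfolding young_columns_blk by auto
  then show ?thesis unfolding is_column_iff col_def by metis
qed

lemma col_young: "a \<in> set ids \<Longrightarrow> col n a \<in> young_columns"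
  using young_columns_col by blast

lemma col_eq_iff: "a \<in> set ids \<Longrightarrow> b \<in> set ids \<Longrightarrow> col n a = col m b \<longleftrightarrow> a = b \<and> n = m"
  unfolding col_def inj_image_eq_iff[OF inj_blk] using col_set_unique by blast

lemma class_of_col: "a \<in> set ids \<Longrightarrow> class_of (col n a) = range (\<lambda>m. col m a)"
proof -
  assume a: "a \<in> set ids"
  have "class_of (col n a) = range (\<lambda>k. blk ` shift k (shift n (col_set a)))"
    unfolding col_def using a by (intro class_of_blk) (simp add: is_column_col_set)
  also have "\<dots> = range (\<lambda>k. col (k + n) a)" by (simp add: col_def)
  also have "\<dots> = range (\<lambda>m. col m a)"
  proof (intro equalityI subsetI)
    fix Y assume "Y \<in> range (\<lambda>m. col m a)"
    then obtain m where "Y = col (m - n + n) a" by auto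
    then show "Y \<in> range (\<lambda>k. col (k + n) a)" by blast
  qed auto
  finally show ?thesis .
qed

lemma insert_col: "insert (blk s) (col n a) = blk ` shift n (insert (s - 30 * n) (col_set a))"
  by (simp add: col_def shift_insert)

lemma remove_col: "col n a - {blk s} = blk ` shift n (col_set a - {s - 30 * n})"
proof -
  have "shift n (col_set a) - {s} = shift n (col_set a - {s - 30 * n})" by auto
  then show ?thesis unfolding col_def using image_set_diff[OF inj_blk, of "shift n (col_set a)" "{s}"] by simp
qed

lemma addable_col:
  assumes a: "a \<in> set ids"
  shows "addable i (col n a) = (\<lambda>(j, t, b). blk (t + 30 * n)) ` {(j, t, b) \<in> set (adds a). j = int i}"
proof (intro equalityI subsetI)
  fix x assume x: "x \<in> addable i (col n a)"
  then obtain s where s: "x = blk s" by (auto simp: addable_def pattern_blk)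
  then have 1: "s - 30 * n \<notin> col_set a" "num_colour s = i" and "insert (blk s) (col n a) \<in> young_columns"
    using x by (auto simp: addable_def)
  then have "is_column (insert (s - 30 * n) (col_set a))"
    unfolding insert_col young_columns_iff by simp
  then obtain j b where jb: "(j, s - 30 * n, b) \<in> set (adds a)" using adds_complete[OF a 1(1)] by blast
  have "num_colour (s - 30 * n) = i" using 1 num_colour_shift[of "s - 30 * n" n] by simp
  then have "j = int i" using addsD(2)[OF a jb] by (simp add: icol_def)
  then show "x \<in> (\<lambda>(j, t, b). blk (t + 30 * n)) ` {(j, t, b) \<in> set (adds a). j = int i}"
    using jb s by force
next
  fix x assume "x \<in> (\<lambda>(j, t, b). blk (t + 30 * n)) ` {(j, t, b) \<in> set (adds a). j = int i}"
  then obtain t b where tb: "(int i, t, b) \<in> set (adds a)" "x = blk (t + 30 * n)" by auto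
  note D = addsD[OF a tb(1)]
  have "insert x (col n a) = blk ` shift (n + delta (int i)) (col_set b)"
    unfolding tb(2) insert_col by (simp add: D(4))
  then have "insert x (col n a) \<in> young_columns" using D(1) col_young[of b] unfolding col_def by simp
  then show "x \<in> addable i (col n a)"
    using D(2,3) by (simp add: addable_def pattern_blk tb(2) icol_def)
qed

lemma removable_col:
  assumes a: "a \<in> set ids"
  shows "removable i (col n a) = (\<lambda>(j, t, b). blk (t + 30 * n)) ` {(j, t, b) \<in> set (rems a). j = int i}"
proof (intro equalityI subsetI)
  fix x assume x: "x \<in> removable i (col n a)"
  then obtain s where s: "x = blk s" by (auto simp: removable_def col_def)
  then have 1: "s - 30 * n \<in> col_set a" "num_colour s = i" and "col n a - {blk s} \<in> young_columns"
    using x by (auto simp: removable_def)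
  then have "is_column (col_set a - {s - 30 * n})"
    unfolding remove_col young_columns_iff by simp
  then obtain j b where jb: "(j, s - 30 * n, b) \<in> set (rems a)" using rems_complete[OF a 1(1)] by blast
  have "num_colour (s - 30 * n) = i" using 1 num_colour_shift[of "s - 30 * n" n] by simp
  then have "j = int i" using remsD(3)[OF a jb] by (simp add: icol_def)
  then show "x \<in> (\<lambda>(j, t, b). blk (t + 30 * n)) ` {(j, t, b) \<in> set (rems a). j = int i}"
    using jb s by force
next
  fix x assume "x \<in> (\<lambda>(j, t, b). blk (t + 30 * n)) ` {(j, t, b) \<in> set (rems a). j = int i}"
  then obtain t b where tb: "(int i, t, b) \<in> set (rems a)" "x = blk (t + 30 * n)" by auto
  note D = remsD[OF a tb(1)]
  have "col n a - {x} = blk ` shift (n - delta (int i)) (col_set b)"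
    unfolding tb(2) remove_col by (simp add: D(5))
  then have "col n a - {x} \<in> young_columns" using D(1) col_young[of b] unfolding col_def by simp
  then show "x \<in> removable i (col n a)"
    using D(3,4) by (simp add: removable_def tb(2) icol_def)
qed

lemma first_SomeD: "first i l = Some (t, b) \<Longrightarrow> (i, t, b) \<in> set l"
  by (induction i l rule: first.induct) (auto split: if_splits)

lemma first_NoneD: "first i l = None \<Longrightarrow> (i, t, b) \<notin> set l"
  by (induction i l rule: first.induct) (auto split: if_splits)

lemma first_prefs:
  "prefs P l \<Longrightarrow> first i l = Some (t, b) \<Longrightarrow> (i, u, c) \<in> set l \<Longrightarrow> u = t \<or> P i t u"
  by (induction P l rule: prefs.induct) (auto split: if_splits simp: list_all_iff)

lemma on_col_iff: "on_col (int i) t \<longleftrightarrow> lies_on_colour i (blk (t + 30 * n))"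
  unfolding on_col_def list_ex_iff lies_on_colour_blk below_shift by (auto simp: icol_def)

lemma block_to_add_col:
  assumes a: "a \<in> set ids" and f: "first (int i) (adds a) = Some (t, b)"
  shows "block_to_add i (col n a) = blk (t + 30 * n)"
proof -
  let ?P = "\<lambda>i t u. if i = 4 then on_col 5 t \<and> \<not> on_col 5 u else num_height u < num_height t"
  let ?Q = "\<lambda>b b'. if i = 4 then lies_on_colour 5 b else height b' < height b"
  have p: "prefs ?P (adds a)" using checks(6)[OF a] by (simp add: chk_prefs_def)
  have A: "x \<in> addable i (col n a) \<longleftrightarrow> (\<exists>u c. (int i, u, c) \<in> set (adds a) \<and> x = blk (u + 30 * n))" for x
    unfolding addable_col[OF a] by force
  have t: "blk (t + 30 * n) \<in> addable i (col n a)" using A first_SomeD[OF f] by blast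
  have PQ: "?Q (blk (t + 30 * n)) (blk (u + 30 * n)) \<and> \<not> ?Q (blk (u + 30 * n)) (blk (t + 30 * n))" if "?P (int i) t u" for u
    using that on_col_iff[of 5 t n] on_col_iff[of 5 u n] by (auto split: if_splits)
  have best: "?Q (blk (t + 30 * n)) x \<and> \<not> ?Q x (blk (t + 30 * n))"
    if x: "x \<in> addable i (col n a)" "x \<noteq> blk (t + 30 * n)" for x
  proof -
    obtain u c where u: "(int i, u, c) \<in> set (adds a)" "x = blk (u + 30 * n)" using A x(1) by blast
    then have "?P (int i) t u" using first_prefs[OF p f u(1)] x(2) by auto
    from PQ[OF this] show ?thesis using u by blast
  qed
  show ?thesis unfolding block_to_add_def
  proof (rule the_equality)
    show "blk (t + 30 * n) \<in> addable i (col n a) \<and> (\<forall>b'\<in>addable i (col n a). b' \<noteq> blk (t + 30 * n) \<longrightarrow> ?Q (blk (t + 30 * n)) b')"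
      using t best by blast
    show "x = blk (t + 30 * n)" if "x \<in> addable i (col n a) \<and> (\<forall>b'\<in>addable i (col n a). b' \<noteq> x \<longrightarrow> ?Q x b')" for x
      using that t best by metis
  qed
qed

lemma block_to_remove_col:
  assumes a: "a \<in> set ids" and f: "first (int i) (rems a) = Some (t, b)"
  shows "block_to_remove i (col n a) = blk (t + 30 * n)"
proof -
  let ?P = "\<lambda>i t u. if i = 4 then on_col 3 t \<and> \<not> on_col 3 u else num_height t < num_height u"
  let ?Q = "\<lambda>b b'. if i = 4 then lies_on_colour 3 b else height b < height b'"
  have p: "prefs ?P (rems a)" using checks(6)[OF a] by (simp add: chk_prefs_def)
  have A: "x \<in> removable i (col n a) \<longleftrightarrow> (\<exists>u c. (int i, u, c) \<in> set (rems a) \<and> x = blk (u + 30 * n))" for x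
    unfolding removable_col[OF a] by force
  have t: "blk (t + 30 * n) \<in> removable i (col n a)" using A first_SomeD[OF f] by blast
  have PQ: "?Q (blk (t + 30 * n)) (blk (u + 30 * n)) \<and> \<not> ?Q (blk (u + 30 * n)) (blk (t + 30 * n))" if "?P (int i) t u" for u
    using that on_col_iff[of 3 t n] on_col_iff[of 3 u n] by (auto split: if_splits)
  have best: "?Q (blk (t + 30 * n)) x \<and> \<not> ?Q x (blk (t + 30 * n))"
    if x: "x \<in> removable i (col n a)" "x \<noteq> blk (t + 30 * n)" for x
  proof -
    obtain u c where u: "(int i, u, c) \<in> set (rems a)" "x = blk (u + 30 * n)" using A x(1) by blast
    then have "?P (int i) t u" using first_prefs[OF p f u(1)] x(2) by auto
    from PQ[OF this] show ?thesis using u by blast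
  qed
  show ?thesis unfolding block_to_remove_def
  proof (rule the_equality)
    show "blk (t + 30 * n) \<in> removable i (col n a) \<and> (\<forall>b'\<in>removable i (col n a). b' \<noteq> blk (t + 30 * n) \<longrightarrow> ?Q (blk (t + 30 * n)) b')"
      using t best by blast
    show "x = blk (t + 30 * n)" if "x \<in> removable i (col n a) \<and> (\<forall>b'\<in>removable i (col n a). b' \<noteq> x \<longrightarrow> ?Q x b')" for x
      using that t best by metis
  qed
qed

lemma addable_empty_iff: "a \<in> set ids \<Longrightarrow> addable i (col n a) = {} \<longleftrightarrow> first (int i) (adds a) = None"
  unfolding addable_col by (cases "first (int i) (adds a)") (auto dest: first_NoneD first_SomeD)

lemma removable_empty_iff: "a \<in> set ids \<Longrightarrow> removable i (col n a) = {} \<longleftrightarrow> first (int i) (rems a) = None"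
  unfolding removable_col by (cases "first (int i) (rems a)") (auto dest: first_NoneD first_SomeD)

lemma f_pre_col:
  assumes a: "a \<in> set ids"
  shows "f_pre i (col n a) = map_option (\<lambda>(t, b). col (n + delta (int i)) b) (first (int i) (adds a))"
proof (cases "first (int i) (adds a)")
  case None
  then show ?thesis using addable_empty_iff[OF a] by (simp add: f_pre_def)
next
  case (Some x)
  obtain t b where x: "x = (t, b)" by force
  note D = addsD[OF a first_SomeD[OF Some[unfolded x]]]
  have "insert (blk (t + 30 * n)) (col n a) = col (n + delta (int i)) b"
    unfolding insert_col by (simp add: D(4) col_def)
  then show ?thesis using addable_empty_iff[OF a] Some block_to_add_col[OF a Some[unfolded x]]
    by (simp add: f_pre_def x)
qed

lemma e_pre_col:
  assumes a: "a \<in> set ids"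
  shows "e_pre i (col n a) = map_option (\<lambda>(t, b). col (n - delta (int i)) b) (first (int i) (rems a))"
proof (cases "first (int i) (rems a)")
  case None
  then show ?thesis using removable_empty_iff[OF a] by (simp add: e_pre_def)
next
  case (Some x)
  obtain t b where x: "x = (t, b)" by force
  note D = remsD[OF a first_SomeD[OF Some[unfolded x]]]
  have "col n a - {blk (t + 30 * n)} = col (n - delta (int i)) b"
    unfolding remove_col by (simp add: D(5) col_def)
  then show ?thesis using removable_empty_iff[OF a] Some block_to_remove_col[OF a Some[unfolded x]]
    by (simp add: e_pre_def x)
qed

section \<open>Rule (b) on the table\<close>

lemma mem_colours_first: "i \<in> set (map fst l) \<longleftrightarrow> first i l \<noteq> None"
  by (induction i l rule: first.induct) auto

lemma exclusive_f:
  assumes a: "a \<in> set ids"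
  shows "(\<exists>Y'\<in>young_columns. Y' \<noteq> col n a \<and> f_pre i Y' = Some (col n a)) \<longleftrightarrow>
    (\<exists>t b. (int i, t, b) \<in> set (rems a) \<and> first (int i) (adds b) = Some (t + 30 * delta (int i), a))"
proof
  assume "\<exists>Y'\<in>young_columns. Y' \<noteq> col n a \<and> f_pre i Y' = Some (col n a)"
  then obtain Y' where Y': "Y' \<in> young_columns" "f_pre i Y' = Some (col n a)" by blast
  then obtain m b where b: "b \<in> set ids" "Y' = col m b" using young_columns_col by blast
  with Y' have b: "b \<in> set ids" "f_pre i (col m b) = Some (col n a)" by simp_all
  then obtain t c where tc: "first (int i) (adds b) = Some (t, c)" "col (m + delta (int i)) c = col n a"
    unfolding f_pre_col[OF b(1)] by auto
  note A = first_SomeD[OF tc(1)]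
  have "c = a" using tc(2) col_eq_iff[OF addsD(1)[OF b(1) A] a] by simp
  then have "(int i, t - 30 * delta (int i), b) \<in> set (rems a)" using adds_rems[OF b(1) A] by simp
  then show "\<exists>t b. (int i, t, b) \<in> set (rems a) \<and> first (int i) (adds b) = Some (t + 30 * delta (int i), a)"
    using tc(1) \<open>c = a\<close> by (intro exI[of _ "t - 30 * delta (int i)"] exI[of _ b]) simp
next
  assume "\<exists>t b. (int i, t, b) \<in> set (rems a) \<and> first (int i) (adds b) = Some (t + 30 * delta (int i), a)"
  then obtain t b where tb: "(int i, t, b) \<in> set (rems a)" "first (int i) (adds b) = Some (t + 30 * delta (int i), a)" by blast
  note D = remsD[OF a tb(1)]
  have "f_pre i (col (n - delta (int i)) b) = Some (col n a)" unfolding f_pre_col[OF D(1)] tb(2) by simp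
  \<comment> \<open>The two columns differ in the block \<open>t\<close> that was added.\<close>
  moreover have "col (n - delta (int i)) b \<noteq> col n a"
  proof
    assume "col (n - delta (int i)) b = col n a"
    then have "shift (n - delta (int i)) (col_set b) = shift n (col_set a)"
      unfolding col_def inj_image_eq_iff[OF inj_blk] .
    then have "shift (- n) (shift (n - delta (int i)) (col_set b)) = shift (- n) (shift n (col_set a))" by simp
    then have "shift (- delta (int i)) (col_set b) = col_set a" by simp
    then show False using D(4,5) by blast
  qed
  ultimately show "\<exists>Y'\<in>young_columns. Y' \<noteq> col n a \<and> f_pre i Y' = Some (col n a)"
    using col_young[OF D(1)] by blast
qed

lemma exclusive_e:
  assumes a: "a \<in> set ids"
  shows "(\<exists>Y'\<in>young_columns. Y' \<noteq> col n a \<and> e_pre i Y' = Some (col n a)) \<longleftrightarrow>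
    (\<exists>t b. (int i, t, b) \<in> set (adds a) \<and> first (int i) (rems b) = Some (t - 30 * delta (int i), a))"
proof
  assume "\<exists>Y'\<in>young_columns. Y' \<noteq> col n a \<and> e_pre i Y' = Some (col n a)"
  then obtain Y' where Y': "Y' \<in> young_columns" "e_pre i Y' = Some (col n a)" by blast
  then obtain m b where b: "b \<in> set ids" "Y' = col m b" using young_columns_col by blast
  with Y' have b: "b \<in> set ids" "e_pre i (col m b) = Some (col n a)" by simp_all
  then obtain t c where tc: "first (int i) (rems b) = Some (t, c)" "col (m - delta (int i)) c = col n a"
    unfolding e_pre_col[OF b(1)] by auto
  note A = first_SomeD[OF tc(1)]
  have "c = a" using tc(2) col_eq_iff[OF remsD(1)[OF b(1) A] a] by simp
  then have "(int i, t + 30 * delta (int i), b) \<in> set (adds a)" using remsD(2)[OF b(1) A] by simp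
  then show "\<exists>t b. (int i, t, b) \<in> set (adds a) \<and> first (int i) (rems b) = Some (t - 30 * delta (int i), a)"
    using tc(1) \<open>c = a\<close> by (intro exI[of _ "t + 30 * delta (int i)"] exI[of _ b]) simp
next
  assume "\<exists>t b. (int i, t, b) \<in> set (adds a) \<and> first (int i) (rems b) = Some (t - 30 * delta (int i), a)"
  then obtain t b where tb: "(int i, t, b) \<in> set (adds a)" "first (int i) (rems b) = Some (t - 30 * delta (int i), a)" by blast
  note D = addsD[OF a tb(1)]
  have "e_pre i (col (n + delta (int i)) b) = Some (col n a)" unfolding e_pre_col[OF D(1)] tb(2) by simp
  moreover have "col (n + delta (int i)) b \<noteq> col n a"
  proof
    assume "col (n + delta (int i)) b = col n a"
    then have "shift (n + delta (int i)) (col_set b) = shift n (col_set a)"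
      unfolding col_def inj_image_eq_iff[OF inj_blk] .
    then have "shift (- n) (shift (n + delta (int i)) (col_set b)) = shift (- n) (shift n (col_set a))" by simp
    then have "shift (delta (int i)) (col_set b) = col_set a" by simp
    then show False using D(3,4) by blast
  qed
  ultimately show "\<exists>Y'\<in>young_columns. Y' \<noteq> col n a \<and> e_pre i Y' = Some (col n a)"
    using col_young[OF D(1)] by blast
qed

lemma exclusive_col:
  assumes a: "a \<in> set ids"
  shows "exclusive i (col n a) \<longleftrightarrow> excl_in (int i) a"
proof -
  have "list_ex (\<lambda>(j, t, b). j = int i \<and> Q t b) l \<longleftrightarrow> (\<exists>t b. (int i, t, b) \<in> set l \<and> Q t b)" for Q and l :: "step list"
    by (force simp: list_ex_iff)
  then show ?thesis
    unfolding exclusive_def excl_in_def mem_colours_first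
    using exclusive_f[OF a, of n i] exclusive_e[OF a, of n i] addable_empty_iff[OF a, of i n] removable_empty_iff[OF a, of i n]
    by (simp add: Bex_def) blast
qed

lemma excl_iff: "j \<in> set (excl a) \<longleftrightarrow> excl_in j a"
  unfolding excl_def excl_in_def by (force simp: list_ex_iff)

lemma colour_le_8: "num_colour t \<le> 8"
proof -
  have "list_all (\<lambda>q. colour_list ! nat q \<le> 8) [0..29]" by code_simp
  from mod_30_cases[OF this, of t] show ?thesis by (simp add: num_colour_def)
qed

lemma excl_nat:
  assumes a: "a \<in> set ids" and j: "j \<in> set (excl a)"
  shows "\<exists>k\<in>colours. j = int k"
proof -
  have "j \<in> set (map fst (adds a))" using j by (auto simp: excl_def)
  then obtain t b where "(j, t, b) \<in> set (adds a)" by auto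
  then have "j = int (num_colour t)" using addsD(2)[OF a] icol_def by metis
  then show ?thesis using colour_le_8[of t] by auto
qed

lemma exclusive_other:
  assumes a: "a \<in> set ids"
  shows "(\<exists>k\<in>colours. k \<noteq> i \<and> exclusive k (col n a)) \<longleftrightarrow> \<not> list_all (\<lambda>j. j = int i) (excl a)"
  unfolding list_all_iff exclusive_col[OF a] excl_iff[symmetric] using excl_nat[OF a] by fastforce

lemma count_list_SucD: "count_list xs x = Suc n \<Longrightarrow> x \<in> set xs"
  by (metis count_notin nat.simps(3))

text \<open>By \<open>chk_phis\<close>, the multiplicity of \<open>i\<close> in
  \<open>phis a\<close> is positive exactly if some \<open>i\<close>-block is addable and no other
  colour is exclusive. Membership in \<open>phis a\<close> thus accounts for rule (b).\<close>

lemma col_f_col: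
  assumes a: "a \<in> set ids"
  shows "col_f i (col n a) = (if int i \<in> set (phis a)
    then map_option (\<lambda>(t, b). col (n + delta (int i)) b) (first (int i) (adds a)) else None)"
proof -
  have C: "(if list_all (\<lambda>j. j = int i) (excl a) then (case first (int i) (adds a) of None \<Rightarrow> False | Some (t, b) \<Rightarrow> count_list (phis a) (int i) = Suc (count_list (phis b) (int i)))
      else count_list (phis a) (int i) = 0)" if "int i \<in> set (map fst (adds a))"
    using checks(7)[OF a] that unfolding chk_phis_def list_all_iff by blast
  have S: "int i \<in> set (map fst (adds a))" if "int i \<in> set (phis a)"
    using checks(7)[OF a] that unfolding chk_phis_def list_all_iff by blast
  show ?thesis
  proof (cases "int i \<in> set (map fst (adds a))")
    case False
    then have "first (int i) (adds a) = None" unfolding mem_colours_first by blast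
    then show ?thesis by (simp add: col_f_def f_pre_col[OF a])
  next
    case True
    then show ?thesis using C[OF True]
      unfolding col_f_def f_pre_col[OF a] exclusive_other[OF a]
      by (auto simp: count_list_0_iff dest: count_list_SucD split: option.splits if_splits)
  qed
qed

lemma col_e_col:
  assumes a: "a \<in> set ids"
  shows "col_e i (col n a) = (if int i \<in> set (epss a)
    then map_option (\<lambda>(t, b). col (n - delta (int i)) b) (first (int i) (rems a)) else None)"
proof -
  have C: "(if list_all (\<lambda>j. j = int i) (excl a) then (case first (int i) (rems a) of None \<Rightarrow> False | Some (t, b) \<Rightarrow> count_list (epss a) (int i) = Suc (count_list (epss b) (int i)))
      else count_list (epss a) (int i) = 0)" if "int i \<in> set (map fst (rems a))"
    using checks(8)[OF a] that unfolding chk_epss_def list_all_iff by blast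
  have S: "int i \<in> set (map fst (rems a))" if "int i \<in> set (epss a)"
    using checks(8)[OF a] that unfolding chk_epss_def list_all_iff by blast
  show ?thesis
  proof (cases "int i \<in> set (map fst (rems a))")
    case False
    then have "first (int i) (rems a) = None" unfolding mem_colours_first by blast
    then show ?thesis by (simp add: col_e_def e_pre_col[OF a])
  next
    case True
    then show ?thesis using C[OF True]
      unfolding col_e_def e_pre_col[OF a] exclusive_other[OF a]
      by (auto simp: count_list_0_iff dest: count_list_SucD split: option.splits if_splits)
  qed
qed

section \<open>The crystal and the energy function\<close>

definition up :: "int \<Rightarrow> int \<Rightarrow> int option" where
  "up i a = (if i \<in> set (phis a) then map_option snd (first i (adds a)) else None)"

definition dn :: "int \<Rightarrow> int \<Rightarrow> int option" where
  "dn i a = (if i \<in> set (epss a) then map_option snd (first i (rems a)) else None)"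

lemma phis_first:
  assumes a: "a \<in> set ids" and i: "i \<in> set (phis a)"
  shows "\<exists>t b. first i (adds a) = Some (t, b) \<and> b \<in> set ids \<and> count_list (phis a) i = Suc (count_list (phis b) i)
    \<and> i \<in> set (epss b) \<and> first i (rems b) = Some (t - 30 * delta i, a)"
proof -
  have "case first i (adds a) of None \<Rightarrow> False | Some (t, b) \<Rightarrow> first i (rems b) = Some (t - 30 * delta i, a) \<and> i \<in> set (epss b)"
    using checks(9)[OF a] i unfolding chk_inv_def list_all_iff by blast
  then obtain t b where tb: "first i (adds a) = Some (t, b)" "first i (rems b) = Some (t - 30 * delta i, a)" "i \<in> set (epss b)"
    by (auto split: option.splits)
  have "i \<in> set (map fst (adds a))" using checks(7)[OF a] i unfolding chk_phis_def list_all_iff by blast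
  then have "if list_all (\<lambda>j. j = i) (excl a) then (case first i (adds a) of None \<Rightarrow> False | Some (t, b) \<Rightarrow> count_list (phis a) i = Suc (count_list (phis b) i))
      else count_list (phis a) i = 0"
    using checks(7)[OF a] unfolding chk_phis_def list_all_iff by blast
  then have "count_list (phis a) i = Suc (count_list (phis b) i)" using tb i by (auto simp: count_list_0_iff split: if_splits)
  then show ?thesis using tb addsD(1)[OF a first_SomeD[OF tb(1)]] by blast
qed

lemma epss_first:
  assumes a: "a \<in> set ids" and i: "i \<in> set (epss a)"
  shows "\<exists>t b. first i (rems a) = Some (t, b) \<and> b \<in> set ids \<and> count_list (epss a) i = Suc (count_list (epss b) i)
    \<and> i \<in> set (phis b) \<and> first i (adds b) = Some (t + 30 * delta i, a)"
proof -
  have "case first i (rems a) of None \<Rightarrow> False | Some (t, b) \<Rightarrow> first i (adds b) = Some (t + 30 * delta i, a) \<and> i \<in> set (phis b)"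
    using checks(9)[OF a] i unfolding chk_inv_def list_all_iff by blast
  then obtain t b where tb: "first i (rems a) = Some (t, b)" "first i (adds b) = Some (t + 30 * delta i, a)" "i \<in> set (phis b)"
    by (auto split: option.splits)
  have "i \<in> set (map fst (rems a))" using checks(8)[OF a] i unfolding chk_epss_def list_all_iff by blast
  then have "if list_all (\<lambda>j. j = i) (excl a) then (case first i (rems a) of None \<Rightarrow> False | Some (t, b) \<Rightarrow> count_list (epss a) i = Suc (count_list (epss b) i))
      else count_list (epss a) i = 0"
    using checks(8)[OF a] unfolding chk_epss_def list_all_iff by blast
  then have "count_list (epss a) i = Suc (count_list (epss b) i)" using tb i by (auto simp: count_list_0_iff split: if_splits)
  then show ?thesis using tb remsD(1)[OF a first_SomeD[OF tb(1)]] by blast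
qed

lemma up_eq_None_iff: "a \<in> set ids \<Longrightarrow> up i a = None \<longleftrightarrow> i \<notin> set (phis a)"
  using phis_first[of a i] by (auto simp: up_def)

lemma dn_eq_None_iff: "a \<in> set ids \<Longrightarrow> dn i a = None \<longleftrightarrow> i \<notin> set (epss a)"
  using epss_first[of a i] by (auto simp: dn_def)

lemma upD:
  assumes a: "a \<in> set ids" and u: "up i a = Some b"
  shows "b \<in> set ids" "dn i b = Some a" "count_list (phis a) i = Suc (count_list (phis b) i)"
    "count_list (epss b) i = Suc (count_list (epss a) i)"
    "\<exists>t. t \<notin> col_set a \<and> insert t (col_set a) = shift (delta i) (col_set b)"
proof -
  have i: "i \<in> set (phis a)" using u by (auto simp: up_def split: if_splits)
  then obtain t where t: "first i (adds a) = Some (t, b)" "b \<in> set ids" "count_list (phis a) i = Suc (count_list (phis b) i)"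
    "i \<in> set (epss b)" "first i (rems b) = Some (t - 30 * delta i, a)"
    using phis_first[OF a i] u by (auto simp: up_def)
  then show "b \<in> set ids" "dn i b = Some a" "count_list (phis a) i = Suc (count_list (phis b) i)"
    by (simp_all add: dn_def)
  show "count_list (epss b) i = Suc (count_list (epss a) i)" using epss_first[OF t(2) t(4)] t(5) by auto
  show "\<exists>t. t \<notin> col_set a \<and> insert t (col_set a) = shift (delta i) (col_set b)"
    using addsD[OF a first_SomeD[OF t(1)]] by blast
qed

lemma dnD:
  assumes a: "a \<in> set ids" and u: "dn i a = Some b"
  shows "b \<in> set ids" "up i b = Some a"
proof -
  have i: "i \<in> set (epss a)" using u by (auto simp: dn_def split: if_splits)
  then obtain t where t: "first i (rems a) = Some (t, b)" "b \<in> set ids"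
    "i \<in> set (phis b)" "first i (adds b) = Some (t + 30 * delta i, a)"
    using epss_first[OF a i] u by (auto simp: dn_def)
  then show "b \<in> set ids" "up i b = Some a" by (simp_all add: up_def)
qed

lemma col_f_up: "a \<in> set ids \<Longrightarrow> col_f i (col n a) = map_option (col (n + delta (int i))) (up (int i) a)"
  unfolding col_f_col up_def by (cases "first (int i) (adds a)") auto

lemma col_e_dn: "a \<in> set ids \<Longrightarrow> col_e i (col n a) = map_option (col (n - delta (int i))) (dn (int i) a)"
  unfolding col_e_col dn_def by (cases "first (int i) (rems a)") auto

definition cls :: "int \<Rightarrow> block set set" where "cls a = range (\<lambda>m. col m a)"

lemma class_of_col_cls: "a \<in> set ids \<Longrightarrow> class_of (col n a) = cls a"
  by (simp add: class_of_col cls_def)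

lemma cls_crystal: "a \<in> set ids \<Longrightarrow> cls a \<in> crystal"
  using quotientI[OF col_young, of a column_equiv 0] class_of_col_cls[of a 0]
  by (simp add: crystal_def class_of_def)

lemma some_cls: "a \<in> set ids \<Longrightarrow> \<exists>m. (SOME Y. Y \<in> cls a) = col m a"
proof -
  have "(SOME Y. Y \<in> cls a) \<in> cls a" by (rule someI[of _ "col 0 a"]) (simp add: cls_def)
  then show ?thesis by (auto simp: cls_def)
qed

lemma cr_f_cls:
  assumes a: "a \<in> set ids"
  shows "cr_f i (cls a) = map_option cls (up (int i) a)"
proof -
  obtain m where m: "(SOME Y. Y \<in> cls a) = col m a" using some_cls[OF a] by blast
  show ?thesis unfolding cr_f_def m col_f_up[OF a]
    using upD(1)[OF a] class_of_col_cls by (cases "up (int i) a") auto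
qed

lemma cr_e_cls:
  assumes a: "a \<in> set ids"
  shows "cr_e i (cls a) = map_option cls (dn (int i) a)"
proof -
  obtain m where m: "(SOME Y. Y \<in> cls a) = col m a" using some_cls[OF a] by blast
  show ?thesis unfolding cr_e_def m col_e_dn[OF a]
    using dnD(1)[OF a] class_of_col_cls by (cases "dn (int i) a") auto
qed

section \<open>String lengths as multiplicities in the table\<close>

lemma iterate_0: "iterate g 0 x = Some x"
  by (simp add: iterate_def)

text \<open>The iteration adds new applications on the outside; induction along a string needs the
  first step split off instead.\<close>

lemma iterate_Suc: "iterate g (Suc n) x = (case g x of None \<Rightarrow> None | Some y \<Rightarrow> iterate g n y)"
proof -
  have "((\<lambda>y. Option.bind y g) ^^ n) None = None" by (induction n) auto
  then show ?thesis by (simp add: iterate_def funpow_Suc_right del: funpow.simps split: option.splits)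
qed

lemma iterate_cr_f:
  "a \<in> set ids \<Longrightarrow> iterate (cr_f i) n (cls a) \<noteq> None \<longleftrightarrow> n \<le> count_list (phis a) (int i)"
proof (induction n arbitrary: a)
  case (Suc n)
  show ?case
  proof (cases "up (int i) a")
    case None
    then have "int i \<notin> set (phis a)" using up_eq_None_iff[OF Suc.prems] by blast
    then show ?thesis by (simp add: None iterate_Suc cr_f_cls[OF Suc.prems])
  next
    case (Some b)
    then show ?thesis using Suc.IH[of b] upD[OF Suc.prems Some] by (simp add: iterate_Suc cr_f_cls[OF Suc.prems])
  qed
qed (simp add: iterate_0)

lemma iterate_cr_e:
  "a \<in> set ids \<Longrightarrow> iterate (cr_e i) n (cls a) \<noteq> None \<longleftrightarrow> n \<le> count_list (epss a) (int i)"
proof (induction n arbitrary: a)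
  case (Suc n)
  show ?case
  proof (cases "dn (int i) a")
    case None
    then have "int i \<notin> set (epss a)" using dn_eq_None_iff[OF Suc.prems] by blast
    then show ?thesis by (simp add: None iterate_Suc cr_e_cls[OF Suc.prems])
  next
    case (Some b)
    note b = dnD[OF Suc.prems Some]
    show ?thesis using Some Suc.IH[of b] b upD[OF b] by (simp add: iterate_Suc cr_e_cls[OF Suc.prems])
  qed
qed (simp add: iterate_0)

lemma phi_cls: "a \<in> set ids \<Longrightarrow> phi i (cls a) = count_list (phis a) (int i)"
  unfolding phi_def iterate_cr_f by (intro Max_eqI) auto

lemma eps_cls: "a \<in> set ids \<Longrightarrow> eps i (cls a) = count_list (epss a) (int i)"
  unfolding eps_def iterate_cr_e by (intro Max_eqI) auto

text \<open>Records only the behaviour under the operators, so it is stable under adding a constant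
  to \<open>h\<close>. In the end this allows \<open>h 0 0 = 1\<close> to be arranged.\<close>

definition tensor_invariant :: "(int \<Rightarrow> int \<Rightarrow> int) \<Rightarrow> bool" where
  "tensor_invariant h \<longleftrightarrow> (\<forall>a\<in>set ids. \<forall>b\<in>set ids. \<forall>i\<in>{0..8}.
     (\<forall>a'. count_list (epss b) i < count_list (phis a) i \<longrightarrow> up i a = Some a' \<longrightarrow> h a' b = h a b + delta i) \<and>
     (\<forall>b'. count_list (phis a) i \<le> count_list (epss b) i \<longrightarrow> up i b = Some b' \<longrightarrow> h a b' = h a b - delta i))"

lemma energy_tensor_invariant:
  assumes H: "energy_function H"
  shows "tensor_invariant (\<lambda>a b. H (cls a, cls b))"
  unfolding tensor_invariant_def
proof (intro ballI conjI allI impI)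
  fix a b a' i :: int
  assume ab: "a \<in> set ids" "b \<in> set ids" and i: "i \<in> {0..8}" and u: "up i a = Some a'"
    and less: "count_list (epss b) i < count_list (phis a) i"
  define k where "k = nat i"
  have k: "i = int k" "k \<in> colours" using i by (auto simp: k_def)
  have c: "cr_f k (cls a) = Some (cls a')" using cr_f_cls[OF ab(1), of k] u k(1) by simp
  then have t: "tensor_f k (cls a, cls b) = Some (cls a', cls b)"
    using less by (simp add: phi_cls eps_cls ab k(1))
  show "H (cls a', cls b) = H (cls a, cls b) + delta i"
  proof (cases "k = 0")
    case True
    then show ?thesis using H c t cls_crystal[OF ab(1)] cls_crystal[OF ab(2)] k
      unfolding energy_function_def delta_def by simp
  next
    case False
    then show ?thesis using H t cls_crystal[OF ab(1)] cls_crystal[OF ab(2)] k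
      unfolding energy_function_def delta_def by (simp del: tensor_f.simps)
  qed
next
  fix a b b' i :: int
  assume ab: "a \<in> set ids" "b \<in> set ids" and i: "i \<in> {0..8}" and u: "up i b = Some b'"
    and le: "count_list (phis a) i \<le> count_list (epss b) i"
  define k where "k = nat i"
  have k: "i = int k" "k \<in> colours" using i by (auto simp: k_def)
  have c: "cr_f k (cls b) = Some (cls b')" using cr_f_cls[OF ab(2), of k] u k(1) by simp
  then have t: "tensor_f k (cls a, cls b) = Some (cls a, cls b')"
    using le by (simp add: phi_cls eps_cls ab k(1))
  show "H (cls a, cls b') = H (cls a, cls b) - delta i"
  proof (cases "k = 0")
    case True
    then show ?thesis using H c t cls_crystal[OF ab(1)] cls_crystal[OF ab(2)] k
      unfolding energy_function_def delta_def by simp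
  next
    case False
    then show ?thesis using H t cls_crystal[OF ab(1)] cls_crystal[OF ab(2)] k
      unfolding energy_function_def delta_def by (simp del: tensor_f.simps)
  qed
qed

lemma ground_column_col: "ground_column = col 0 0"
proof -
  define C :: "(int \<times> nat) list" where "C = [(1,7), (1,5), (1,2), (2,6), (2,4), (3,5), (3,3), (4,4), (4,1), (5,2), (5,3),
           (7,5), (8,6), (9,7), (10,8), (11,0)]"
  \<comment> \<open>Two periods are searched because the 0-block of cube 11 has number 30. Number 17
    is the right 4-block, which belongs to the entry although its height and colour are not in
    \<open>C\<close>.\<close>
  have ch: "list_all (\<lambda>t. ((num_height t, num_colour t) \<in> set C) = (t = 17 \<or> t \<in> set (extras 0)) \<or> t = 17) [0..59]"
    unfolding C_def extras_simps num_height_def num_colour_def by code_simp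
  have hb: "1 \<le> h \<and> h \<le> 11" if "(h, c) \<in> set C" for h :: int and c using that by (auto simp: C_def)
  have "num_height t \<le> 0 \<or> (num_height t, num_colour t) \<in> set C \<or> t = 17 \<longleftrightarrow> in_col 0 t" for t
  proof -
    consider "t < 0" | "0 \<le> t \<and> t < 60" | "60 \<le> t" by linarith
    then show ?thesis
    proof cases
      case 1
      then show ?thesis using height_le_iff[of t 0] by (simp add: in_col_def lo_simps)
    next
      case 2
      then have "t \<in> set [0..59]" by simp
      then have "((num_height t, num_colour t) \<in> set C) = (t = 17 \<or> t \<in> set (extras 0)) \<or> t = 17"
        using ch unfolding list_all_iff by blast
      moreover have "\<not> num_height t \<le> 0" using height_le_iff[of t 0] 2 by simp
      moreover have "17 \<in> set (extras 0)" by (simp add: extras_simps)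
      ultimately show ?thesis using 2 by (auto simp: in_col_def lo_simps)
    next
      case 3
      then have "\<not> num_height t \<le> 20" using height_le_iff[of t 2] by simp
      moreover have "\<not> in_col 0 t" using 3 by (auto simp: in_col_def lo_simps extras_simps)
      ultimately show ?thesis using hb[of "num_height t" "num_colour t"] 3 by auto
    qed
  qed
  then have s: "{t. num_height t \<le> 0 \<or> (num_height t, num_colour t) \<in> set C \<or> t = 17} = col_set 0"
    by (simp add: col_set_def)
  have "number (6, Upper, 4) = 17" by code_simp
  then have "right_four = blk 17" by (simp add: right_four_def block_at_blk cells_def)
  then have g: "ground_column = {b \<in> range blk. height b \<le> 0} \<union> {b \<in> range blk. (height b, colour b) \<in> set C} \<union> {blk 17}"
    by (simp only: ground_column_def pattern_blk C_def list.set)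
  have b: "{b \<in> range blk. height b \<le> 0} \<union> {b \<in> range blk. (height b, colour b) \<in> set C} \<union> {blk 17} =
      blk ` {t. num_height t \<le> 0 \<or> (num_height t, num_colour t) \<in> set C \<or> t = 17}"
    by auto
  show ?thesis unfolding g b s col_def shift_0 ..
qed

text \<open>Every entry except 0 has a neighbour of smaller index in the crystal graph, so an
  induction on the index reaches all entries from the ground state column.\<close>

definition chk_parent :: "int \<Rightarrow> bool" where
  "chk_parent a = (a = 0 \<or> list_ex (\<lambda>i. case first i (adds a) of None \<Rightarrow> False | Some (t, b) \<Rightarrow> b < a) (phis a) \<or>
     list_ex (\<lambda>i. case first i (rems a) of None \<Rightarrow> False | Some (t, b) \<Rightarrow> b < a) (epss a))"

lemma all_parent: "list_all chk_parent ids"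
  by (simp add: ids_simps chk_parent_def table_simps)

text \<open>In a walk the entry \<open>i + 1\<close> stands for \<open>f\<^sub>i\<close> and \<open>- (i + 1)\<close> for \<open>e\<^sub>i\<close>.\<close>

fun column_walk :: "int list \<Rightarrow> int \<Rightarrow> int \<Rightarrow> (int \<times> int) option" where
  "column_walk [] a n = Some (a, n)"
| "column_walk (s # l) a n = (if 0 < s then (case up (s - 1) a of None \<Rightarrow> None | Some b \<Rightarrow> column_walk l b (n + delta (s - 1)))
     else (case dn (- s - 1) a of None \<Rightarrow> None | Some b \<Rightarrow> column_walk l b (n - delta (- s - 1))))"

text \<open>A closed walk in the crystal graph with one more \<open>f\<close> than \<open>e\<close>
  of colour 0. On columns it leads from the ground state column to its translate one period higher,
  which links all translates.\<close>

lemma loop_walk: "column_walk [1, 9, -1, 8, 7, 6, 5, 3, 4, 2, 5, 4, 6, 5, 3, 7, 6, 5, 4, 2, 8, 7, 6, 5, 3, 4, 5, 6, 7, 8, 9, 1] 0 0 = Some (0, 1)"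
  by (simp add: up_def dn_def table_simps delta_def)

lemma phis_colours: "a \<in> set ids \<Longrightarrow> i \<in> set (phis a) \<Longrightarrow> i \<in> {0..8}"
proof -
  assume a: "a \<in> set ids" "i \<in> set (phis a)"
  then obtain t b where "(i, t, b) \<in> set (adds a)" using phis_first[OF a] first_SomeD by blast
  then have "i = int (num_colour t)" using addsD(2)[OF a(1)] icol_def by metis
  then show ?thesis using colour_le_8[of t] by auto
qed

lemma up_colours: "a \<in> set ids \<Longrightarrow> up i a = Some b \<Longrightarrow> i \<in> {0..8}"
  using phis_colours by (auto simp: up_def split: if_splits)

text \<open>Compatibility carries the claim along each edge in both directions, by \<open>f\<close>
  forwards and by \<open>e\<close> backwards. It holds at the ground state column by assumption, at
  the translates of that column by the loop, and elsewhere by the induction behind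
  \<open>chk_parent\<close>. Since \<open>f\<close> of colour 0 lowers the exponent, moving up a
  period costs 1.\<close>

lemma identification:
  assumes \<Phi>: "column_identification m \<Phi>" and a: "a \<in> set ids"
  shows "\<Phi> r (col n a) = (m r - n, cls a)"
proof -
  define G where "G a n \<longleftrightarrow> \<Phi> r (col n a) = (m r - n, cls a)" for a n
  have up: "G a n \<longleftrightarrow> G b (n + delta i)" if a: "a \<in> set ids" and u: "up i a = Some b" for a b i n
  proof -
    define k where "k = nat i"
    have k: "i = int k" "k \<in> colours" using up_colours[OF that] by (auto simp: k_def)
    note b = upD(1)[OF a u] and d = upD(2)[OF a u]
    have ef: "map_option (\<Phi> r) (col_f i Y) = aff_f i (\<Phi> r Y)" "map_option (\<Phi> r) (col_e i Y) = aff_e i (\<Phi> r Y)"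
      if "Y \<in> young_columns" "i \<in> colours" for i Y
      using \<Phi> that unfolding column_identification_def by blast+
    show ?thesis
    proof
      assume "G a n"
      then show "G b (n + delta i)"
        using ef(1)[OF col_young[OF a] k(2), of n] u k by (simp add: G_def col_f_up[OF a] cr_f_cls[OF a] delta_def)
    next
      assume "G b (n + delta i)"
      then show "G a n"
        using ef(2)[OF col_young[OF b] k(2), of "n + delta i"] d k by (simp add: G_def col_e_dn[OF b] cr_e_cls[OF b] delta_def)
    qed
  qed
  have dn: "G a n \<longleftrightarrow> G b (n - delta i)" if a: "a \<in> set ids" and u: "dn i a = Some b" for a b i n
    using up[OF dnD[OF a u], of "n - delta i"] by simp
  \<comment> \<open>The summand \<open>x\<close> lets a walk computed at one height be used at every
    height.\<close>
  have walk: "a \<in> set ids \<Longrightarrow> column_walk l a n = Some (b, n') \<Longrightarrow> G a (n + x) \<longleftrightarrow> G b (n' + x)" for l a n b n' x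
  proof (induction l a n rule: column_walk.induct)
    case (2 s l a n)
    show ?case
    proof (cases "0 < s")
      case True
      then obtain c where c: "up (s - 1) a = Some c" "column_walk l c (n + delta (s - 1)) = Some (b, n')"
        using 2 by (auto split: option.splits)
      have "c \<in> set ids" using upD(1) c 2 by blast
      then have "G c (n + delta (s - 1) + x) \<longleftrightarrow> G b (n' + x)" using 2(1)[OF True c(1)] c by blast
      then show ?thesis using up[OF 2(3) c(1), of "n + x"] by (simp add: algebra_simps)
    next
      case False
      then obtain c where c: "dn (- s - 1) a = Some c" "column_walk l c (n - delta (- s - 1)) = Some (b, n')"
        using 2 by (auto split: option.splits)
      have "c \<in> set ids" using dnD(1) c 2 by blast
      then have "G c (n - delta (- s - 1) + x) \<longleftrightarrow> G b (n' + x)" using 2(2)[OF False c(1)] c by blast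
      then show ?thesis using dn[OF 2(3) c(1), of "n + x"] by (simp add: algebra_simps)
    qed
  qed auto
  have "\<Phi> r (col 0 0) = (m r, class_of (col 0 0))"
    using \<Phi> unfolding column_identification_def ground_column_col by blast
  moreover have z: "0 \<in> set ids" by (simp add: set_ids)
  ultimately have G0: "G 0 0" by (simp add: G_def class_of_col_cls)
  have step: "G 0 n \<longleftrightarrow> G 0 (n + 1)" for n using walk[OF z loop_walk, of n] by (simp add: add.commute)
  have G0n: "G 0 n" for n
  proof (induction n rule: int_induct[of _ 0])
    case (step1 i) then show ?case using step by blast
  next
    case (step2 i) then show ?case using step[of "i - 1"] by simp
  qed (rule G0)
  have "\<forall>n. G a n" using a
  proof (induction "nat a" arbitrary: a rule: less_induct)
    case less
    show ?case
    proof (cases "a = 0")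
      case False
      have "chk_parent a" using all_parent less.prems by (simp only: list_all_iff)
      then have "(\<exists>i t b. i \<in> set (phis a) \<and> first i (adds a) = Some (t, b) \<and> b < a) \<or>
          (\<exists>i t b. i \<in> set (epss a) \<and> first i (rems a) = Some (t, b) \<and> b < a)"
        using False unfolding chk_parent_def list_ex_iff by (auto split: option.splits)
      then have "\<exists>i b. b < a \<and> (up i a = Some b \<or> dn i a = Some b)"
        by (elim disjE exE) (force simp: up_def dn_def)+
      then obtain i b where ib: "b < a" "up i a = Some b \<or> dn i a = Some b" by blast
      have b: "b \<in> set ids" using ib upD(1) dnD(1) less.prems by blast
      then have "\<forall>n. G b n" using less.hyps[of b] ib(1) by (simp add: set_ids)
      then show ?thesis using ib(2) up dn less.prems by blast
    next
      case True
      then show ?thesis using G0n by blast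
    qed
  qed
  then show ?thesis by (simp add: G_def)
qed

section \<open>Pairs of columns\<close>

text \<open>The pairs of classical highest weight, each with a walk to the pair of ground state columns.\<close>

definition top_walks :: "(int \<times> int \<times> int list) list" where
  "top_walks = [(0, 0, []),
   (0, 1, [-1]),
   (1, 0, [9,8,7,6,5,4,3,5,6,7,8,2,4,5,6,7,3,5,6,4,5,2,4,3,5,6,7,8,9,9,8,7,6,5,4,3,5,6,7,8,2,4,5,6,7,3,5,6,4,5,2,4,3,5,6,7,8,9,1]),
   (1, 1, [9,8,7,6,5,4,3,5,6,7,8,2,4,5,6,7,3,5,6,4,5,2,4,3,5,6,7,8,9,9,8,7,6,5,4,3,5,6,7,8,2,4,5,6,7,3,5,6,4,5,2,4,3,5,6,7,8,-1,9,1]),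
   (1, 2, [-1,-9,-8,-7,-6,-5,-4,-3,-5,-6,-7,-8,-2,-4,-5,-6,-7,-3,-5,-6,-4,-5,-2,-4,-3,-5,-6,-7,-8,-9,-9,-8,-7,-6,-5,-4,-3,-5,-6,-7,-8,-2,-4,-5,-6,-7,-3,-5,-6,-4,-5,-2,-4,-3,-5,-6,-7,-8,-9,-1]),
   (1, 3, [-1,-9,-1,-9,-8,-7,-6,-5,-4,-3,-5,-6,-7,-8,-2,-4,-5,-6,-7,-3,-5,-6,-4,-5,-2,-4,-3,-5,-6,-7,-8,-9,-1]),
   (1, 11, [-1,-9,-8,-7,-6,-5,-4,-3,-5,-6,-7,-8,-2,-4,-5,-6,-7,-3,-5,-6,-4,-5,-2,-4,-3,-5,-6,-7,-8,-9,-1]),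
   (1, 147, [-1,-9,-8,-7,-6,-5,-4,-3,-5,-6,-7,-8,-9,-1])]"

text \<open>The \<open>a\<close>-th list contains, for the pairs \<open>(a, b)\<close> with \<open>\<phi>(a) = \<epsilon>(b)\<close> for which \<open>a\<close> is not contained in
  \<open>b\<close>, the index \<open>b\<close> and a walk from \<open>(a, b)\<close> that moves the right column down relative to the left one,
  by two periods if \<open>a\<close> is not even contained in \<open>b\<close> moved up by one.\<close>

definition walk_table :: "(int \<times> int list) list list" where
  "walk_table = [
   [], [], [(1,[9,1,-9,-1])], [], [(3,[8,9,-8,1,-9,-1])], [],
   [(5,[-9,-1]), (7,[9,1]), (115,[9,1])], [],
   [(5,[7,8,9,-7,-8,1,-9,-1]), (7,[9,1]), (115,[2,4,5,6,7,8,9,9,1,1])], [],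
   [(9,[-9,-1]), (12,[9,1]), (89,[-9,-1]), (221,[9,1])], [(147,[2,4,5,6,7,8,9,1])], [],
   [(9,[6,7,8,9,-6,-7,-8,1,-9,-1]), (12,[9,1]), (89,[2,4,5,6,7,8,9,8,9,1,1]), (221,[3,5,6,7,8,9,9,1,1])],
   [], [(14,[-9,-1]), (18,[9,1]), (68,[-9,-1]), (132,[9,1]), (206,[-9,-1])],
   [(17,[8,9,1]), (240,[8,9,1])], [], [(240,[3,5,6,7,8,9,8,9,1])],
   [(14,[5,6,7,8,9,-5,-6,-7,-8,1,-9,-1]), (18,[9,1]), (68,[2,4,5,6,7,8,9,7,8,9,1,1]), (132,[4,5,6,7,8,9,9,1,1]), (206,[3,5,6,7,8,9,8,9,1,1])],
   [], [(20,[-9,-1]), (25,[9,1]), (51,[-9,-1]), (81,[9,1]), (138,[-9,-1]), (223,[-9,-1])],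
   [(24,[8,9,1]), (164,[8,9,1]), (246,[-8,-9,-1])], [(248,[3,5,6,7,8,9,1])], [],
   [(164,[4,5,6,7,8,9,8,9,1]), (246,[3,5,6,7,8,9,7,8,9,1])],
   [(20,[3,5,6,7,8,9,-3,-5,-6,-7,-8,1,-9,-1]), (25,[9,1]), (51,[2,4,5,6,7,8,9,6,7,8,9,1,1]), (81,[3,5,6,7,8,9,9,1,1]), (138,[3,5,6,7,8,9,7,8,9,1,1]), (223,[4,5,6,7,8,9,8,9,1,1])],
   [], [], [(34,[9,1]), (37,[-9,-1])],
   [(33,[8,9,1]), (102,[8,9,1]), (220,[-8,-9,-1]), (234,[-8,-9,-1])],
   [(32,[7,8,9,1]), (193,[7,8,9,1])], [], [(193,[4,5,6,7,8,7,8,9,1])],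
   [(102,[3,5,6,7,8,9,8,9,1]), (220,[4,5,6,7,8,9,7,8,9,1]), (234,[-4,-5,-3,-5,-6,-7,-8,-9,-1])],
   [(27,[4,5,6,7,8,9,-4,-5,-6,-7,-8,1,-9,-1]), (63,[9,-4,-5,-6,-7,-8,1,-9,-1]), (174,[7,8,9,-4,-5,-6,-7,-8,1,-9,-1])],
   [(28,[3,5,6,7,8,9,-3,-5,-6,-7,-8,1,-9,-1]), (46,[9,-3,-5,-6,-7,-8,1,-9,-1]), (85,[6,7,8,9,-3,-5,-6,-7,-8,1,-9,-1]), (199,[8,9,-3,-5,-6,-7,-8,1,-9,-1])],
   [], [(28,[3,5,6,7,8,9,1,-9,-1]), (46,[9,1]), (85,[-9,-1]), (199,[-9,-1])], [],
   [(47,[9,1]), (50,[-9,-1])], [(45,[8,9,1])],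
   [(44,[7,8,9,1]), (128,[7,8,9,1]), (218,[-7,-8,-9,-1])], [(217,[4,5,6,7,8,9,1])], [],
   [(128,[3,5,6,7,8,7,8,9,1]), (218,[-3,-5,-4,-5,-6,-7,-8,-9,-1])],
   [(80,[-4,-5,-6,-7,-8,-9,-1]), (243,[-4,-5,-6,-7,-8,-9,-1])],
   [(60,[-3,-5,-6,-7,-8,-9,-1]), (196,[-3,-5,-6,-7,-8,-9,-1]), (210,[-3,-5,-6,-7,-8,-9,-1])],
   [(34,[9,1]), (37,[5,6,7,8,9,-5,-6,-7,-8,1,-9,-1])],
   [(39,[3,5,6,7,8,9,-3,-5,-6,-7,-8,1,-9,-1]), (169,[8,9,-3,-5,-6,-7,-8,1,-9,-1])], [], [],
   [(62,[9,1]), (66,[-9,-1])],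
   [(40,[3,5,6,7,8,9,1]), (60,[8,9,1]), (196,[-8,-9,-1]), (210,[-8,-9,-1])],
   [(27,[4,5,6,7,8,9,1,-9,-1]), (63,[9,1]), (174,[-9,-1])], [(61,[8,9,1])], [(59,[7,8,9,1])],
   [(58,[6,7,8,9,1]), (160,[6,7,8,9,1])], [], [(160,[3,5,6,7,6,7,8,9,1])],
   [(101,[-4,-5,-6,-7,-8,-9,-1]), (239,[-4,-5,-6,-7,-8,-9,-1])],
   [(77,[-3,-5,-6,-7,-8,-9,-1]), (194,[-3,-5,-6,-7,-8,-9,-1])], [],
   [(166,[-3,-5,-6,-7,-8,-9,-1]), (181,[-3,-5,-6,-7,-8,-9,-1])],
   [(47,[9,1]), (50,[5,6,7,8,9,-5,-6,-7,-8,1,-9,-1])],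
   [(20,[-6,-7,-8,-9,4,3,5,6,7,8,-1,9,1]), (25,[9,1]), (51,[6,7,8,9,-6,-7,-8,1,-9,-1]), (81,[9,-6,-7,-8,1,-9,-1]), (138,[7,8,9,-6,-7,-8,1,-9,-1]), (223,[8,9,-6,-7,-8,1,-9,-1])],
   [],
   [(20,[-3,-5,-6,-7,-8,-9,-9,-1,-1]), (25,[9,1]), (51,[6,7,8,9,1,-9,-1]), (81,[9,1]), (138,[-9,-1]), (223,[-9,-1])],
   [], [(82,[9,1]), (86,[-9,-1])], [(79,[8,9,1])],
   [(55,[3,5,6,7,8,9,1]), (77,[7,8,9,1]), (194,[-7,-8,-9,-1])],
   [(38,[4,5,6,7,8,9,1]), (80,[8,9,1]), (243,[-8,-9,-1])], [(78,[7,8,9,1])], [(76,[6,7,8,9,1])],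
   [(190,[3,5,6,7,8,9,1])], [], [(127,[-4,-5,-6,-7,-8,-9,-1])],
   [(98,[-3,-5,-6,-7,-8,-9,-1]), (192,[-3,-5,-6,-7,-8,-9,-1])], [],
   [(163,[-3,-5,-6,-7,-8,-9,-1])], [],
   [(102,[-6,-7,-8,-9,-1]), (220,[-6,-7,-8,-9,-1]), (234,[-6,-7,-8,-9,-1])],
   [(62,[9,1]), (66,[6,7,8,9,-6,-7,-8,1,-9,-1])],
   [(14,[-2,-4,-5,-6,-7,-8,-9,-7,-8,-9,-1,-1]), (18,[9,1]), (68,[7,8,9,-7,-8,1,-9,-1]), (132,[9,-7,-8,1,-9,-1]), (206,[8,9,-7,-8,1,-9,-1])],
   [], [], [(104,[9,1]), (109,[-9,-1])],
   [(29,[-3,-5,-6,-7,-8,-9,-8,-9,-1]), (33,[8,9,1]), (69,[6,7,8,9,1]), (102,[8,9,1]), (220,[-8,-9,-1]), (234,[-8,-9,-1])],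
   [], [(105,[9,1]), (111,[-9,-1])], [(103,[8,9,1])], [(100,[7,8,9,1])],
   [(73,[3,5,6,7,8,9,1]), (98,[6,7,8,9,1]), (192,[-6,-7,-8,-9,-1])],
   [(53,[4,5,6,7,8,9,1]), (101,[7,8,9,1]), (239,[-7,-8,-9,-1])], [(99,[6,7,8,9,1])],
   [(97,[5,6,7,8,9,1])], [], [(159,[-4,-5,-6,-7,-8,-9,-1])], [(124,[-3,-5,-6,-7,-8,-9,-1])], [],
   [(161,[-3,-5,-6,-7,-8,-9,-1])], [], [(128,[-6,-7,-8,-9,-1]), (218,[-6,-7,-8,-9,-1])], [],
   [(164,[-7,-8,-9,-1]), (246,[-7,-8,-9,-1])],
   [(28,[3,5,6,7,8,9,-6,-7,-8,1,-9,-1]), (46,[9,1]), (85,[6,7,8,9,-6,-7,-8,1,-9,-1]), (199,[8,9,-6,-7,-8,1,-9,-1])],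
   [(82,[9,1]), (86,[7,8,9,-7,-8,1,-9,-1])],
   [(9,[-2,-4,-5,-6,-7,-8,-9,-8,-9,-1,-1]), (12,[9,1]), (89,[8,9,-8,1,-9,-1]), (221,[9,-8,1,-9,-1])],
   [],
   [(14,[-4,-5,-6,-7,-8,-9,-9,-1,-1]), (18,[9,1]), (68,[7,8,9,1,-9,-1]), (132,[9,1]), (206,[-9,-1])],
   [], [(133,[9,1]), (139,[-9,-1])], [(130,[8,9,1])],
   [(41,[-3,-5,-6,-7,-8,-7,-8,-9,-1]), (44,[7,8,9,1]), (91,[6,7,8,9,1]), (128,[7,8,9,1]), (218,[-7,-8,-9,-1])],
   [], [(134,[9,1]), (142,[9,1])], [(131,[8,9,1])], [(129,[7,8,9,1])], [(126,[6,7,8,9,1])],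
   [(95,[3,5,6,7,8,9,1]), (124,[5,6,7,8,9,1])], [(71,[4,5,6,7,8,9,1]), (127,[6,7,8,9,1])],
   [(125,[5,6,7,8,9,1])], [(156,[3,5,6,7,8,9,1]), (191,[4,5,6,7,8,9,1])], [], [], [],
   [(157,[-3,-5,-6,-7,-8,-9,-1])], [], [(160,[-6,-7,-8,-9,-1])], [], [(193,[-7,-8,-9,-1])],
   [(196,[-6,-7,-8,-9,-1]), (210,[-6,-7,-8,-9,-1])], [], [(240,[-8,-9,-1])],
   [(104,[9,1]), (109,[7,8,9,-7,-8,1,-9,-1])], [(105,[9,1]), (111,[8,9,-8,1,-9,-1])],
   [(5,[-2,-4,-5,-6,-7,-8,-9,-9,-1,-1]), (7,[9,1]), (115,[9,1,-9,-1])], [], [],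
   [(167,[9,1]), (175,[-9,-1])],
   [(21,[-4,-5,-6,-7,-8,-9,-8,-9,-1]), (24,[8,9,1]), (90,[7,8,9,1]), (164,[8,9,1]), (246,[-8,-9,-1])],
   [], [(168,[9,1]), (177,[9,1])], [(165,[8,9,1])], [(162,[7,8,9,1])],
   [(56,[4,5,3,5,6,7,8,9,1]), (58,[6,7,8,9,1]), (118,[6,7,8,9,1]), (160,[6,7,8,9,1])], [],
   [(39,[3,5,6,7,8,9,-8,1,-9,-1]), (169,[8,9,-8,1,-9,-1])],
   [(54,[3,5,6,7,8,9,1]), (166,[7,8,9,1]), (181,[-7,-8,-9,-1])],
   [(72,[3,5,6,7,8,9,1]), (163,[6,7,8,9,1])], [(94,[3,5,6,7,8,9,1]), (161,[5,6,7,8,9,1])],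
   [(121,[3,5,6,7,8,9,1]), (157,[4,5,6,7,8,9,1])],
   [(123,[-3,-5,-6,-7,-8,-9,-1]), (156,[3,5,6,7,8,9,1]), (191,[4,5,6,7,8,9,1])],
   [(93,[4,5,6,7,8,9,1]), (159,[5,6,7,8,9,1])], [(158,[4,5,6,7,8,9,1])], [], [], [], [], [],
   [(191,[-2,-4,-5,-6,-7,-8,-9,-1])], [], [(190,[-2,-4,-5,-6,-7,-8,-9,-1])],
   [(194,[-6,-7,-8,-9,-1])], [], [(217,[-2,-4,-5,-6,-7,-8,-9,-1])], [], [],
   [(248,[-2,-4,-5,-6,-7,-8,-9,-1])],
   [(20,[-3,-5,-6,-7,-8,-9,-7,-8,-9,-1,-1]), (25,[9,1]), (51,[6,7,8,9,-7,-8,1,-9,-1]), (81,[9,1]), (138,[7,8,9,-7,-8,1,-9,-1]), (223,[8,9,-7,-8,1,-9,-1])],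
   [(133,[9,1]), (139,[8,9,-8,1,-9,-1])], [(134,[9,1]), (142,[9,1,-9,-1])],
   [(11,[-2,-4,-5,-6,-7,-8,-9,-1]), (147,[2,4,5,6,7,8,9,-2,-4,-5,-6,-7,-8,1,-9,-1])], [], [],
   [(197,[9,1]), (204,[-9,-1])], [], [(198,[9,1]), (207,[9,1])], [(195,[8,9,1])],
   [(30,[-4,-5,-6,-7,-8,-7,-8,-9,-1]), (32,[7,8,9,1]), (117,[7,8,9,1]), (193,[7,8,9,1])], [],
   [(28,[3,5,6,7,8,9,-8,1,-9,-1]), (46,[9,1]), (85,[6,7,8,9,-8,1,-9,-1]), (199,[8,9,-8,1,-9,-1])],
   [(40,[3,5,6,7,8,9,1]), (60,[8,9,1]), (110,[6,7,8,9,1]), (196,[7,8,9,1]), (210,[-7,-8,-9,-1])],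
   [(55,[3,5,6,7,8,9,1]), (77,[7,8,9,1]), (141,[6,7,8,9,1]), (194,[6,7,8,9,1])],
   [(73,[3,5,6,7,8,9,1]), (98,[6,7,8,9,1]), (192,[5,6,7,8,9,1])],
   [(75,[-3,-5,-6,-7,-8,-9,-1]), (150,[2,4,5,6,7,8,9,1]), (190,[3,5,6,7,8,9,1])], [],
   [(123,[-4,-5,-6,-7,-8,-9,-1]), (151,[2,4,5,6,7,8,9,1]), (156,[3,5,6,7,8,9,1]), (191,[4,5,6,7,8,9,1])],
   [(216,[2,4,5,6,7,8,9,1])], [], [], [], [], [], [], [],
   [(220,[-7,-8,-9,-1]), (234,[-7,-8,-9,-1])], [], [],
   [(27,[4,5,6,7,8,9,-7,-8,1,-9,-1]), (63,[9,1]), (174,[7,8,9,-7,-8,1,-9,-1])],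
   [(167,[9,1]), (175,[8,9,-8,1,-9,-1])], [(168,[9,1]), (177,[9,1,-9,-1])],
   [(54,[3,5,6,7,8,9,1]), (166,[7,8,9,1]), (181,[4,5,6,7,8,9,-4,-5,-6,-7,-8,1,-9,-1])], [],
   [(9,[-3,-5,-6,-7,-8,-9,-9,-1,-1]), (12,[9,1]), (89,[8,9,1,-9,-1]), (221,[9,1,-9,-1])], [],
   [], [(222,[9,1])], [(219,[8,9,1])], [],
   [(20,[-4,-5,-6,-7,-8,-9,-8,-9,-1,-1]), (25,[9,1]), (51,[6,7,8,9,-8,1,-9,-1]), (81,[9,1]), (138,[7,8,9,-8,1,-9,-1]), (223,[8,9,-8,1,-9,-1])],
   [(29,[-4,-2,4,3,5,6,7,8,9,1]), (33,[8,9,1]), (69,[6,7,8,9,1]), (102,[8,9,1]), (176,[7,8,9,1]), (220,[7,8,9,1]), (234,[-7,-8,-9,-1])],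
   [(41,[3,5,4,5,6,7,8,9,1]), (44,[7,8,9,1]), (91,[6,7,8,9,1]), (128,[7,8,9,1]), (218,[6,7,8,9,1])],
   [(43,[-4,-5,-6,-7,-8,-9,-1]), (149,[2,4,5,6,7,8,9,1]), (217,[4,5,6,7,8,9,1])],
   [(189,[-2,-4,-5,-6,-7,-8,-9,-1]), (216,[2,4,5,6,7,8,9,1])], [], [], [], [], [],
   [(243,[-7,-8,-9,-1])], [], [], [(197,[9,1]), (204,[8,9,-8,1,-9,-1])],
   [(14,[-3,-5,-6,-7,-8,-9,-8,-9,-1,-1]), (18,[9,1]), (68,[7,8,9,-8,1,-9,-1]), (132,[9,1]), (206,[8,9,-8,1,-9,-1])],
   [(198,[9,1]), (207,[9,1,-9,-1])],
   [(40,[3,5,6,7,8,9,1]), (60,[8,9,1]), (110,[6,7,8,9,1]), (196,[7,8,9,1]), (210,[5,6,7,8,9,-5,-6,-7,-8,1,-9,-1])],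
   [], [(246,[-8,-9,-1])], [(232,[9,1,-9,-1])],
   [(15,[-3,-5,-6,-7,-8,-9,-8,-9,-1]), (17,[8,9,1]), (116,[8,9,1]), (240,[8,9,-8,1,-9,-1])], [],
   [(229,[9,1,-9,-1])], [], [(228,[8,9,-8,1,-9,-1])], [(241,[7,8,9,1])],
   [(53,[4,5,6,7,8,9,1]), (101,[7,8,9,1]), (239,[5,6,7,8,9,1])], [], [], [], [],
   [(29,[4,5,3,5,6,7,8,9,1]), (33,[8,9,1]), (69,[6,7,8,9,1]), (102,[8,9,1]), (176,[7,8,9,1]), (220,[7,8,9,1]), (234,[6,7,8,9,-6,-7,-8,1,-9,-1])],
   [],
   [(21,[-3,-5,-6,-7,-8,-9,-7,-8,-9,-1]), (24,[8,9,1]), (90,[7,8,9,1]), (164,[8,9,1]), (233,[8,9,1]), (246,[7,8,9,-7,-8,1,-9,-1])],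
   [(23,[-3,-5,-6,-7,-8,-9,-1]), (148,[2,4,5,6,7,8,9,1]), (248,[3,5,6,7,8,9,-3,-5,-6,-7,-8,1,-9,-1])],
   [], [(38,[4,5,6,7,8,9,1]), (80,[8,9,1]), (205,[7,8,9,1]), (243,[6,7,8,9,-6,-7,-8,1,-9,-1])],
   []]"

definition walks :: "int \<Rightarrow> (int \<times> int list) list" where "walks a = walk_table ! nat a"

declare upto_numeral_simps [simp]

lemma length_walk_table: "length walk_table = 249"
  by (simp add: walk_table_def)

lemma walks_list: "map walks ids = walk_table"
  unfolding walks_def ids_def by (rule nth_equalityI) (simp_all add: length_walk_table del: upto_numeral_simps)
lemmas walks_simps = walks_list[unfolded walk_table_def ids_simps, simplified]
declare upto_numeral_simps [simp del]

text \<open>The operators act on the factor chosen by the tensor product rule. The accumulator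
  balances the energy: \<open>h a b + k\<close> is constant along the walk.\<close>

fun pair_walk :: "int list \<Rightarrow> int \<Rightarrow> int \<Rightarrow> int \<Rightarrow> (int \<times> int \<times> int) option" where
  "pair_walk [] a b k = Some (a, b, k)"
| "pair_walk (s # l) a b k = (let i = \<bar>s\<bar> - 1 in
     if 0 < s then
       if count_list (epss b) i < count_list (phis a) i
       then (case up i a of None \<Rightarrow> None | Some c \<Rightarrow> pair_walk l c b (k - delta i))
       else (case up i b of None \<Rightarrow> None | Some c \<Rightarrow> pair_walk l a c (k + delta i))
     else
       if count_list (epss b) i \<le> count_list (phis a) i
       then (case dn i a of None \<Rightarrow> None | Some c \<Rightarrow> pair_walk l c b (k + delta i))
       else (case dn i b of None \<Rightarrow> None | Some c \<Rightarrow> pair_walk l a c (k - delta i)))"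

section \<open>Energy along walks in the tensor square\<close>

lemma phis_count: "i \<in> set (phis a) \<longleftrightarrow> 0 < count_list (phis a) i"
  by (metis count_list_0_iff gr0I less_numeral_extra(3))

lemma epss_count: "i \<in> set (epss a) \<longleftrightarrow> 0 < count_list (epss a) i"
  by (metis count_list_0_iff gr0I less_numeral_extra(3))

text \<open>The rules for \<open>e\<close> are those for \<open>f\<close> read at the target.
  Undoing a step on the left raises \<phi> by one, which makes a weak inequality strict; undoing one
  on the right lowers \<epsilon> by one, which makes a strict inequality weak.\<close>

lemma tensor_rules:
  assumes h: "tensor_invariant h" and ab: "a \<in> set ids" "b \<in> set ids"
  shows "count_list (epss b) i < count_list (phis a) i \<Longrightarrow> up i a = Some c \<Longrightarrow> h a b = h c b - delta i"
    and "count_list (phis a) i \<le> count_list (epss b) i \<Longrightarrow> up i b = Some c \<Longrightarrow> h a b = h a c + delta i"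
    and "count_list (epss b) i \<le> count_list (phis a) i \<Longrightarrow> dn i a = Some c \<Longrightarrow> h a b = h c b + delta i"
    and "count_list (phis a) i < count_list (epss b) i \<Longrightarrow> dn i b = Some c \<Longrightarrow> h a b = h a c - delta i"
proof -
  have L: "h c b = h a b + delta i" if "a \<in> set ids" "b \<in> set ids" "count_list (epss b) i < count_list (phis a) i" "up i a = Some c" for a b c
    using h that up_colours[OF that(1,4)] unfolding tensor_invariant_def by blast
  have R: "h a c = h a b - delta i" if "a \<in> set ids" "b \<in> set ids" "count_list (phis a) i \<le> count_list (epss b) i" "up i b = Some c" for a b c
    using h that up_colours[OF that(2,4)] unfolding tensor_invariant_def by blast
  show "count_list (epss b) i < count_list (phis a) i \<Longrightarrow> up i a = Some c \<Longrightarrow> h a b = h c b - delta i"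
    using L[OF ab] by simp
  show "count_list (phis a) i \<le> count_list (epss b) i \<Longrightarrow> up i b = Some c \<Longrightarrow> h a b = h a c + delta i"
    using R[OF ab] by simp
  show "h a b = h c b + delta i" if le: "count_list (epss b) i \<le> count_list (phis a) i" and d: "dn i a = Some c"
  proof -
    note c = dnD[OF ab(1) d]
    have "count_list (epss b) i < count_list (phis c) i" using upD(3)[OF c] le by simp
    then show ?thesis using L[OF c(1) ab(2) _ c(2)] by simp
  qed
  show "h a b = h a c - delta i" if le: "count_list (phis a) i < count_list (epss b) i" and d: "dn i b = Some c"
  proof -
    note c = dnD[OF ab(2) d]
    have "count_list (phis a) i \<le> count_list (epss c) i" using upD(4)[OF c] le by simp
    then show ?thesis using R[OF ab(1) c(1) _ c(2)] by simp
  qed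
qed

lemma pair_walk:
  assumes h: "tensor_invariant h"
  shows "a \<in> set ids \<Longrightarrow> b \<in> set ids \<Longrightarrow> pair_walk l a b k = Some (a', b', k') \<Longrightarrow>
    h a b + k = h a' b' + k' \<and> a' \<in> set ids \<and> b' \<in> set ids"
proof (induction l arbitrary: a b k)
  case (Cons s l)
  define i where "i = \<bar>s\<bar> - 1"
  note T = tensor_rules[OF h Cons.prems(1,2), of i]
  have w: "(if 0 < s then
       if count_list (epss b) i < count_list (phis a) i
       then (case up i a of None \<Rightarrow> None | Some c \<Rightarrow> pair_walk l c b (k - delta i))
       else (case up i b of None \<Rightarrow> None | Some c \<Rightarrow> pair_walk l a c (k + delta i))
     else
       if count_list (epss b) i \<le> count_list (phis a) i
       then (case dn i a of None \<Rightarrow> None | Some c \<Rightarrow> pair_walk l c b (k + delta i))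
       else (case dn i b of None \<Rightarrow> None | Some c \<Rightarrow> pair_walk l a c (k - delta i))) = Some (a', b', k')"
    using Cons.prems(3) unfolding pair_walk.simps Let_def i_def[symmetric] .
  consider c where "count_list (epss b) i < count_list (phis a) i" "up i a = Some c" "pair_walk l c b (k - delta i) = Some (a', b', k')"
    | c where "count_list (phis a) i \<le> count_list (epss b) i" "up i b = Some c" "pair_walk l a c (k + delta i) = Some (a', b', k')"
    | c where "count_list (epss b) i \<le> count_list (phis a) i" "dn i a = Some c" "pair_walk l c b (k + delta i) = Some (a', b', k')"
    | c where "count_list (phis a) i < count_list (epss b) i" "dn i b = Some c" "pair_walk l a c (k - delta i) = Some (a', b', k')"
    using w by (auto simp: not_less not_le split: if_splits option.splits)
  then show ?case
  proof cases
    case 1 then show ?thesis using Cons.IH[OF upD(1)[OF Cons.prems(1) 1(2)] Cons.prems(2) 1(3)] T(1) by simp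
  next
    case 2 then show ?thesis using Cons.IH[OF Cons.prems(1) upD(1)[OF Cons.prems(2) 2(2)] 2(3)] T(2) by simp
  next
    case 3 then show ?thesis using Cons.IH[OF dnD(1)[OF Cons.prems(1) 3(2)] Cons.prems(2) 3(3)] T(3) by simp
  next
    case 4 then show ?thesis using Cons.IH[OF Cons.prems(1) dnD(1)[OF Cons.prems(2) 4(2)] 4(3)] T(4) by simp
  qed
qed simp

section \<open>Upper bound for the energy\<close>

definition size_of :: "int \<Rightarrow> int" where "size_of a = lo a + int (length (extras a))"

text \<open>\<open>size_of\<close> counts blocks relative to the column of all numbers below 0, so
  one more block counts 1 and one more period counts 30. The bounds of 100 are crude; they keep the
  termination measures below positive.\<close>

definition chk_size :: "int \<Rightarrow> bool" where
  "chk_size a = (- 100 \<le> size_of a \<and> size_of a \<le> 100 \<and>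
     list_all (\<lambda>(i, t, b). size_of b + 30 * delta i = size_of a + 1) (adds a))"

lemma all_size: "list_all chk_size ids"
  by (simp add: ids_simps chk_size_def size_of_def table_simps delta_def)

lemma size_bounds: "a \<in> set ids \<Longrightarrow> - 100 \<le> size_of a \<and> size_of a \<le> 100"
  using all_size unfolding list_all_iff chk_size_def by blast

lemma size_up:
  assumes a: "a \<in> set ids" and u: "up i a = Some b"
  shows "size_of b + 30 * delta i = size_of a + 1"
proof -
  obtain t where "first i (adds a) = Some (t, b)" using u by (auto simp: up_def split: if_splits)
  then have "(i, t, b) \<in> set (adds a)" by (rule first_SomeD)
  moreover have "chk_size a" using all_size a by (simp only: list_all_iff)
  ultimately show ?thesis unfolding chk_size_def list_all_iff by blast
qed

text \<open>Apart from 0 and 1, every entry can be raised by an \<open>e\<close> of nonzero colour.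
  To the right of 0 or 1, either such an \<open>e\<close> acts on the right factor or the pair is
  one of the eight listed.\<close>

definition chk_top :: "int \<Rightarrow> bool" where
  "chk_top a = ((a = 0 \<or> a = 1 \<or> list_ex (\<lambda>i. i \<noteq> 0) (epss a)) \<and>
     (list_ex (\<lambda>i. i \<noteq> 0 \<and> count_list (phis 0) i < count_list (epss a) i) (epss a) \<or> list_ex (\<lambda>(x, y, l). x = 0 \<and> y = a) top_walks) \<and>
     (list_ex (\<lambda>i. i \<noteq> 0 \<and> count_list (phis 1) i < count_list (epss a) i) (epss a) \<or> list_ex (\<lambda>(x, y, l). x = 1 \<and> y = a) top_walks))"

lemma all_top: "list_all chk_top ids"
  by (simp add: ids_simps chk_top_def table_simps top_walks_def)

text \<open>At the end of such a walk the energy of the starting pair is \<open>h 0 0 + k\<close>,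
  so \<open>k \<le> 0\<close> is the required bound.\<close>

lemma top_walks_ok: "list_all (\<lambda>(x, y, l). case pair_walk l x y 0 of None \<Rightarrow> False | Some (a, b, k) \<Rightarrow> a = 0 \<and> b = 0 \<and> k \<le> 0) top_walks"
  by (simp add: top_walks_def up_def dn_def table_simps delta_def Let_def)

text \<open>An \<open>e\<close> of nonzero colour keeps the energy and removes one block, hence the
  induction on the total size. That size is at least -200, so the offset 300 keeps the measure
  positive.\<close>

lemma tensor_upper_bound:
  assumes h: "tensor_invariant h"
  shows "a \<in> set ids \<Longrightarrow> b \<in> set ids \<Longrightarrow> h a b \<le> h 0 0"
proof (induction "nat (size_of a + size_of b + 300)" arbitrary: a b rule: less_induct)
  case less
  note T = tensor_rules[OF h less.prems]
  have dec: "size_of c = size_of a - 1" if "a \<in> set ids" "dn i a = Some c" "i \<noteq> 0" for a c i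
    using size_up[OF dnD[OF that(1,2)]] that(3) by (simp add: delta_def)
  have left: ?case if i: "i \<noteq> 0" "i \<in> set (epss a)" "count_list (epss b) i \<le> count_list (phis a) i" for i
  proof -
    obtain c where c: "dn i a = Some c" using i dn_eq_None_iff[OF less.prems(1), of i] by auto
    have "nat (size_of c + size_of b + 300) < nat (size_of a + size_of b + 300)"
      using dec[OF less.prems(1) c i(1)] size_bounds[OF less.prems(1)] size_bounds[OF less.prems(2)] by simp
    from less.hyps[OF this dnD(1)[OF less.prems(1) c] less.prems(2)] show ?thesis
      using T(3)[OF i(3) c] i(1) by (simp add: delta_def)
  qed
  have right: ?case if i: "i \<noteq> 0" "count_list (phis a) i < count_list (epss b) i" for i
  proof -
    have "i \<in> set (epss b)" using i(2) epss_count by simp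
    then obtain c where c: "dn i b = Some c" using dn_eq_None_iff[OF less.prems(2), of i] by auto
    have "nat (size_of a + size_of c + 300) < nat (size_of a + size_of b + 300)"
      using dec[OF less.prems(2) c i(1)] size_bounds[OF less.prems(1)] size_bounds[OF less.prems(2)] by simp
    from less.hyps[OF this less.prems(1) dnD(1)[OF less.prems(2) c]] show ?thesis
      using T(4)[OF i(2) c] i(1) by (simp add: delta_def)
  qed
  have ca: "chk_top a" "chk_top b" using all_top less.prems by (simp_all only: list_all_iff)
  have base: ?case if top: "list_ex (\<lambda>(x, y, l). x = a \<and> y = b) top_walks"
  proof -
    obtain w where "w \<in> set top_walks" "case w of (x, y, l) \<Rightarrow> x = a \<and> y = b"
      using top unfolding list_ex_iff by blast
    moreover obtain x y l where "w = (x, y, l)" by (rule prod_cases3)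
    ultimately have "(a, b, l) \<in> set top_walks" by simp
    then have "case pair_walk l a b 0 of None \<Rightarrow> False | Some (a, b, k) \<Rightarrow> a = 0 \<and> b = 0 \<and> k \<le> 0"
      using top_walks_ok unfolding list_all_iff by blast
    then obtain k where "pair_walk l a b 0 = Some (0, 0, k)" "k \<le> 0" by (auto split: option.splits)
    then show ?thesis using pair_walk[OF h less.prems] by fastforce
  qed
  consider i where "i \<noteq> 0" "i \<in> set (epss a)" | "a = 0" | "a = 1"
    using ca(1) by (auto simp: chk_top_def list_ex_iff)
  then show ?case
  proof cases
    case 1
    \<comment> \<open>If \<open>e\<close> of colour \<open>i\<close> does not kill \<open>a\<close>,
      it acts on the pair in any case: the tensor product rule only decides on which factor.\<close>
    then show ?thesis using left right by (meson not_le)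
  next
    case 2
    then show ?thesis using ca(2) base right unfolding chk_top_def list_ex_iff[of _ "epss b"] by blast
  next
    case 3
    then show ?thesis using ca(2) base right unfolding chk_top_def list_ex_iff[of _ "epss b"] by blast
  qed
qed

section \<open>Containment between translated columns\<close>

definition subset_test :: "int \<Rightarrow> int \<Rightarrow> int \<Rightarrow> bool" where
  "subset_test a b k = (list_all (\<lambda>t. in_col b (t - 30 * k)) (extras a) \<and>
     (if lo a \<le> lo b + 30 * k then True else list_all (\<lambda>t. in_col b (t - 30 * k)) [lo b + 30 * k..lo a - 1]))"

text \<open>Below the threshold of the shifted \<open>b\<close> containment is automatic; what
  remains are the further blocks of \<open>a\<close> and the gap between the two thresholds, both
  finite.\<close>

lemma subset_test: "subset_test a b k \<Longrightarrow> col_set a \<subseteq> shift k (col_set b)"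
proof
  fix t assume s: "subset_test a b k" and t: "t \<in> col_set a"
  then have "t \<in> set (extras a) \<or> t < lo a" by (auto simp: col_set_eq)
  then consider "t \<in> set (extras a)" | "t < lo b + 30 * k" | "lo b + 30 * k \<le> t" "t < lo a"
    by linarith
  then have "in_col b (t - 30 * k)"
  proof cases
    case 1 then show ?thesis using s by (simp add: subset_test_def list_all_iff)
  next
    case 2 then show ?thesis by (simp add: in_col_def)
  next
    case 3
    then have "t \<in> set [lo b + 30 * k..lo a - 1]" "\<not> lo a \<le> lo b + 30 * k" by simp_all
    then show ?thesis using s unfolding subset_test_def list_all_iff by metis
  qed
  then show "t \<in> shift k (col_set b)" by (simp add: col_set_def)
qed

text \<open>The numbers below 34 and those in the list form entry 1, which has the lowest threshold,
  moved up by two periods and without its 0-block 60. Each entry fits inside this set and covers it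
  after a move by two periods.\<close>

definition chk_far :: "int \<Rightarrow> bool" where
  "chk_far a = (list_all (\<lambda>t. t < 34 \<or> t \<in> set [35, 36, 38, 39, 41, 42, 44, 45, 47, 50, 53, 56, 59]) (extras a) \<and> lo a \<le> 34 \<and> 34 \<le> lo a + 60 \<and>
     list_all (\<lambda>t. in_col a (t - 60)) [35, 36, 38, 39, 41, 42, 44, 45, 47, 50, 53, 56, 59])"

lemma all_far: "list_all chk_far ids"
  by (simp add: ids_simps chk_far_def in_col_def table_simps)

lemma far_subset:
  assumes a: "a \<in> set ids" and b: "b \<in> set ids" and k: "2 \<le> k"
  shows "col_set a \<subseteq> shift k (col_set b)"
proof
  fix t assume t: "t \<in> col_set a"
  have A: "chk_far a" "chk_far b" using all_far a b by (simp_all only: list_all_iff)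
  then have "t < 34 \<or> t \<in> set [35, 36, 38, 39, 41, 42, 44, 45, 47, 50, 53, 56, 59]" using t unfolding chk_far_def col_set_eq list_all_iff by force
  then consider "t < 34" | "t \<in> set [35, 36, 38, 39, 41, 42, 44, 45, 47, 50, 53, 56, 59]" "k = 2" | "t < 60" "2 < k" using k by fastforce
  then have "in_col b (t - 30 * k)"
  proof cases
    case 1 then show ?thesis using A(2) k by (simp add: chk_far_def in_col_def)
  next
    case 2 then show ?thesis using A(2) by (auto simp: chk_far_def)
  next
    case 3 then show ?thesis using A(2) by (simp add: chk_far_def in_col_def)
  qed
  then show "t \<in> shift k (col_set b)" by (simp add: col_set_def)
qed

section \<open>Pairs with equal string lengths\<close>

fun lookup :: "int \<Rightarrow> (int \<times> int list) list \<Rightarrow> int list option" where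
  "lookup b [] = None"
| "lookup b ((c, l) # r) = (if c = b then Some l else lookup b r)"

text \<open>A walk ending with \<open>k\<close> shows that the energy is at most
  \<open>1 + k\<close>. For \<open>k \<le> - 2\<close> the value is then not positive at relative
  height 0 or 1; for \<open>k = - 1\<close> it is not positive at height 0, and height 1 must give
  containment. Heights from 2 on are settled by \<open>far_subset\<close>.\<close>

definition stuck_ok :: "int \<Rightarrow> int \<Rightarrow> bool" where
  "stuck_ok a b = (if a = 0 \<and> b = 0 then True else (case lookup b (walks a) of
      None \<Rightarrow> subset_test a b 0 \<and> subset_test a b 1
    | Some l \<Rightarrow> (case pair_walk l a b 0 of None \<Rightarrow> False | Some (x, y, k) \<Rightarrow> if k \<le> - 2 then True else k = - 1 \<and> subset_test a b 1)))"

definition chk_stuck :: "int \<Rightarrow> bool" where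
  "chk_stuck a = list_all (\<lambda>b. if epss b = phis a then stuck_ok a b else True) ids"

lemmas stuck_simps = ids_simps chk_stuck_def table_simps stuck_ok_def walks_simps subset_test_def in_col_def upto.simps up_def dn_def delta_def Let_def

lemma all_stuck: "list_all chk_stuck ids"
  by (simp add: stuck_simps)

text \<open>Sorted lists with equal multiplicities coincide, so the equality of string lengths takes
  the form of the list equality tested by \<open>chk_stuck\<close>.\<close>

lemma all_sorted_weights: "list_all (\<lambda>a. sorted (phis a) \<and> sorted (epss a)) ids"
  by (simp add: ids_simps table_simps)

lemma sorted_count_eq:
  fixes xs ys :: "int list"
  shows "sorted xs \<Longrightarrow> sorted ys \<Longrightarrow> (\<And>i. count_list xs i = count_list ys i) \<Longrightarrow> xs = ys"
proof (induction xs arbitrary: ys)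
  case Nil
  then show ?case by (cases ys) (use Nil.prems(3)[of "hd ys"] in auto)
next
  case (Cons x xs)
  have "x \<in> set ys" using Cons.prems(3)[of x] count_list_0_iff[of ys x] by auto
  then obtain y ys' where ys: "ys = y # ys'" by (cases ys) auto
  then have "y \<in> set (x # xs)" using Cons.prems(3)[of y] count_list_0_iff[of "x # xs" y] by auto
  then have xy: "x = y" using \<open>x \<in> set ys\<close> Cons.prems(1,2) ys by (intro antisym) auto
  have "count_list xs i = count_list ys' i" for i using Cons.prems(3)[of i] ys xy by (auto split: if_splits)
  then have "xs = ys'" using Cons.IH[of ys'] Cons.prems(1,2) ys by auto
  then show ?case using ys xy by simp
qed

lemma stuck_weights:
  assumes "a \<in> set ids" "b \<in> set ids" "\<And>i. count_list (phis a) i = count_list (epss b) i"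
  shows "phis a = epss b"
  using all_sorted_weights assms(1,2) unfolding list_all_iff by (intro sorted_count_eq assms(3)) blast+

lemma stuck_case:
  assumes h: "tensor_invariant h" and h0: "h 0 0 = 1" and a: "a \<in> set ids" and b: "b \<in> set ids"
    and eq: "phis a = epss b" and not_sub: "\<not> col_set a \<subseteq> shift k (col_set b)" and k: "0 \<le> k" and pos: "1 \<le> h a b + k"
  shows "h a b + k = 2"
proof -
  have "k < 2" using far_subset[OF a b] not_sub by (meson not_le)
  then have k01: "k = 0 \<or> k = 1" using k by auto
  have "chk_stuck a" using all_stuck a by (simp only: list_all_iff)
  then have stuck_ok: "stuck_ok a b" using b eq unfolding chk_stuck_def list_all_iff by metis
  show ?thesis
  proof (cases "a = 0 \<and> b = 0")
    case True
    \<comment> \<open>A column contains itself, so the ground state pair can fail only at relative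
      height 1, where the value is 2.\<close>
    then have "k \<noteq> 0" using not_sub by auto
    then show ?thesis using True k01 h0 by auto
  next
    case False
    show ?thesis
    proof (cases "lookup b (walks a)")
      case None
      then have "subset_test a b k" using stuck_ok False k01 by (auto simp: stuck_ok_def)
      then show ?thesis using subset_test not_sub by blast
    next
      case (Some l)
      then obtain x y j where w: "pair_walk l a b 0 = Some (x, y, j)" "j \<le> - 2 \<or> j = - 1 \<and> subset_test a b 1"
        using stuck_ok False by (auto simp: stuck_ok_def split: option.splits if_splits)
      then have "h a b = h x y + j" "x \<in> set ids" "y \<in> set ids" using pair_walk[OF h a b w(1)] by auto
      then have "h a b \<le> 1 + j" using tensor_upper_bound[OF h] h0 by fastforce
      then show ?thesis using w(2) k01 pos subset_test not_sub by auto
    qed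
  qed
qed

text \<open>The measure is the number of blocks by which the moved right column exceeds the left
  one. A step on either side lowers it by exactly one, and it stays positive because
  \<open>k\<close> is nonnegative and sizes are bounded by 100.\<close>

lemma not_subset_case:
  assumes h: "tensor_invariant h" and h0: "h 0 0 = 1"
  shows "a \<in> set ids \<Longrightarrow> b \<in> set ids \<Longrightarrow> \<not> col_set a \<subseteq> shift k (col_set b) \<Longrightarrow> 1 \<le> h a b + k \<Longrightarrow> h a b + k = 2"
proof (induction "nat (size_of b + 30 * k - size_of a + 300)" arbitrary: a b k rule: less_induct)
  case less
  note T = tensor_rules[OF h less.prems(1,2)]
  have k: "0 \<le> k" using tensor_upper_bound[OF h less.prems(1,2)] h0 less.prems(4) by simp
  note sz = size_bounds[OF less.prems(1)] size_bounds[OF less.prems(2)]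
  show ?case
  proof (cases "\<forall>i. count_list (phis a) i = count_list (epss b) i")
    case True
    then show ?thesis using stuck_case[OF h h0 less.prems(1,2) stuck_weights] less.prems k by blast
  next
    case False
    then obtain i where "count_list (epss b) i < count_list (phis a) i \<or> count_list (phis a) i < count_list (epss b) i"
      by (meson linorder_neqE_nat)
    then show ?thesis
    proof
      assume i: "count_list (epss b) i < count_list (phis a) i"
      then have "i \<in> set (phis a)" using phis_count by simp
      then obtain c where c: "up i a = Some c" using up_eq_None_iff[OF less.prems(1), of i] by auto
      obtain t where t: "insert t (col_set a) = shift (delta i) (col_set c)" using upD(5)[OF less.prems(1) c] by blast
      have ns: "\<not> col_set c \<subseteq> shift (k - delta i) (col_set b)"
      proof
        assume "col_set c \<subseteq> shift (k - delta i) (col_set b)"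
        then have "shift (delta i) (col_set c) \<subseteq> shift k (col_set b)" by (force simp: algebra_simps)
        then show False using t less.prems(3) by blast
      qed
      have e: "h c b + (k - delta i) = h a b + k" using T(1)[OF i c] by simp
      have "nat (size_of b + 30 * (k - delta i) - size_of c + 300) < nat (size_of b + 30 * k - size_of a + 300)"
        using size_up[OF less.prems(1) c] sz k by (simp add: algebra_simps)
      from less.hyps[OF this upD(1)[OF less.prems(1) c] less.prems(2) ns] show ?thesis using e less.prems(4) by simp
    next
      assume i: "count_list (phis a) i < count_list (epss b) i"
      then have "i \<in> set (epss b)" using epss_count by simp
      then obtain c where c: "dn i b = Some c" using dn_eq_None_iff[OF less.prems(2), of i] by auto
      note d = dnD[OF less.prems(2) c]
      obtain t where t: "insert t (col_set c) = shift (delta i) (col_set b)" using upD(5)[OF d] by blast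
      have ns: "\<not> col_set a \<subseteq> shift (k - delta i) (col_set c)"
      proof
        assume "col_set a \<subseteq> shift (k - delta i) (col_set c)"
        also have "\<dots> \<subseteq> shift (k - delta i) (shift (delta i) (col_set b))" using t by (force simp: shift_def)
        finally show False using less.prems(3) by simp
      qed
      have e: "h a c + (k - delta i) = h a b + k" using T(4)[OF i c] by simp
      have "nat (size_of c + 30 * (k - delta i) - size_of a + 300) < nat (size_of b + 30 * k - size_of a + 300)"
        using size_up[OF d] sz k by (simp add: algebra_simps)
      from less.hyps[OF this less.prems(1) d(1) ns] show ?thesis using e less.prems(4) by simp
    qed
  qed
qed

theorem proposition5p8:
  fixes H :: "block set set \<times> block set set \<Rightarrow> int"
    and m :: "nat \<Rightarrow> int"
    and \<Phi> :: "nat \<Rightarrow> block set \<Rightarrow> affine"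
    and W :: "(nat \<times> block) set"
    and r :: nat
  assumes "energy_function H"
    and "ground_exponents H m"
    and "column_identification m \<Phi>"
    and "W \<in> Z_Lambda0 H \<Phi>"
    and "H_aff H (\<Phi> (Suc r) (wall_column W (Suc r))) (\<Phi> r (wall_column W r)) \<noteq> 2"
  shows "\<forall>b. (Suc r, b) \<in> W \<longrightarrow> (r, b) \<in> W"
proof -
  \<comment> \<open>The normalisation of \<open>H\<close> concerns classes of nonzero weight,
    whereas the ground state class has weight 0. Its energy is therefore carried along as a
    constant, which cancels against the difference of consecutive exponents
    \<open>m\<close>.\<close>
  define h where "h a b = H (cls a, cls b) - H (cls 0, cls 0) + 1" for a b
  have h: "tensor_invariant h" and h0: "h 0 0 = 1"
    using energy_tensor_invariant[OF assms(1)] by (simp_all add: tensor_invariant_def h_def)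
  have young: "wall_column W s \<in> young_columns" for s
    using assms(4) by (simp add: Z_Lambda0_def young_wall_def)
  obtain a n where a: "a \<in> set ids" "wall_column W (Suc r) = col n a" using young young_columns_col by blast
  obtain b k where b: "b \<in> set ids" "wall_column W r = col k b" using young young_columns_col by blast
  have "0 \<in> set ids" by (simp add: set_ids)
  then have "H (cls 0, cls 0) + m (Suc r) - m r = 1"
    using assms(2) unfolding ground_exponents_def ground_column_col by (simp add: class_of_col_cls)
  \<comment> \<open>By \<open>identification\<close> the exponents of the two columns are
    \<open>m (Suc r) - n\<close> and \<open>m r - k\<close>, so only the relative height
    \<open>k - n\<close> remains.\<close>
  then have D: "H_aff H (\<Phi> (Suc r) (wall_column W (Suc r))) (\<Phi> r (wall_column W r)) = h a b + (k - n)"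
    using identification[OF assms(3)] a b by (simp add: h_def)
  have "0 < H_aff H (\<Phi> (Suc r) (wall_column W (Suc r))) (\<Phi> r (wall_column W r))"
    using assms(4) unfolding Z_Lambda0_def by blast
  then have "1 \<le> h a b + (k - n)" unfolding D by simp
  then have "col_set a \<subseteq> shift (k - n) (col_set b)"
    using not_subset_case[OF h h0 a(1) b(1)] assms(5) unfolding D by blast
  then have "shift n (col_set a) \<subseteq> shift k (col_set b)" by (force simp: algebra_simps)
  then have "wall_column W (Suc r) \<subseteq> wall_column W r" unfolding a(2) b(2) col_def by (rule image_mono)
  then show ?thesis by (auto simp: wall_column_def)
qed

end
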